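(* Let $p\in(1,2]$ with dual exponent $q\ge2$, let $\mathcal{A}$ be the $\ell_p$ unit ball in $\mathbb{R}^d$, $T$ the horizon and $\delta\in(0,1)$. Assume the covariance matrix $\Sigma$ is unknown. In the stochastic linear bandit with parameter noise model, with probability at least $1-2\delta$ the regret of the VALEE algorithm (context, unknown-covariance version) is bounded by $$\widetilde{O}\Big(d^{2/3+2/(3q)}\log^{2/3}(1/\delta)(Tq)^{1/3}+\sqrt{dTq\log(1/\delta)\,\sigma_q^2}\Big),$$ where $\sigma_q^2=\big(\sum_{i=1}^d\Sigma_{ii}^{q/2}\big)^{2/q}$ and $\widetilde O$ hides logarithmic factors.
   Context: Stochastic linear bandits with parameter noise: fixed unknown distribution $\nu$ on $\mathbb{R}^d$ with mean $\theta^\star$ and covariance $\Sigma$; at each round $t=1,\dots,T$ the learner picks $a_t\in\mathcal{A}$, $\theta_t\sim\nu$ is drawn independently, and $X_t=a_t^\top\theta_t$ is observed; $|a^\top\theta|\le1$ a.s. for all $a\in\mathcal{A}$. Regret $\mathcal{R}_T=\sum_{t=1}^T(a^\star-a_t)^\top\theta^\star$, $a^\star\in\arg\max_{a\in\mathcal{A}}a^\top\theta^\star$. $e_i$ is the $i$-th standard basis vector. $\mathcal{SR}(\bar\varepsilon,\bar\delta)$ is the Stopping Rule algorithm of Dagum et al.: from samples of a $[0,1]$-valued variable with mean $\mu>0$ it outputs $\hat\mu$ with $|\hat\mu-\mu|\le\bar\varepsilon\mu$ w.p. $1-\bar\delta$, using $O(\log(1/\bar\delta)/(\bar\varepsilon^2\mu))$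 samples w.p. $1-\bar\delta$. Variance estimation of $a$ with threshold $\tau$, confidence $\bar\delta$, error $\bar\varepsilon$: run $\mathcal{SR}(\bar\varepsilon,\bar\delta)$ on samples $Z(a)=\max\{\frac14(X_s-X_{s+1})^2,\tau/2\}$ where $X_s,X_{s+1}$ are rewards from playing $a$ twice. VALEE (unknown covariance) with threshold $\tau=d^{1/3-2/(3q)}\log^{1/3}(d/\delta)/(Tq)^{1/3}$: for each $i\in[d]$ run variance estimation on $e_i$ with threshold $\tau$, confidence $\delta/d$, error $1/2$, giving $\hat\sigma^2(e_i)$; set $\hat\sigma_q^2=(\sum_i\hat\sigma^2(e_i)^{q/2})^{2/q}$. Then set $\kappa=\lceil8\log(d\log(T)/\delta)\rceil$, $\alpha=(d\kappa/(Tq\hat\sigma_q^2))^{1/4}$, $\hat N_0=2$, $\|\hat\theta^{(0)}\|_q=0$. Exploration: for $j=1,2,\dots$ as long as $\hat N_{j-1}\ge\|\hat\theta^{(j-1)}\|_q$: $\hat N_j=\hat N_{j-1}/2$, $\hat\varepsilon_j=\alpha\sqrt{\hat N_j}$, $T_j(e_i)=\lceil8/\hat\varepsilon_j^2\rceil$; for $\ell=1,\dots,\kappa$ play each $e_i$ for $T_j(e_i)$ rounds and let $\hat\theta^{(j,\ell)}_i$ be the average reward; $\hat\theta^{(j)}_i=\mathrm{median}_{\ell\le\kappa}\hat\theta^{(j,\ell)}_i$. Once $\hat N_j<\|\hat\theta^{(j)}\|_q$, play for all remaining rounds $\hat a$ with $\hat a_i=\mathrm{sign}(\hat\theta^{(j)}_i)|\hat\theta^{(j)}_i|^{q-1}/\|\hat\theta^{(j)}\|_q^{q-1}$.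 *)

theory Defs
  imports "HOL-Probability.Probability"
begin

text \<open>Vectors in R^d are represented as functions nat => real; only the coordinates
  0, ..., d-1 matter (coordinate i of the paper is coordinate i-1 here).\<close>

definition inner_d :: "nat \<Rightarrow> (nat \<Rightarrow> real) \<Rightarrow> (nat \<Rightarrow> real) \<Rightarrow> real" where
  "inner_d d a b = (\<Sum>i<d. a i * b i)"

definition unit_vec :: "nat \<Rightarrow> nat \<Rightarrow> real" where
  "unit_vec i = (\<lambda>k. if k = i then 1 else 0)"

definition lp_ball :: "nat \<Rightarrow> real \<Rightarrow> (nat \<Rightarrow> real) set" where
  "lp_ball d p = {a. (\<forall>i\<ge>d. a i = 0) \<and> (\<Sum>i<d. \<bar>a i\<bar> powr p) \<le> 1}"

definition dual_exp :: "real \<Rightarrow> real" where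
  "dual_exp p = p / (p - 1)"

definition qnorm :: "nat \<Rightarrow> real \<Rightarrow> (nat \<Rightarrow> real) \<Rightarrow> real" where
  "qnorm d q v = (\<Sum>i<d. \<bar>v i\<bar> powr q) powr (1 / q)"

definition median :: "real list \<Rightarrow> real" where
  "median xs = sort xs ! ((length xs - 1) div 2)"

subsection \<open>Stopping Rule algorithm of Dagum, Karp, Luby, Ross\<close>

text \<open>SR(eps, delta): with Upsilon = 4(e-2) ln(2/delta)/eps^2 and Upsilon1 = 1 + (1+eps) Upsilon,
  draw samples Z_1, Z_2, ... until S = Z_1 + ... + Z_N >= Upsilon1 and output Upsilon1 / N.\<close>
definition sr_threshold :: "real \<Rightarrow> real \<Rightarrow> real" where
  "sr_threshold eps dl = 1 + (1 + eps) * (4 * (exp 1 - 2) * ln (2 / dl) / eps\<^sup>2)"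

definition valee_tau :: "nat \<Rightarrow> real \<Rightarrow> nat \<Rightarrow> real \<Rightarrow> real" where
  "valee_tau d q T \<delta> =
     real d powr (1/3 - 2 / (3 * q)) * ln (real d / \<delta>) powr (1/3) / (real T * q) powr (1/3)"

definition var_sample :: "real \<Rightarrow> real \<Rightarrow> real \<Rightarrow> real" where
  "var_sample \<tau> x y = max ((x - y)\<^sup>2 / 4) (\<tau> / 2)"

definition valee_kappa :: "nat \<Rightarrow> nat \<Rightarrow> real \<Rightarrow> nat" where
  "valee_kappa d T \<delta> = nat \<lceil>8 * ln (real d * ln (real T) / \<delta>)\<rceil>"

definition sigma_q_hat :: "nat \<Rightarrow> real \<Rightarrow> (nat \<Rightarrow> real) \<Rightarrow> real" where
  "sigma_q_hat d q est = (\<Sum>i<d. est i powr (q / 2)) powr (2 / q)"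

definition valee_alpha :: "nat \<Rightarrow> real \<Rightarrow> nat \<Rightarrow> nat \<Rightarrow> real \<Rightarrow> real" where
  "valee_alpha d q T \<kappa> s = (real d * real \<kappa> / (real T * q * s)) powr (1/4)"

definition N_hat :: "nat \<Rightarrow> real" where
  "N_hat j = 2 / 2 ^ j"

text \<open>Number of plays of each e_i in each of the kappa repetitions of phase j.\<close>
definition phase_len :: "real \<Rightarrow> nat \<Rightarrow> nat" where
  "phase_len \<alpha> j = nat \<lceil>8 / (\<alpha> * sqrt (N_hat j))\<^sup>2\<rceil>"

definition a_hat :: "nat \<Rightarrow> real \<Rightarrow> (nat \<Rightarrow> real) \<Rightarrow> nat \<Rightarrow> real" where
  "a_hat d q th = (\<lambda>i. if i < d then sgn (th i) * \<bar>th i\<bar> powr (q - 1) / qnorm d q th powr (q - 1)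
                       else 0)"

text \<open>
  VarEst i est N S pend : variance estimation (Stopping Rule) for coordinate i; est holds the
     estimates for coordinates < i; N samples and their sum S so far; pend is the first reward of
     the current pair of plays of e_i (if already observed).
  Explore alpha kappa j l i m s tab : exploration phase j, repetition l (0-based), coordinate i;
     m plays of e_i done in the current block with reward sum s; tab l i stores the averages.
  Exploit a : play a forever.\<close>
datatype valee_state =
    VarEst nat "nat \<Rightarrow> real" nat real "real option"
  | Explore real nat nat nat nat nat real "nat \<Rightarrow> nat \<Rightarrow> real"
  | Exploit "nat \<Rightarrow> real"

fun valee_action :: "valee_state \<Rightarrow> nat \<Rightarrow> real" where
  "valee_action (VarEst i _ _ _ _) = unit_vec i"
| "valee_action (Explore _ _ _ _ i _ _ _) = unit_vec i"
| "valee_action (Exploit a) = a"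

definition valee_init :: valee_state where
  "valee_init = VarEst 0 (\<lambda>_. 0) 0 0 None"

fun valee_update :: "nat \<Rightarrow> real \<Rightarrow> nat \<Rightarrow> real \<Rightarrow> valee_state \<Rightarrow> real \<Rightarrow> valee_state" where
  "valee_update d q T \<delta> (VarEst i est N S None) x = VarEst i est N S (Some x)"
| "valee_update d q T \<delta> (VarEst i est N S (Some x0)) x =
     (let Y1 = sr_threshold (1/2) (\<delta> / real d);
          N' = Suc N;
          S' = S + var_sample (valee_tau d q T \<delta>) x0 x
      in if S' < Y1 then VarEst i est N' S' None
         else (let est' = est(i := Y1 / real N') in
               if Suc i < d then VarEst (Suc i) est' 0 0 None
               else (let \<kappa> = valee_kappa d T \<delta>;
                         \<alpha> = valee_alpha d q T \<kappa> (sigma_q_hat d q est')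
                     in Explore \<alpha> \<kappa> 1 0 0 0 0 (\<lambda>_ _. 0))))"
| "valee_update d q T \<delta> (Explore \<alpha> \<kappa> j l i m s tab) x =
     (let m' = Suc m; s' = s + x
      in if m' < phase_len \<alpha> j then Explore \<alpha> \<kappa> j l i m' s' tab
         else (let tab' = tab(l := (tab l)(i := s' / real m')) in
               if Suc i < d then Explore \<alpha> \<kappa> j l (Suc i) 0 0 tab'
               else if Suc l < \<kappa> then Explore \<alpha> \<kappa> j (Suc l) 0 0 0 tab'
               else (let th = (\<lambda>k. median (map (\<lambda>l'. tab' l' k) [0..<\<kappa>])) in
                     if N_hat j < qnorm d q th then Exploit (a_hat d q th)
                     else Explore \<alpha> \<kappa> (Suc j) 0 0 0 0 (\<lambda>_ _. 0))))"
| "valee_update d q T \<delta> (Exploit a) x = Exploit a"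

text \<open>State before round t+1 (0-based round t), given the parameter draws om 0, om 1, ...\<close>
primrec valee_states ::
  "nat \<Rightarrow> real \<Rightarrow> nat \<Rightarrow> real \<Rightarrow> (nat \<Rightarrow> nat \<Rightarrow> real) \<Rightarrow> nat \<Rightarrow> valee_state" where
  "valee_states d q T \<delta> om 0 = valee_init"
| "valee_states d q T \<delta> om (Suc t) =
     (let st = valee_states d q T \<delta> om t
      in valee_update d q T \<delta> st (inner_d d (valee_action st) (om t)))"

definition valee_act :: "nat \<Rightarrow> real \<Rightarrow> nat \<Rightarrow> real \<Rightarrow> (nat \<Rightarrow> nat \<Rightarrow> real) \<Rightarrow> nat \<Rightarrow> nat \<Rightarrow> real" where
  "valee_act d q T \<delta> om t = valee_action (valee_states d q T \<delta> om t)"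

definition theta_star :: "(nat \<Rightarrow> real) measure \<Rightarrow> nat \<Rightarrow> real" where
  "theta_star \<nu> = (\<lambda>i. integral\<^sup>L \<nu> (\<lambda>\<theta>. \<theta> i))"

definition Sigma_diag :: "(nat \<Rightarrow> real) measure \<Rightarrow> nat \<Rightarrow> real" where
  "Sigma_diag \<nu> i = integral\<^sup>L \<nu> (\<lambda>\<theta>. (\<theta> i - theta_star \<nu> i)\<^sup>2)"

definition sigma_q_sq :: "nat \<Rightarrow> real \<Rightarrow> (nat \<Rightarrow> real) measure \<Rightarrow> real" where
  "sigma_q_sq d q \<nu> = (\<Sum>i<d. Sigma_diag \<nu> i powr (q / 2)) powr (2 / q)"

definition valee_regret ::
  "nat \<Rightarrow> real \<Rightarrow> nat \<Rightarrow> real \<Rightarrow> (nat \<Rightarrow> real) measure \<Rightarrow> (nat \<Rightarrow> nat \<Rightarrow> real) \<Rightarrow> real" where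
  "valee_regret d p T \<delta> \<nu> om =
     (\<Sum>t<T. (SUP a\<in>lp_ball d p. inner_d d a (theta_star \<nu>))
             - inner_d d (valee_act d (dual_exp p) T \<delta> om t) (theta_star \<nu>))"

end

theory Submission
  imports Defs
begin

text \<open>
  The threshold \<open>\<tau>\<close> satisfies \<open>\<tau>^3 T q d^(2/q) = d ln (d/\<delta>)\<close>, which balances the cost
  \<open>d ln (d/\<delta>) / \<tau>\<close> of the variance estimation against the price of treating every variance as at
  least \<open>\<tau>\<close>. On a good event every estimate is of the order of \<open>w i = Sigma i + \<tau>\<close>, and every
  median of means of phase \<open>j\<close> is accurate up to \<open>\<alpha> sqrt (N j * w i)\<close>. As long as exploration
  continues, the gap is at most of order \<open>N j + \<alpha> sqrt (N j * W)\<close>, where \<open>W\<close> is the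
  \<open>q/2\<close>-norm of \<open>w\<close>, so each of the at most \<open>ln T + 1\<close> phases costs
  \<open>O(d \<kappa> / \<alpha>\<^sup>2)\<close>. Once it stops, smoothness of the q-norm bounds the loss per
  round by \<open>O(q \<alpha>\<^sup>2 W)\<close>; the choice of \<open>\<alpha>\<close> makes the two contributions equal.

  Sampling times are random, but the whole schedule is a function of the stopping times of the
  variance estimation. The samples following a stopping time are a fresh copy of the sequence, so
  the concentration bounds need no union bound over starting times.
\<close>

subsection \<open>The q-norm and its dual action\<close>

text \<open>The variance estimates are used up to constant factors only, so a stopping time is
  compared with two fixed sample counts: partial sums are monotone, hence each comparison is an
  event about one fixed sum. Block lengths are random too, but known before their blocks begin,
  which is what the restart at a stopping time asks for. Chebyshev's inequality controls one block,
  and the median over \<open>\<kappa>\<close> repetitions makes the failure probability small enough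
  for a union bound over \<open>d\<close> coordinates and \<open>ln T\<close> phases. The good event
  therefore reaches only up to phase \<open>ln T\<close>; a lower bound for the length of a phase
  shows that no later phase can be completed within the horizon. The algorithm works with
  \<open>ln (d / \<delta>)\<close>, the claim with \<open>ln (1 / \<delta>)\<close>; the difference
  fits into a logarithmic factor once \<open>\<delta> < 1 / 2\<close>, and for larger
  \<open>\<delta>\<close> the claimed probability is not positive. If \<open>\<tau> > 1\<close> or
  \<open>T < 3\<close>, the trivial bound \<open>2 * T\<close> is already of the right
  order.\<close>

text \<open>Hoelder's inequality with exponents \<open>1 / (1 - s)\<close> and \<open>1 / s\<close>:
  once both sums are normalised to 1 it is the weighted Young inequality, summed. Zero sums are
  split off because the normalisation divides by them.\<close>

lemma sum_powr_mult_le: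
  fixes u v :: "'a \<Rightarrow> real"
  assumes "finite I" "0 < s" "s < 1"
    and u: "\<And>i. i \<in> I \<Longrightarrow> 0 \<le> u i" and v: "\<And>i. i \<in> I \<Longrightarrow> 0 \<le> v i"
  shows "(\<Sum>i\<in>I. u i powr (1 - s) * v i powr s) \<le> (\<Sum>i\<in>I. u i) powr (1 - s) * (\<Sum>i\<in>I. v i) powr s"
proof (cases "(\<Sum>i\<in>I. u i) = 0 \<or> (\<Sum>i\<in>I. v i) = 0")
  case True
  then have "u i powr (1 - s) * v i powr s = 0" if "i \<in> I" for i
    using that assms by (auto simp: sum_nonneg_eq_0_iff)
  then show ?thesis by (subst sum.neutral) auto
next
  case False
  define U where "U = (\<Sum>i\<in>I. u i)"
  define V where "V = (\<Sum>i\<in>I. v i)"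
  have U: "U > 0" and V: "V > 0"
    using False u v unfolding U_def V_def by (auto simp: order.strict_iff_order sum_nonneg)
  have "(\<Sum>i\<in>I. u i powr (1 - s) * v i powr s) / (U powr (1 - s) * V powr s)
      = (\<Sum>i\<in>I. (u i / U) powr (1 - s) * (v i / V) powr s)"
    unfolding sum_divide_distrib using u v U V by (intro sum.cong) (auto simp: powr_divide)
  also have "\<dots> \<le> (\<Sum>i\<in>I. (1 - s) * (u i / U) + s * (v i / V))"
  proof (rule sum_mono)
    fix i assume "i \<in> I"
    show "(u i / U) powr (1 - s) * (v i / V) powr s \<le> (1 - s) * (u i / U) + s * (v i / V)"
      using Youngs_inequality_0[of "1 - s" s "u i / U" "v i / V"] u[OF \<open>i \<in> I\<close>] v[OF \<open>i \<in> I\<close>] U V assms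
      by (cases "u i = 0 \<or> v i = 0") auto
  qed
  also have "\<dots> = (1 - s) * (U / U) + s * (V / V)"
    unfolding U_def V_def sum.distrib sum_divide_distrib sum_distrib_left ..
  also have "\<dots> = 1" using U V by simp
  finally show ?thesis using U V unfolding U_def V_def by (simp add: divide_le_eq)
qed

text \<open>The power function lies above its tangent at \<open>v\<close>; written without division,
  this also covers zero arguments.\<close>

lemma powr_tangent_le:
  fixes u v s :: real
  assumes "0 \<le> u" "0 \<le> v" "1 \<le> s"
  shows "s * (v powr (s - 1) * u) \<le> u powr s + (s - 1) * v powr s"
proof (cases "s = 1 \<or> u = 0 \<or> v = 0")
  case True
  then show ?thesis using assms by (cases "u = 0"; cases "v = 0") auto
next
  case False
  then have "u > 0" "v > 0" "s > 1" using assms by auto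
  then have "(u powr s) powr (1/s) * (v powr s) powr ((s-1)/s) \<le> 1/s * u powr s + ((s-1)/s) * v powr s"
    by (intro Youngs_inequality_0) (auto simp: diff_divide_distrib)
  moreover have "(u powr s) powr (1/s) = u" "(v powr s) powr ((s-1)/s) = v powr (s-1)"
    using \<open>u > 0\<close> \<open>v > 0\<close> \<open>s > 1\<close> by (auto simp: powr_powr)
  ultimately have "s * (u * v powr (s-1)) \<le> s * (1/s * u powr s + ((s-1)/s) * v powr s)"
    using \<open>s > 1\<close> by (simp add: mult_left_mono)
  also have "\<dots> = u powr s + (s-1) * v powr s" using \<open>s > 1\<close> by (simp add: field_simps)
  finally show ?thesis by (simp add: mult.commute)
qed

lemma powr_diff_le:
  fixes u v s :: real
  assumes "0 \<le> v" "v \<le> u" "1 \<le> s"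
  shows "u powr s - v powr s \<le> s * u powr (s - 1) * (u - v)"
proof -
  have "u powr (s - 1) * u = u powr s"
    using assms by (cases "u = 0") (auto simp: powr_mult_base powr_diff)
  with powr_tangent_le[of v u s] assms show ?thesis by (simp add: algebra_simps)
qed

section \<open>Signed powers and a second-order bound for powers of the absolute value\<close>

text \<open>Up to the factor \<open>q\<close>, \<open>spow (q - 1)\<close> is the derivative of the
  \<open>q\<close>-th power of the absolute value, that is, the gradient which the dual action
  normalises.\<close>

definition spow :: "real \<Rightarrow> real \<Rightarrow> real" where
  "spow s x = sgn x * \<bar>x\<bar> powr s"

lemma spow_diff_le_aux:
  fixes x y s :: real
  assumes s: "1 \<le> s" and xy: "\<bar>x\<bar> \<le> \<bar>y\<bar>"
  shows "\<bar>spow s y - spow s x\<bar> \<le> s * \<bar>y\<bar> powr (s - 1) * \<bar>y - x\<bar>"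
proof (cases "sgn x = sgn y \<or> x = 0")
  case True
  then have "\<bar>y - x\<bar> = \<bar>y\<bar> - \<bar>x\<bar>" "\<bar>spow s y - spow s x\<bar> = \<bar>y\<bar> powr s - \<bar>x\<bar> powr s"
    using xy powr_mono2[OF _ abs_ge_zero xy, of s] s
    by (auto simp: sgn_if spow_def split: if_splits)
  then show ?thesis using powr_diff_le[of "\<bar>x\<bar>" "\<bar>y\<bar>" s] assms by simp
next
  case False
  then have y0: "y \<noteq> 0" using xy by auto
  have e1: "\<bar>y - x\<bar> = \<bar>y\<bar> + \<bar>x\<bar>" "\<bar>spow s y - spow s x\<bar> = \<bar>y\<bar> powr s + \<bar>x\<bar> powr s"
    using xy False abs_of_nonneg[OF add_nonneg_nonneg[OF powr_ge_zero[of "\<bar>y\<bar>" s] powr_ge_zero[of "\<bar>x\<bar>" s]]]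
      abs_minus_cancel[of "\<bar>y\<bar> powr s + \<bar>x\<bar> powr s"]
    by (auto simp: sgn_if spow_def split: if_splits)
  have "\<bar>x\<bar> powr s = \<bar>x\<bar> powr (s - 1) * \<bar>x\<bar>" using False by (simp add: powr_diff)
  also have "\<dots> \<le> \<bar>y\<bar> powr (s - 1) * \<bar>x\<bar>" using xy s by (intro mult_right_mono powr_mono2) auto
  finally have "\<bar>y\<bar> powr s + \<bar>x\<bar> powr s \<le> \<bar>y\<bar> powr (s - 1) * (\<bar>y\<bar> + \<bar>x\<bar>)"
    using y0 by (simp add: powr_diff field_simps)
  also have "\<dots> \<le> s * (\<bar>y\<bar> powr (s - 1) * (\<bar>y\<bar> + \<bar>x\<bar>))"
    using s mult_right_mono[of 1 s "\<bar>y\<bar> powr (s - 1) * (\<bar>y\<bar> + \<bar>x\<bar>)"] by simp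
  finally show ?thesis unfolding e1 by (simp add: mult.assoc)
qed

lemma spow_diff_le:
  fixes x y s :: real
  assumes s: "1 \<le> s"
  shows "\<bar>spow s y - spow s x\<bar> \<le> s * max \<bar>x\<bar> \<bar>y\<bar> powr (s - 1) * \<bar>y - x\<bar>"
  using spow_diff_le_aux[OF s, of x y] spow_diff_le_aux[OF s, of y x]
  by (cases "\<bar>x\<bar> \<le> \<bar>y\<bar>") (auto simp: max_def abs_minus_commute)

lemma spow_mult_self: "spow (q - 1) x * x = \<bar>x\<bar> powr q"
  by (cases "x = 0") (auto simp: spow_def sgn_if powr_diff abs_if)

text \<open>Convexity bounds the increment by the gradient at \<open>y\<close>; passing to the
  gradient at \<open>x\<close> costs the Lipschitz bound \<open>spow_diff_le\<close>. Using the full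
  change of the gradient gives \<open>q * (q - 1)\<close> in place of half of it, and no derivative
  is taken.\<close>

lemma abs_powr_taylor_le:
  fixes x y q :: real
  assumes q: "2 \<le> q"
  shows "\<bar>y\<bar> powr q \<le> \<bar>x\<bar> powr q + q * spow (q - 1) x * (y - x)
     + q * (q - 1) * (max \<bar>x\<bar> \<bar>y\<bar> powr (q - 2) * (y - x)\<^sup>2)"
proof -
  have "spow (q - 1) y * x \<le> \<bar>y\<bar> powr (q - 1) * \<bar>x\<bar>"
    by (auto simp: spow_def sgn_if abs_if mult_left_mono)
       (metis abs_ge_zero linorder_not_le mult_nonneg_nonneg mult_nonneg_nonpos order.trans neg_0_le_iff_le powr_ge_zero less_imp_le minus_mult_minus)+
  then have "q * (spow (q - 1) y * x) \<le> q * (\<bar>y\<bar> powr (q - 1) * \<bar>x\<bar>)"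
    using q by (intro mult_left_mono) auto
  also have "\<dots> \<le> \<bar>x\<bar> powr q + (q - 1) * \<bar>y\<bar> powr q"
    using powr_tangent_le[of "\<bar>x\<bar>" "\<bar>y\<bar>" q] q by simp
  finally have "\<bar>y\<bar> powr q \<le> \<bar>x\<bar> powr q + q * (spow (q - 1) y * (y - x))"
    using spow_mult_self[of q y] by (simp add: algebra_simps)
  also have "q * (spow (q - 1) y * (y - x)) = q * spow (q - 1) x * (y - x)
       + q * ((spow (q - 1) y - spow (q - 1) x) * (y - x))"
    by (simp add: algebra_simps)
  also have "(spow (q - 1) y - spow (q - 1) x) * (y - x)
      \<le> \<bar>spow (q - 1) y - spow (q - 1) x\<bar> * \<bar>y - x\<bar>"
    by (metis abs_ge_self abs_mult)
  also have "\<dots> \<le> ((q - 1) * max \<bar>x\<bar> \<bar>y\<bar> powr (q - 1 - 1) * \<bar>y - x\<bar>) * \<bar>y - x\<bar>"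
    using q by (intro mult_right_mono spow_diff_le) auto
  also have "\<dots> = (q - 1) * (max \<bar>x\<bar> \<bar>y\<bar> powr (q - 2) * (y - x)\<^sup>2)"
    by (simp add: power2_eq_square)
  finally show ?thesis using q by (simp add: mult_left_mono mult.assoc)
qed

lemma qnorm_nonneg [simp]: "0 \<le> qnorm d q v"
  by (simp add: qnorm_def)

lemma qnorm_powr: "q > 0 \<Longrightarrow> qnorm d q v powr q = (\<Sum>i<d. \<bar>v i\<bar> powr q)"
  unfolding qnorm_def by (simp add: powr_powr sum_nonneg)

lemma qnorm_mono:
  assumes "q > 0" "\<And>i. i < d \<Longrightarrow> \<bar>u i\<bar> \<le> \<bar>v i\<bar>"
  shows "qnorm d q u \<le> qnorm d q v"
  unfolding qnorm_def using assms by (intro powr_mono2 sum_mono sum_nonneg) auto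

lemma inner_d_add: "inner_d d a (\<lambda>i. u i + v i) = inner_d d a u + inner_d d a v"
  by (simp add: inner_d_def algebra_simps sum.distrib)

lemma inner_unit_vec: "i < d \<Longrightarrow> inner_d d (unit_vec i) v = v i"
  by (simp add: inner_d_def unit_vec_def if_distrib[of "\<lambda>x. x * _"] cong: if_cong)

section \<open>Duality between the p-ball and the q-norm\<close>

locale dual_exponents =
  fixes d :: nat and p q :: real
  assumes p: "1 < p" "p \<le> 2" and q_def: "q = dual_exp p"
begin

lemma dual_exp_ge_2: "2 \<le> q"
  using p unfolding q_def dual_exp_def by (simp add: field_simps)

lemma dual_exp_eqs: "(q - 1) * p = q" "1 / q = 1 - 1 / p" "p * (q - 1) = q"
  using p unfolding q_def dual_exp_def by (auto simp: field_simps)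

lemma inner_d_le_qnorm:
  assumes "a \<in> lp_ball d p"
  shows "\<bar>inner_d d a v\<bar> \<le> qnorm d q v"
proof -
  have q: "q \<ge> 2" by (rule dual_exp_ge_2)
  have eqs: "p * (1 - 1 / q) = 1" using p dual_exp_eqs(2) by (simp add: field_simps)
  have "\<bar>inner_d d a v\<bar> \<le> (\<Sum>i<d. \<bar>a i\<bar> * \<bar>v i\<bar>)"
    unfolding inner_d_def by (rule order.trans[OF sum_abs]) (simp add: abs_mult)
  also have "\<dots> = (\<Sum>i<d. (\<bar>a i\<bar> powr p) powr (1 - 1/q) * (\<bar>v i\<bar> powr q) powr (1/q))"
    using p q by (intro sum.cong) (auto simp: powr_powr eqs)
  also have "\<dots> \<le> (\<Sum>i<d. \<bar>a i\<bar> powr p) powr (1 - 1/q) * (\<Sum>i<d. \<bar>v i\<bar> powr q) powr (1/q)"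
    using q by (intro sum_powr_mult_le) auto
  also have "\<dots> \<le> 1 powr (1 - 1/q) * (\<Sum>i<d. \<bar>v i\<bar> powr q) powr (1/q)"
    using assms q by (intro mult_right_mono powr_mono2) (auto simp: lp_ball_def sum_nonneg)
  finally show ?thesis by (simp add: qnorm_def)
qed

lemma a_hat_in_lp_ball: "a_hat d q v \<in> lp_ball d p"
proof -
  let ?n = "qnorm d q v"
  have q: "q \<ge> 2" by (rule dual_exp_ge_2)
  have "(\<Sum>i<d. \<bar>a_hat d q v i\<bar> powr p) = (\<Sum>i<d. \<bar>v i\<bar> powr q / ?n powr q)"
    using p q dual_exp_eqs
    by (intro sum.cong)
       (auto simp: a_hat_def abs_mult powr_divide powr_powr abs_sgn_eq)
  also have "\<dots> = ?n powr q / ?n powr q"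
    using q by (simp add: qnorm_powr flip: sum_divide_distrib)
  \<comment> \<open>Not an equality: for \<open>v = 0\<close> the quotient is 0.\<close>
  also have "\<dots> \<le> 1" by simp
  finally show ?thesis by (auto simp: lp_ball_def a_hat_def)
qed

lemma a_hat_spow: "inner_d d (a_hat d q v) u = (\<Sum>i<d. spow (q - 1) (v i) * u i) / qnorm d q v powr (q - 1)"
  unfolding inner_d_def a_hat_def spow_def sum_divide_distrib by (intro sum.cong) auto

lemma inner_a_hat_self: "inner_d d (a_hat d q v) v = qnorm d q v"
proof -
  have "inner_d d (a_hat d q v) v = qnorm d q v powr q / qnorm d q v powr (q - 1)"
    using dual_exp_ge_2 unfolding a_hat_spow by (simp add: spow_mult_self qnorm_powr)
  also have "\<dots> = qnorm d q v" by (cases "qnorm d q v = 0") (auto simp: powr_diff)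
  finally show ?thesis .
qed

text \<open>Minkowski's inequality by duality: the action attaining the norm of the sum pairs with
  each summand, where Hoelder applies.\<close>

lemma qnorm_triangle: "qnorm d q (\<lambda>i. u i + v i) \<le> qnorm d q u + qnorm d q v"
proof -
  let ?a = "a_hat d q (\<lambda>i. u i + v i)"
  have "qnorm d q (\<lambda>i. u i + v i) = inner_d d ?a u + inner_d d ?a v"
    by (simp flip: inner_d_add inner_a_hat_self)
  then show ?thesis
    using inner_d_le_qnorm[OF a_hat_in_lp_ball, of "(\<lambda>i. u i + v i)" u]
      inner_d_le_qnorm[OF a_hat_in_lp_ball, of "(\<lambda>i. u i + v i)" v] by linarith
qed

lemma unit_vec_in_lp_ball: "i < d \<Longrightarrow> unit_vec i \<in> lp_ball d p"
proof -
  assume "i < d"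
  then have "(\<Sum>k<d. \<bar>unit_vec i k\<bar> powr p) = (\<Sum>k<d. if k = i then 1 else 0)"
    using p by (intro sum.cong) (auto simp: unit_vec_def)
  with \<open>i < d\<close> show ?thesis by (auto simp: lp_ball_def unit_vec_def)
qed

text \<open>If the error is at most \<open>qnorm d q x / q\<close>, the second-order Taylor bound for the q-th power
  applies, and \<open>(1 + 1/q) powr (q - 2) \<le> 3\<close> keeps the constant linear in \<open>q\<close>; for larger errors
  the triangle inequality suffices.\<close>

lemma a_hat_regret_le:
  fixes x y :: "nat \<Rightarrow> real"
  assumes x0: "qnorm d q x > 0"
  defines "h \<equiv> (\<lambda>i. y i - x i)"
  shows "qnorm d q y - inner_d d (a_hat d q x) y \<le> 3 * q * (qnorm d q h)\<^sup>2 / qnorm d q x"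
proof -
  let ?X = "qnorm d q x" and ?H = "qnorm d q h" and ?Y = "qnorm d q y"
  have q: "q \<ge> 2" by (rule dual_exp_ge_2)
  have y: "y = (\<lambda>i. x i + h i)" by (auto simp: h_def)
  have inn: "inner_d d (a_hat d q x) y = ?X + inner_d d (a_hat d q x) h"
    by (subst y, subst inner_d_add) (simp add: inner_a_hat_self)
  show ?thesis
  proof (cases "q * ?H \<le> ?X")
    case False
    have "?Y \<le> ?X + ?H" using qnorm_triangle[of x h] by (simp flip: y)
    moreover have "- ?H \<le> inner_d d (a_hat d q x) h"
      using inner_d_le_qnorm[OF a_hat_in_lp_ball, of x h] by linarith
    ultimately have "?Y - inner_d d (a_hat d q x) y \<le> 2 * ?H" using inn by linarith
    also have "2 * ?H * ?X \<le> 2 * ?H * (q * ?H)" using False by (intro mult_left_mono) auto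
    then have "2 * ?H \<le> 2 * q * ?H\<^sup>2 / ?X" using x0 by (simp add: field_simps power2_eq_square)
    also have "\<dots> \<le> 3 * q * ?H\<^sup>2 / ?X" using q x0 by (intro divide_right_mono mult_right_mono) auto
    finally show ?thesis .
  next
    case True
    \<comment> \<open>The quadratic term is evaluated at the pointwise larger modulus, whose norm
      exceeds that of \<open>x\<close> by at most the factor \<open>1 + 1 / q\<close>.\<close>
    define m where "m = (\<lambda>i. max \<bar>x i\<bar> \<bar>y i\<bar>)"
    have mn: "qnorm d q m \<le> ?X * (1 + 1 / q)"
    proof -
      have "qnorm d q m \<le> qnorm d q (\<lambda>i. \<bar>x i\<bar> + \<bar>h i\<bar>)"
        using q by (intro qnorm_mono) (auto simp: m_def h_def)
      also have "\<dots> \<le> ?X + ?H"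
        using qnorm_triangle[of "\<lambda>i. \<bar>x i\<bar>" "\<lambda>i. \<bar>h i\<bar>"] by (simp add: qnorm_def)
      also have "\<dots> \<le> ?X * (1 + 1 / q)" using True q by (simp add: field_simps)
      finally show ?thesis .
    qed
    have hol: "(\<Sum>i<d. m i powr (q - 2) * (h i)\<^sup>2) \<le> 3 * ?X powr (q - 2) * ?H\<^sup>2"
    \<comment> \<open>Hoelder with exponents \<open>q / (q - 2)\<close> and \<open>q / 2\<close>;
      the first one is infinite for \<open>q = 2\<close>.\<close>
    proof (cases "q = 2")
      case True
      have "(\<Sum>i<d. m i powr (q - 2) * (h i)\<^sup>2) \<le> (\<Sum>i<d. \<bar>h i\<bar> powr q)"
        using True by (intro sum_mono) auto
      also have "\<dots> = ?H\<^sup>2" using qnorm_powr[of q d h] True by simp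
      also have "\<dots> \<le> 3 * ?X powr (q - 2) * ?H\<^sup>2" using True x0 by simp
      finally show ?thesis .
    next
      case False
      then have q2: "q > 2" using q by simp
      have m0: "0 \<le> m i" for i by (auto simp: m_def)
      have "(\<Sum>i<d. m i powr (q - 2) * (h i)\<^sup>2)
         = (\<Sum>i<d. (\<bar>m i\<bar> powr q) powr (1 - 2/q) * (\<bar>h i\<bar> powr q) powr (2/q))"
      proof (intro sum.cong refl)
        fix i
        have "q * (1 - 2/q) = q - 2" using q by (simp add: field_simps)
        moreover have "\<bar>h i\<bar> powr 2 = (h i)\<^sup>2" by (cases "h i = 0") auto
        ultimately show "m i powr (q - 2) * (h i)\<^sup>2 = (\<bar>m i\<bar> powr q) powr (1 - 2/q) * (\<bar>h i\<bar> powr q) powr (2/q)"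
          using q m0[of i] by (simp add: powr_powr)
      qed
      also have "\<dots> \<le> (\<Sum>i<d. \<bar>m i\<bar> powr q) powr (1 - 2/q) * (\<Sum>i<d. \<bar>h i\<bar> powr q) powr (2/q)"
        using q2 by (intro sum_powr_mult_le) auto
      also have "\<dots> = (qnorm d q m powr q) powr (1 - 2/q) * (?H powr q) powr (2/q)"
        using q by (simp add: qnorm_powr)
      also have "\<dots> = qnorm d q m powr (q - 2) * ?H\<^sup>2"
      proof -
        have "q * (1 - 2/q) = q - 2" using q by (simp add: field_simps)
        moreover have "?H powr 2 = ?H\<^sup>2" by (cases "?H = 0") auto
        ultimately show ?thesis using q by (simp add: powr_powr)
      qed
      also have "\<dots> \<le> (?X * (1 + 1 / q)) powr (q - 2) * ?H\<^sup>2"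
        using mn q by (intro mult_right_mono powr_mono2) auto
      also have "\<dots> = ?X powr (q - 2) * (1 + 1 / q) powr (q - 2) * ?H\<^sup>2"
        using q by (simp add: powr_mult)
      also have "(1 + 1 / q) powr (q - 2) \<le> 3"
      proof -
        have "(1 + 1 / q) powr (q - 2) = exp ((q - 2) * ln (1 + 1 / q))"
          using q by (simp add: powr_def add_nonneg_eq_0_iff)
        also have "\<dots> \<le> exp 1"
        proof -
          have "(q - 2) * ln (1 + 1/q) \<le> q * (1 / q)"
            using q ln_add_one_self_le_self[of "1/q"] by (intro mult_mono) (auto simp: add_pos_pos)
          then show ?thesis using q by simp
        qed
        also have "\<dots> \<le> 3" by (rule exp_le)
        finally show ?thesis .
      qed
      finally show ?thesis by (simp add: mult.commute mult.left_commute mult_left_mono mult_right_mono)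
    qed
    have "?Y powr q = (\<Sum>i<d. \<bar>y i\<bar> powr q)" using q by (simp add: qnorm_powr)
    also have "\<dots> \<le> (\<Sum>i<d. \<bar>x i\<bar> powr q + q * (spow (q - 1) (x i) * h i)
        + q * (q - 1) * (m i powr (q - 2) * (h i)\<^sup>2))"
      using abs_powr_taylor_le[OF q] by (intro sum_mono) (simp add: h_def m_def mult.assoc)
    also have "\<dots> = ?X powr q + q * (\<Sum>i<d. spow (q - 1) (x i) * h i)
        + q * (q - 1) * (\<Sum>i<d. m i powr (q - 2) * (h i)\<^sup>2)"
      using q by (simp add: sum.distrib qnorm_powr sum_distrib_left)
    also have "(\<Sum>i<d. spow (q - 1) (x i) * h i) = ?X powr (q - 1) * inner_d d (a_hat d q x) h"
      using x0 by (simp add: a_hat_spow)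
    also have "q * (q - 1) * (\<Sum>i<d. m i powr (q - 2) * (h i)\<^sup>2)
       \<le> q * q * (3 * ?X powr (q - 2) * ?H\<^sup>2)"
      using q hol by (intro mult_mono) (auto intro!: sum_nonneg)
    finally have a: "?Y powr q \<le> ?X powr q + q * (?X powr (q - 1) * inner_d d (a_hat d q x) h)
        + q * q * (3 * ?X powr (q - 2) * ?H\<^sup>2)" by simp
    \<comment> \<open>Bounding \<open>?Y powr q\<close> below by its tangent at \<open>?X\<close>
      makes the inequality linear in \<open>?Y\<close>, so that no root has to be taken.\<close>
    have "q * (?X powr (q - 1) * ?Y) \<le> ?Y powr q + (q - 1) * ?X powr q"
      using q by (intro powr_tangent_le) auto
    with a have "q * (?X powr (q - 1) * ?Y) \<le> q * (?X powr q + ?X powr (q - 1) * inner_d d (a_hat d q x) h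
        + q * (3 * ?X powr (q - 2) * ?H\<^sup>2))" by (simp add: algebra_simps)
    then have "?X powr (q - 1) * ?Y \<le> ?X powr q + ?X powr (q - 1) * inner_d d (a_hat d q x) h
        + q * (3 * ?X powr (q - 2) * ?H\<^sup>2)" using q by (subst (asm) mult_le_cancel_left_pos) auto
    also have "\<dots> = ?X powr (q - 1) * (?X + inner_d d (a_hat d q x) h + 3 * q * ?H\<^sup>2 / ?X)"
    proof -
      have "?X powr q = ?X powr (q - 1) * ?X" using x0 by (simp add: powr_diff)
      moreover have "?X powr (q - 2) = ?X powr (q - 1) / ?X"
        using x0 by (simp add: powr_diff power2_eq_square)
      ultimately show ?thesis by (simp add: algebra_simps)
    qed
    finally show ?thesis using x0 inn by (simp add: mult_le_cancel_left)
  qed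
qed

end

subsection \<open>Independent sequences and stopping times\<close>

definition shift_seq :: "nat \<Rightarrow> (nat \<Rightarrow> 'a) \<Rightarrow> nat \<Rightarrow> 'a" where
  "shift_seq s \<omega> = (\<lambda>t. \<omega> (s + t))"

lemma shift_seq_apply: "shift_seq s \<omega> t = \<omega> (s + t)"
  by (simp add: shift_seq_def)

lemma shift_seq_shift_seq: "shift_seq s (shift_seq t \<omega>) = shift_seq (t + s) \<omega>"
  by (simp add: shift_seq_def add.assoc)

lemma shift_comb_seq [simp]: "shift_seq s (comb_seq s \<omega> \<omega>') = \<omega>'"
  by (simp add: shift_seq_def comb_seq_def)

section \<open>Independence of the past and the shifted future\<close>

text \<open>Adaptedness to time \<open>s\<close>, expressed as invariance under changes of later
  draws; together with measurability it takes the place of a filtration.\<close>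

definition depends_below :: "nat \<Rightarrow> ((nat \<Rightarrow> 'a) \<Rightarrow> 'b) \<Rightarrow> bool" where
  "depends_below s f \<longleftrightarrow> (\<forall>\<omega> \<omega>'. (\<forall>t<s. \<omega>' t = \<omega> t) \<longrightarrow> f \<omega>' = f \<omega>)"

lemma depends_belowD: "depends_below s f \<Longrightarrow> f (comb_seq s \<omega> \<omega>') = f \<omega>"
  unfolding depends_below_def by (simp add: comb_seq_def)

context sequence_space
begin

lemma measurable_shift_seq [measurable]: "shift_seq s \<in> S \<rightarrow>\<^sub>M S"
  unfolding shift_seq_def by (rule measurable_PiM_single') (auto simp: space_PiM PiE_iff)

text \<open>Replacing all draws from \<open>s\<close> on by an independent copy preserves the law.
  Every use of independence below rests on this invariance.\<close>

lemma nn_integral_split_seq: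
  assumes [measurable]: "F \<in> borel_measurable S"
  shows "(\<integral>\<^sup>+\<omega>. F \<omega> \<partial>S) = (\<integral>\<^sup>+\<omega>. \<integral>\<^sup>+\<omega>'. F (comb_seq s \<omega> \<omega>') \<partial>S \<partial>S)"
proof -
  have "(\<integral>\<^sup>+\<omega>. F \<omega> \<partial>S) = (\<integral>\<^sup>+\<omega>. F \<omega> \<partial>distr (S \<Otimes>\<^sub>M S) S (\<lambda>(\<omega>, \<omega>'). comb_seq s \<omega> \<omega>'))"
    by (simp add: PiM_comb_seq)
  also have "\<dots> = (\<integral>\<^sup>+x. F (case x of (\<omega>, \<omega>') \<Rightarrow> comb_seq s \<omega> \<omega>') \<partial>(S \<Otimes>\<^sub>M S))"
    by (subst nn_integral_distr) auto
  also have "\<dots> = (\<integral>\<^sup>+\<omega>. \<integral>\<^sup>+\<omega>'. F (comb_seq s \<omega> \<omega>') \<partial>S \<partial>S)"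
    by (subst P.nn_integral_fst[symmetric]) auto
  finally show ?thesis .
qed

lemma nn_integral_mult_shift_seq:
  assumes [measurable]: "f \<in> borel_measurable S" "h \<in> borel_measurable S"
    and dep: "depends_below s f"
  shows "(\<integral>\<^sup>+\<omega>. f \<omega> * h (shift_seq s \<omega>) \<partial>S) = (\<integral>\<^sup>+\<omega>. f \<omega> \<partial>S) * (\<integral>\<^sup>+\<omega>. h \<omega> \<partial>S)"
  by (subst nn_integral_split_seq[of _ s])
     (auto simp: depends_belowD[OF dep] nn_integral_cmult nn_integral_multc)

lemma nn_integral_shift_seq:
  assumes "h \<in> borel_measurable S"
  shows "(\<integral>\<^sup>+\<omega>. h (shift_seq s \<omega>) \<partial>S) = (\<integral>\<^sup>+\<omega>. h \<omega> \<partial>S)"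
  using nn_integral_mult_shift_seq[of "\<lambda>_. 1" h s] assms
  by (simp add: depends_below_def P.emeasure_space_1)

lemma distr_shift_seq: "distr S S (shift_seq s) = S"
proof (rule measure_eqI)
  fix A assume "A \<in> sets (distr S S (shift_seq s))"
  then have [measurable]: "A \<in> sets S" by simp
  have "emeasure (distr S S (shift_seq s)) A = (\<integral>\<^sup>+\<omega>. indicator A \<omega> \<partial>distr S S (shift_seq s))"
    by simp
  also have "\<dots> = (\<integral>\<^sup>+\<omega>. indicator A (shift_seq s \<omega>) \<partial>S)"
    by (subst nn_integral_distr) auto
  also have "\<dots> = emeasure S A"
    by (subst nn_integral_shift_seq) auto
  finally show "emeasure (distr S S (shift_seq s)) A = emeasure S A" .
qed simp

lemma integrable_shift_seq:
  fixes h :: "(nat \<Rightarrow> 'a) \<Rightarrow> real"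
  assumes "integrable S h"
  shows "integrable S (\<lambda>\<omega>. h (shift_seq s \<omega>))"
  using assms integrable_distr[of "shift_seq s" S S h] by (simp add: distr_shift_seq)

lemma integral_shift_seq:
  fixes h :: "(nat \<Rightarrow> 'a) \<Rightarrow> real"
  assumes "h \<in> borel_measurable S"
  shows "(\<integral>\<omega>. h (shift_seq s \<omega>) \<partial>S) = (\<integral>\<omega>. h \<omega> \<partial>S)"
  using assms integral_distr[of "shift_seq s" S S h] by (simp add: distr_shift_seq)

text \<open>The signed version, for cross terms of variances: these vanish by centring, which
  nonnegative integrals cannot express.\<close>

lemma integral_mult_shift_seq:
  fixes f h :: "(nat \<Rightarrow> 'a) \<Rightarrow> real"
  assumes f: "integrable S f" and h: "integrable S h" and dep: "depends_below s f"
  shows "integrable S (\<lambda>\<omega>. f \<omega> * h (shift_seq s \<omega>))"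
    and "(\<integral>\<omega>. f \<omega> * h (shift_seq s \<omega>) \<partial>S) = (\<integral>\<omega>. f \<omega> \<partial>S) * (\<integral>\<omega>. h \<omega> \<partial>S)"
proof -
  interpret PP: pair_sigma_finite S S ..
  have [measurable]: "f \<in> borel_measurable S" "h \<in> borel_measurable S" using f h by auto
  let ?F = "\<lambda>\<omega>. f \<omega> * h (shift_seq s \<omega>)"
  let ?D = "distr (S \<Otimes>\<^sub>M S) S (\<lambda>(\<omega>, \<omega>'). comb_seq s \<omega> \<omega>')"
  have eq: "?F (case x of (\<omega>, \<omega>') \<Rightarrow> comb_seq s \<omega> \<omega>') = f (fst x) * h (snd x)" for x
    by (cases x) (simp add: depends_belowD[OF dep])
  have int: "integrable (S \<Otimes>\<^sub>M S) (\<lambda>x. f (fst x) * h (snd x))"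
    by (rule PP.Fubini_integrable) (use f h in \<open>auto simp: abs_mult\<close>)
  then have "integrable ?D ?F"
    by (subst integrable_distr_eq) (auto simp: eq)
  then show "integrable S ?F" by (simp add: PiM_comb_seq)
  have "(\<integral>\<omega>. ?F \<omega> \<partial>S) = (\<integral>\<omega>. ?F \<omega> \<partial>?D)" by (simp add: PiM_comb_seq)
  also have "\<dots> = (\<integral>x. f (fst x) * h (snd x) \<partial>(S \<Otimes>\<^sub>M S))"
    by (subst integral_distr) (auto simp: eq)
  also have "\<dots> = (\<integral>\<omega>. \<integral>\<omega>'. f \<omega> * h \<omega>' \<partial>S \<partial>S)"
    using PP.integral_fst'[OF int] by simp
  also have "\<dots> = (\<integral>\<omega>. f \<omega> \<partial>S) * (\<integral>\<omega>. h \<omega> \<partial>S)" by simp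
  finally show "(\<integral>\<omega>. ?F \<omega> \<partial>S) = (\<integral>\<omega>. f \<omega> \<partial>S) * (\<integral>\<omega>. h \<omega> \<partial>S)" .
qed

text \<open>Peeling off the first block leaves the same product on the shifted sequence. The
  applications are exponential moments of sums over independent blocks.\<close>

lemma nn_integral_prod_shift_seq:
  fixes g :: "(nat \<Rightarrow> 'a) \<Rightarrow> ennreal"
  assumes [measurable]: "g \<in> borel_measurable S" and dep: "depends_below b g"
  shows "(\<integral>\<^sup>+\<omega>. (\<Prod>l<k. g (shift_seq (l * b) \<omega>)) \<partial>S) = (\<integral>\<^sup>+\<omega>. g \<omega> \<partial>S) ^ k"
proof (induction k)
  case 0
  show ?case by (simp add: P.emeasure_space_1)
next
  case (Suc k)
  have sh: "shift_seq 0 \<omega> = \<omega>" for \<omega> :: "nat \<Rightarrow> 'a" by (simp add: shift_seq_def)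
  have "(\<integral>\<^sup>+\<omega>. (\<Prod>l<Suc k. g (shift_seq (l * b) \<omega>)) \<partial>S)
      = (\<integral>\<^sup>+\<omega>. g \<omega> * (\<Prod>l<k. g (shift_seq (l * b) (shift_seq b \<omega>))) \<partial>S)"
    by (simp add: prod.lessThan_Suc_shift shift_seq_shift_seq sh del: prod.lessThan_Suc)
  also have "\<dots> = (\<integral>\<^sup>+\<omega>. g \<omega> \<partial>S) * (\<integral>\<^sup>+\<omega>. (\<Prod>l<k. g (shift_seq (l * b) \<omega>)) \<partial>S)"
    by (rule nn_integral_mult_shift_seq[OF _ _ dep]) auto
  finally show ?case by (simp only: Suc.IH power_Suc)
qed

text \<open>The mark \<open>Y\<close> lets the tested event depend on data computed before the stopping time, such as
  the length of the next block of samples.\<close>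

lemma strong_markov_le:
  fixes \<sigma> Y :: "(nat \<Rightarrow> 'a) \<Rightarrow> nat" and B :: "nat \<Rightarrow> (nat \<Rightarrow> 'a) set"
  assumes [measurable]: "\<sigma> \<in> measurable S (count_space UNIV)" "Y \<in> measurable S (count_space UNIV)"
    and stop: "\<And>\<omega> \<omega>'. (\<And>t. t < \<sigma> \<omega> \<Longrightarrow> \<omega>' t = \<omega> t) \<Longrightarrow> \<sigma> \<omega>' = \<sigma> \<omega> \<and> Y \<omega>' = Y \<omega>"
    and B [measurable]: "\<And>n. B n \<in> sets S" and \<rho>: "\<And>n. measure S (B n) \<le> \<rho>"
  shows "{\<omega> \<in> space S. shift_seq (\<sigma> \<omega>) \<omega> \<in> B (Y \<omega>)} \<in> sets S"
    and "measure S {\<omega> \<in> space S. shift_seq (\<sigma> \<omega>) \<omega> \<in> B (Y \<omega>)} \<le> \<rho>"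
proof -
  have \<rho>0: "0 \<le> \<rho>" using \<rho>[of 0] measure_nonneg[of S "B 0"] by linarith
  define A where "A = (\<lambda>(s, n). {\<omega> \<in> space S. \<sigma> \<omega> = s \<and> Y \<omega> = n})"
  define X where "X = (\<lambda>(s, n). {\<omega> \<in> space S. (\<sigma> \<omega> = s \<and> Y \<omega> = n) \<and> shift_seq s \<omega> \<in> B n})"
  have X [measurable]: "X z \<in> sets S" and A [measurable]: "A z \<in> sets S" for z
    unfolding X_def A_def by (cases z; simp)+
  have eq: "{\<omega> \<in> space S. shift_seq (\<sigma> \<omega>) \<omega> \<in> B (Y \<omega>)} = (\<Union>z. X z)"
    unfolding X_def by auto
  show "{\<omega> \<in> space S. shift_seq (\<sigma> \<omega>) \<omega> \<in> B (Y \<omega>)} \<in> sets S"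
    unfolding eq by measurable
  have le: "emeasure S (X z) \<le> emeasure S (A z) * ennreal \<rho>" for z
  proof (cases z)
    case (Pair s n)
    define f where "f = (\<lambda>\<omega>. if \<sigma> \<omega> = s \<and> Y \<omega> = n then 1 else 0 :: ennreal)"
    have [measurable]: "f \<in> borel_measurable S" unfolding f_def by measurable
    have dep: "depends_below s f"
      unfolding depends_below_def f_def
    proof (intro allI impI)
      fix \<omega> \<omega>' :: "nat \<Rightarrow> 'a" assume ag: "\<forall>t<s. \<omega>' t = \<omega> t"
      \<comment> \<open>\<open>stop\<close> is needed in both directions, because agreement below
        \<open>s\<close> is an agreement up to the stopping time only for the sequence that stops at
        \<open>s\<close>.\<close>
      then have "\<sigma> \<omega> = s \<Longrightarrow> \<sigma> \<omega>' = s \<and> Y \<omega>' = Y \<omega>" "\<sigma> \<omega>' = s \<Longrightarrow> \<sigma> \<omega> = s \<and> Y \<omega> = Y \<omega>'"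
        using stop[of \<omega> \<omega>'] stop[of \<omega>' \<omega>] by auto
      then show "(if \<sigma> \<omega>' = s \<and> Y \<omega>' = n then 1 else 0 :: ennreal) = (if \<sigma> \<omega> = s \<and> Y \<omega> = n then 1 else 0)"
        by metis
    qed
    have "emeasure S (X z) = (\<integral>\<^sup>+\<omega>. f \<omega> * indicator (B n) (shift_seq s \<omega>) \<partial>S)"
      unfolding nn_integral_indicator[OF X, symmetric]
      by (intro nn_integral_cong) (auto simp: X_def Pair f_def indicator_def)
    also have "\<dots> = (\<integral>\<^sup>+\<omega>. f \<omega> \<partial>S) * emeasure S (B n)"
      by (subst nn_integral_mult_shift_seq[OF _ _ dep]) auto
    also have "(\<integral>\<^sup>+\<omega>. f \<omega> \<partial>S) = emeasure S (A z)"
      unfolding nn_integral_indicator[OF A, symmetric]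
      by (intro nn_integral_cong) (auto simp: A_def Pair f_def indicator_def)
    also have "emeasure S (B n) \<le> ennreal \<rho>"
      using \<rho>[of n] by (simp add: P.emeasure_eq_measure ennreal_leI)
    finally show ?thesis by (simp add: mult_left_mono)
  qed
  \<comment> \<open>The slices are disjoint, so the bound is averaged with weights of total mass at
    most 1 and \<open>\<rho>\<close> is not multiplied by the number of possible stopping
    times.\<close>
  have "emeasure S (\<Union>z. X z) = (\<integral>\<^sup>+z. emeasure S (X z) \<partial>count_space UNIV)"
    by (rule emeasure_UN_countable) (auto simp: disjoint_family_on_def X_def)
  also have "\<dots> \<le> (\<integral>\<^sup>+z. emeasure S (A z) * ennreal \<rho> \<partial>count_space UNIV)"
    by (intro nn_integral_mono le)
  also have "\<dots> = (\<integral>\<^sup>+z. emeasure S (A z) \<partial>count_space UNIV) * ennreal \<rho>"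
    by (rule nn_integral_multc) auto
  also have "(\<integral>\<^sup>+z. emeasure S (A z) \<partial>count_space UNIV) = emeasure S (\<Union>z. A z)"
    by (rule emeasure_UN_countable[symmetric]) (auto simp: disjoint_family_on_def A_def)
  also have "\<dots> * ennreal \<rho> \<le> 1 * ennreal \<rho>"
    by (intro mult_right_mono) (auto simp: P.prob_le_1 P.emeasure_eq_measure)
  finally show "measure S {\<omega> \<in> space S. shift_seq (\<sigma> \<omega>) \<omega> \<in> B (Y \<omega>)} \<le> \<rho>"
    unfolding eq using \<rho>0 by (simp add: P.emeasure_eq_measure)
qed

end

subsection \<open>The course of the algorithm\<close>

text \<open>For \<open>\<delta> < 1 / 2\<close> both \<open>ln (d / \<delta>)\<close> and
  \<open>ln (1 / \<delta>)\<close> stay above \<open>ln 2\<close>, so additive constants can be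
  absorbed into them.\<close>

locale valee_params = dual_exponents d p q for d :: nat and p q :: real +
  fixes T :: nat and \<delta> :: real
  assumes d: "1 \<le> d" and T: "1 \<le> T" and \<delta>: "0 < \<delta>" "\<delta> < 1 / 2"
begin

lemma q2: "2 \<le> q" by (rule dual_exp_ge_2)

abbreviation "\<tau> \<equiv> valee_tau d q T \<delta>"
abbreviation "Y1 \<equiv> sr_threshold (1/2) (\<delta> / real d)"
abbreviation "\<kappa> \<equiv> valee_kappa d T \<delta>"
abbreviation "states \<equiv> valee_states d q T \<delta>"

definition Ld :: real where "Ld = ln (real d / \<delta>)"

lemma Ld_ge: "ln 2 \<le> Ld"
proof -
  have "2 \<le> 1 / \<delta>" using \<delta> by (simp add: field_simps)
  also have "\<dots> \<le> real d / \<delta>" using d \<delta> by (simp add: divide_right_mono)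
  finally show ?thesis unfolding Ld_def by simp
qed

lemma Ld_pos: "0 < Ld" using Ld_ge ln_gt_zero[of "2::real"] by linarith

lemma lnT_ge_1: "3 \<le> T \<Longrightarrow> 1 \<le> ln (real T)"
proof -
  assume T3: "3 \<le> T"
  have "exp 1 \<le> (3::real)" by (rule exp_le)
  also have "3 \<le> real T" using T3 by simp
  finally show ?thesis using T3 by (subst ln_ge_iff) auto
qed

lemma tau_pos: "0 < \<tau>"
  unfolding valee_tau_def using d T q2 Ld_pos by (simp add: Ld_def)

lemma Y1_eq: "Y1 = 1 + 24 * (exp 1 - 2) * (ln 2 + Ld)"
proof -
  have "2 / (\<delta> / real d) = 2 * (real d / \<delta>)" by simp
  then have "ln (2 / (\<delta> / real d)) = ln 2 + Ld"
    using d \<delta> ln_mult[of 2 "real d / \<delta>"] unfolding Ld_def by simp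
  then show ?thesis unfolding sr_threshold_def by (simp add: power2_eq_square)
qed

text \<open>The middle bound makes \<open>exp (- Y1 / 2)\<close> at most half of
  \<open>\<delta> / d\<close>, one half for each tail of a coordinate's stopping time; the last one
  limits the number of samples. Only \<open>5/2 \<le> exp 1 \<le> 3\<close> enters.\<close>

lemma Y1_bounds: "1 \<le> Y1" "2 * (ln 2 + Ld) \<le> Y1" "Y1 \<le> 50 * Ld"
proof -
  let ?x = "ln 2 + Ld"
  have x: "0 \<le> ?x" using Ld_pos by simp
  have e: "5/2 \<le> exp (1::real)" using exp_lower_Taylor_quadratic[of "1::real"] by simp
  have e3: "exp (1::real) \<le> 3" by (rule exp_le)
  show "1 \<le> Y1" unfolding Y1_eq using e x by simp
  have "2 * ?x \<le> 24 * (exp 1 - 2) * ?x" using e x by (intro mult_right_mono) auto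
  then show "2 * ?x \<le> Y1" unfolding Y1_eq by simp
  have "24 * (exp 1 - 2) * ?x \<le> 24 * 1 * ?x" using e3 x by (intro mult_right_mono mult_left_mono) auto
  then have "Y1 \<le> 1 + 24 * ?x" unfolding Y1_eq by simp
  moreover have "1 \<le> 2 * ln (2::real)" using ln2_ge_two_thirds by simp
  moreover have "y \<le> 50 * L" if "y \<le> 1 + 24 * (l + L)" "1 \<le> 2 * l" "l \<le> L" for y l L :: real
    using that by simp
  ultimately show "Y1 \<le> 50 * Ld" using Ld_ge by blast
qed

lemma valee_act_in_lp_ball: "valee_act d q T \<delta> \<omega> t \<in> lp_ball d p"
proof -
  define ok where "ok = (\<lambda>st. case st of VarEst i _ _ _ _ \<Rightarrow> i < d
     | Explore _ _ _ _ i _ _ _ \<Rightarrow> i < d | Exploit a \<Rightarrow> a \<in> lp_ball d p)"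
  have "ok (states \<omega> t)"
  proof (induction t)
    case 0
    show ?case using d by (simp add: valee_init_def ok_def)
  next
    case (Suc t)
    have "ok st \<Longrightarrow> ok (valee_update d q T \<delta> st x)" for st x
    proof (cases st)
      case (VarEst i e N s r)
      then show "ok st \<Longrightarrow> ok (valee_update d q T \<delta> st x)"
        using d by (cases r) (auto simp: ok_def Let_def)
    qed (use d in \<open>auto simp: ok_def Let_def a_hat_in_lp_ball\<close>)
    with Suc show ?case by (simp add: Let_def)
  qed
  then show ?thesis
    unfolding valee_act_def ok_def by (cases "states \<omega> t") (auto intro: unit_vec_in_lp_ball)
qed

section \<open>The schedule as a function of the draws\<close>

text \<open>Time is relative: \<open>\<omega>\<close> is meant to begin with the first play of
  coordinate \<open>i\<close>, so that shifts of the draws bring every coordinate into this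
  form.\<close>

definition vsum :: "nat \<Rightarrow> nat \<Rightarrow> (nat \<Rightarrow> nat \<Rightarrow> real) \<Rightarrow> real" where
  "vsum i n \<omega> = (\<Sum>m<n. var_sample \<tau> (\<omega> (2 * m) i) (\<omega> (2 * m + 1) i))"

definition nstop :: "nat \<Rightarrow> (nat \<Rightarrow> nat \<Rightarrow> real) \<Rightarrow> nat" where
  "nstop i \<omega> = (LEAST n. Y1 \<le> vsum i n \<omega>)"

primrec vstart :: "nat \<Rightarrow> (nat \<Rightarrow> nat \<Rightarrow> real) \<Rightarrow> nat" where
  "vstart 0 \<omega> = 0"
| "vstart (Suc i) \<omega> = vstart i \<omega> + 2 * nstop i (shift_seq (vstart i \<omega>) \<omega>)"

definition nvar :: "nat \<Rightarrow> (nat \<Rightarrow> nat \<Rightarrow> real) \<Rightarrow> nat" where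
  "nvar i \<omega> = nstop i (shift_seq (vstart i \<omega>) \<omega>)"

text \<open>The default 0 agrees with the table of \<open>valee_init\<close>, so
  \<open>vest i\<close> is exactly the table held when coordinate \<open>i\<close> starts.\<close>

definition vest :: "nat \<Rightarrow> (nat \<Rightarrow> nat \<Rightarrow> real) \<Rightarrow> nat \<Rightarrow> real" where
  "vest i \<omega> = (\<lambda>k. if k < i then Y1 / real (nvar k \<omega>) else 0)"

definition sighat :: "(nat \<Rightarrow> nat \<Rightarrow> real) \<Rightarrow> real" where
  "sighat \<omega> = sigma_q_hat d q (vest d \<omega>)"

definition alpha :: "(nat \<Rightarrow> nat \<Rightarrow> real) \<Rightarrow> real" where
  "alpha \<omega> = valee_alpha d q T \<kappa> (sighat \<omega>)"

definition plen :: "nat \<Rightarrow> (nat \<Rightarrow> nat \<Rightarrow> real) \<Rightarrow> nat" where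
  "plen j \<omega> = phase_len (alpha \<omega>) j"

text \<open>The schedule runs on after the algorithm has stopped exploring, so that the phase boundaries
  depend on the variance estimation only. Phases are numbered from 1; \<open>pstart 0\<close> is a dummy that
  coincides with \<open>pstart 1\<close>.\<close>

primrec pstart :: "nat \<Rightarrow> (nat \<Rightarrow> nat \<Rightarrow> real) \<Rightarrow> nat" where
  "pstart 0 \<omega> = vstart d \<omega>"
| "pstart (Suc j) \<omega> = pstart j \<omega> + (if j = 0 then 0 else \<kappa> * d * plen j \<omega>)"

text \<open>A repetition plays the coordinates in order, so the block of coordinate \<open>i\<close>
  in repetition \<open>l\<close> is number \<open>l * d + i\<close> of its phase; time is relative
  to the start of the phase.\<close>

definition bavg :: "nat \<Rightarrow> nat \<Rightarrow> nat \<Rightarrow> (nat \<Rightarrow> nat \<Rightarrow> real) \<Rightarrow> real" where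
  "bavg n l i \<omega> = (\<Sum>m<n. \<omega> ((l * d + i) * n + m) i) / real n"

definition mom :: "nat \<Rightarrow> (nat \<Rightarrow> nat \<Rightarrow> real) \<Rightarrow> nat \<Rightarrow> real" where
  "mom n \<omega> = (\<lambda>i. median (map (\<lambda>l. bavg n l i \<omega>) [0..<\<kappa>]))"

lemma vsum_ge: "real n * (\<tau> / 2) \<le> vsum i n \<omega>"
proof -
  have "(\<Sum>m<n. \<tau> / 2) \<le> vsum i n \<omega>" unfolding vsum_def by (intro sum_mono) (simp add: var_sample_def)
  then show ?thesis by simp
qed

lemma var_sample_nonneg: "0 \<le> var_sample \<tau> x y"
  by (simp add: var_sample_def le_max_iff_disj)

lemma vsum_mono: "m \<le> n \<Longrightarrow> vsum i m \<omega> \<le> vsum i n \<omega>"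
  unfolding vsum_def by (rule sum_mono2) (auto simp: var_sample_nonneg)

lemma nstop_ex: "\<exists>n. Y1 \<le> vsum i n \<omega>"
proof -
  obtain n :: nat where "Y1 / (\<tau> / 2) < real n" using reals_Archimedean2 by blast
  then have "Y1 \<le> real n * (\<tau> / 2)" using tau_pos by (simp add: field_simps)
  with vsum_ge[of n i \<omega>] show ?thesis by (intro exI[of _ n]) linarith
qed

lemma nstop_ge: "Y1 \<le> vsum i (nstop i \<omega>) \<omega>"
  unfolding nstop_def by (rule LeastI_ex[OF nstop_ex])

text \<open>Samples are nonnegative, so partial sums increase. This turns bounds for the stopping
  time into tail bounds at a fixed number of samples.\<close>

lemma less_nstop: "n < nstop i \<omega> \<longleftrightarrow> vsum i n \<omega> < Y1"
proof
  assume "n < nstop i \<omega>"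
  then show "vsum i n \<omega> < Y1" unfolding nstop_def using not_less_Least by (metis linorder_not_le)
next
  assume "vsum i n \<omega> < Y1"
  then show "n < nstop i \<omega>" using nstop_ge[of i \<omega>] vsum_mono[of "nstop i \<omega>" n i \<omega>] by linarith
qed

lemma nstop_pos: "0 < nstop i \<omega>"
  using Y1_bounds by (simp add: less_nstop vsum_def)

lemma nvar_pos: "0 < nvar i \<omega>"
  by (simp add: nvar_def nstop_pos)

lemma nstop_le_iff: "nstop i \<omega> \<le> n \<longleftrightarrow> Y1 \<le> vsum i n \<omega>"
  using less_nstop[of n i \<omega>] by (simp add: not_less[symmetric])

section \<open>States of the algorithm at the boundaries of the schedule\<close>

lemma states_var_pair:
  assumes "states \<omega> t = VarEst i e N S None" "i < d"
  shows "states \<omega> (t + 2) = valee_update d q T \<delta> (VarEst i e N S (Some (\<omega> t i))) (\<omega> (t + 1) i)"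
  using assms by (simp add: Let_def inner_unit_vec numeral_2_eq_2)

lemma states_var_within:
  assumes "states \<omega> (vstart i \<omega>) = VarEst i (vest i \<omega>) 0 0 None" "i < d" "n < nvar i \<omega>"
  shows "states \<omega> (vstart i \<omega> + 2 * n) =
    VarEst i (vest i \<omega>) n (vsum i n (shift_seq (vstart i \<omega>) \<omega>)) None"
  using assms(3)
proof (induction n)
  case 0
  then show ?case using assms by (simp add: vsum_def)
next
  case (Suc n)
  let ?sh = "shift_seq (vstart i \<omega>) \<omega>"
  have lt: "vsum i (Suc n) ?sh < Y1" using Suc.prems unfolding nvar_def less_nstop .
  have "states \<omega> (vstart i \<omega> + 2 * Suc n) = states \<omega> ((vstart i \<omega> + 2 * n) + 2)" by simp
  also have "\<dots> = VarEst i (vest i \<omega>) (Suc n) (vsum i (Suc n) ?sh) None"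
    using lt Suc assms(2)
    by (subst states_var_pair[of _ _ i "vest i \<omega>" n "vsum i n ?sh"])
       (auto simp: Let_def vsum_def shift_seq_apply add.assoc)
  finally show ?case .
qed

lemma states_var_end:
  assumes "states \<omega> (vstart i \<omega>) = VarEst i (vest i \<omega>) 0 0 None" "i < d"
  shows "states \<omega> (vstart (Suc i) \<omega>) = (if Suc i < d then VarEst (Suc i) (vest (Suc i) \<omega>) 0 0 None
     else Explore (alpha \<omega>) \<kappa> 1 0 0 0 0 (\<lambda>_ _. 0))"
proof -
  let ?sh = "shift_seq (vstart i \<omega>) \<omega>"
  obtain n where n: "nvar i \<omega> = Suc n" using nvar_pos[of i \<omega>] gr0_conv_Suc by blast
  have ge: "Y1 \<le> vsum i (Suc n) ?sh" using nstop_ge[of i ?sh] n by (simp add: nvar_def)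
  have ve: "(vest i \<omega>)(i := Y1 / real (Suc n)) = vest (Suc i) \<omega>"
    by (auto simp: vest_def n less_Suc_eq fun_eq_iff)
  have "vstart (Suc i) \<omega> = (vstart i \<omega> + 2 * n) + 2" using n by (simp add: nvar_def)
  then have "states \<omega> (vstart (Suc i) \<omega>)
    = valee_update d q T \<delta> (VarEst i (vest i \<omega>) n (vsum i n ?sh) (Some (\<omega> (vstart i \<omega> + 2 * n) i)))
       (\<omega> (vstart i \<omega> + 2 * n + 1) i)"
    using states_var_pair[OF states_var_within[OF assms, of n]] n assms(2) by simp
  also have "\<dots> = (if Suc i < d then VarEst (Suc i) (vest (Suc i) \<omega>) 0 0 None
     else Explore (valee_alpha d q T \<kappa> (sigma_q_hat d q (vest (Suc i) \<omega>))) \<kappa> 1 0 0 0 0 (\<lambda>_ _. 0))"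
    using ge unfolding valee_update.simps Let_def ve
    by (simp add: vsum_def shift_seq_apply add.assoc del: of_nat_Suc)
  also have "\<dots> = (if Suc i < d then VarEst (Suc i) (vest (Suc i) \<omega>) 0 0 None
     else Explore (alpha \<omega>) \<kappa> 1 0 0 0 0 (\<lambda>_ _. 0))"
  proof (cases "Suc i < d")
    case False
    then have "Suc i = d" using assms(2) by simp
    then show ?thesis by (simp add: alpha_def sighat_def)
  qed simp
  finally show ?thesis .
qed

lemma states_vstart: "i < d \<Longrightarrow> states \<omega> (vstart i \<omega>) = VarEst i (vest i \<omega>) 0 0 None"
proof (induction i)
  case 0
  then show ?case by (simp add: valee_init_def vest_def)
next
  case (Suc i)
  then show ?case using states_var_end[of \<omega> i] by simp
qed

lemma states_explore_start: "states \<omega> (pstart 1 \<omega>) = Explore (alpha \<omega>) \<kappa> 1 0 0 0 0 (\<lambda>_ _. 0)"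
proof -
  obtain i where i: "d = Suc i" using d by (cases d) auto
  have "states \<omega> (vstart (Suc i) \<omega>) = Explore (alpha \<omega>) \<kappa> 1 0 0 0 0 (\<lambda>_ _. 0)"
    using states_var_end[of \<omega> i, OF states_vstart] i by simp
  moreover have "pstart 1 \<omega> = vstart d \<omega>" by simp
  then have "pstart 1 \<omega> = vstart (Suc i) \<omega>" unfolding i .
  ultimately show ?thesis by simp
qed

lemma states_block_within:
  assumes "states \<omega> t = Explore a \<kappa> j l i 0 0 tab" "i < d" "m < phase_len a j"
  shows "states \<omega> (t + m) = Explore a \<kappa> j l i m (\<Sum>k<m. \<omega> (t + k) i) tab"
  using assms(3)
proof (induction m)
  case (Suc m)
  then show ?case using assms(2) by (simp add: Let_def inner_unit_vec)
qed (use assms in simp)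

lemma states_block_end:
  fixes a j
  defines "n \<equiv> phase_len a j"
  assumes st: "states \<omega> t = Explore a \<kappa> j l i 0 0 tab" and i: "i < d" and n: "0 < n"
  defines "tab' \<equiv> tab(l := (tab l)(i := (\<Sum>k<n. \<omega> (t + k) i) / real n))"
  defines "th \<equiv> \<lambda>k. median (map (\<lambda>l'. tab' l' k) [0..<\<kappa>])"
  shows "states \<omega> (t + n) = (if Suc i < d then Explore a \<kappa> j l (Suc i) 0 0 tab'
     else if Suc l < \<kappa> then Explore a \<kappa> j (Suc l) 0 0 0 tab'
     else if N_hat j < qnorm d q th then Exploit (a_hat d q th)
     else Explore a \<kappa> (Suc j) 0 0 0 0 (\<lambda>_ _. 0))"
proof -
  obtain m where m: "n = Suc m" using n gr0_conv_Suc by blast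
  have "states \<omega> (t + n) = valee_update d q T \<delta> (states \<omega> (t + m))
     (inner_d d (valee_action (states \<omega> (t + m))) (\<omega> (t + m)))"
    by (simp add: m Let_def)
  also have "states \<omega> (t + m) = Explore a \<kappa> j l i m (\<Sum>k<m. \<omega> (t + k) i) tab"
    using states_block_within[OF st i, of m] m unfolding n_def by simp
  finally show ?thesis
    unfolding valee_action.simps inner_unit_vec[OF i] valee_update.simps Let_def th_def tab'_def m
    using m unfolding n_def by (simp add: add.commute del: of_nat_Suc)
qed

text \<open>Block \<open>b\<close> belongs to repetition \<open>b div d\<close> and coordinate
  \<open>b mod d\<close>. Only entries of completed blocks are pinned down, which suffices since the
  medians are taken after the last block.\<close>

lemma states_phase_within:
  fixes a j t
  defines "n \<equiv> phase_len a j"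
  assumes st: "states \<omega> t = Explore a \<kappa> j 0 0 0 0 tab0" and n: "0 < n"
  assumes b: "b < \<kappa> * d"
  shows "\<exists>tab. states \<omega> (t + b * n) = Explore a \<kappa> j (b div d) (b mod d) 0 0 tab \<and>
    (\<forall>c<b. tab (c div d) (c mod d) = bavg n (c div d) (c mod d) (shift_seq t \<omega>))"
  using b
proof (induction b)
  case 0
  then show ?case using st by simp
next
  case (Suc b)
  then obtain tab where tab: "states \<omega> (t + b * n) = Explore a \<kappa> j (b div d) (b mod d) 0 0 tab"
    "\<And>c. c < b \<Longrightarrow> tab (c div d) (c mod d) = bavg n (c div d) (c mod d) (shift_seq t \<omega>)"
    by auto
  let ?l = "b div d" and ?i = "b mod d"
  define tab' where "tab' = tab(?l := (tab ?l)(?i := (\<Sum>k<n. \<omega> (t + b * n + k) ?i) / real n))"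
  have i: "?i < d" using d by simp
  \<comment> \<open>The last branch is left unevaluated: the end of the phase is not reached as long
    as \<open>Suc b < \<kappa> * d\<close>.\<close>
  have end_st: "states \<omega> (t + Suc b * n) = (if Suc ?i < d then Explore a \<kappa> j ?l (Suc ?i) 0 0 tab'
     else if Suc ?l < \<kappa> then Explore a \<kappa> j (Suc ?l) 0 0 0 tab'
     else states \<omega> (t + Suc b * n))"
    using states_block_end[OF tab(1) i] n unfolding n_def tab'_def by (simp add: algebra_simps)
  \<comment> \<open>If block \<open>b\<close> closes a repetition, then \<open>Suc b\<close> is a
    multiple of \<open>d\<close> below \<open>\<kappa> * d\<close>, so another repetition
    follows.\<close>
  have "Suc ?l < \<kappa>" if "\<not> Suc ?i < d"
  proof -
    have "Suc b = d * Suc ?l" using that i div_mult_mod_eq[of b d]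
      by (metis add_Suc_right linorder_neqE_nat mult.commute mult_Suc_right not_less_eq add.commute)
    then have "d * Suc ?l < d * \<kappa>" using Suc.prems by (simp add: mult.commute)
    then show ?thesis by (simp only: nat_mult_less_cancel1[OF less_le_trans[OF zero_less_one d]])
  qed
  then have "states \<omega> (t + Suc b * n) = Explore a \<kappa> j (Suc b div d) (Suc b mod d) 0 0 tab'"
    using end_st i by (auto simp: div_Suc mod_Suc)
  moreover have "tab' (c div d) (c mod d) = bavg n (c div d) (c mod d) (shift_seq t \<omega>)" if "c < Suc b" for c
  proof (cases "c = b")
    case True
    then show ?thesis by (simp add: tab'_def bavg_def shift_seq_apply add.assoc)
  next
    case False
    then have "\<not> (c div d = ?l \<and> c mod d = ?i)" by (metis div_mult_mod_eq)
    then show ?thesis using tab(2)[of c] that False by (auto simp: tab'_def)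
  qed
  ultimately show ?case by blast
qed

lemma states_phase_end:
  fixes a j t
  defines "n \<equiv> phase_len a j"
  assumes st: "states \<omega> t = Explore a \<kappa> j 0 0 0 0 tab0" and n: "0 < n" and k: "0 < \<kappa>"
  defines "th \<equiv> mom n (shift_seq t \<omega>)"
  shows "states \<omega> (t + \<kappa> * d * n) = (if N_hat j < qnorm d q th then Exploit (a_hat d q th)
     else Explore a \<kappa> (Suc j) 0 0 0 0 (\<lambda>_ _. 0))"
proof -
  define b where "b = \<kappa> * d - 1"
  have b: "b < \<kappa> * d" "Suc b = \<kappa> * d" using k d by (auto simp: b_def)
  have bdm: "b div d = \<kappa> - 1" "b mod d = d - 1"
  proof -
    obtain k' where k': "\<kappa> = Suc k'" using k gr0_conv_Suc by blast
    have b': "b = (d - 1) + k' * d" using d by (simp add: b_def k')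
    show "b div d = \<kappa> - 1" "b mod d = d - 1" unfolding b' k' using d by (simp_all only: div_mult_self1 mod_mult_self1, simp_all)
  qed
  obtain tab where tab: "states \<omega> (t + b * n) = Explore a \<kappa> j (b div d) (b mod d) 0 0 tab"
    "\<And>c. c < b \<Longrightarrow> tab (c div d) (c mod d) = bavg n (c div d) (c mod d) (shift_seq t \<omega>)"
    using states_phase_within[OF st, of b] n b(1) unfolding n_def by auto
  let ?l = "b div d" and ?i = "b mod d"
  define tab' where "tab' = tab(?l := (tab ?l)(?i := (\<Sum>k<n. \<omega> (t + b * n + k) ?i) / real n))"
  define th' where "th' = (\<lambda>k. median (map (\<lambda>l'. tab' l' k) [0..<\<kappa>]))"
  have tab': "tab' l i = bavg n l i (shift_seq t \<omega>)" if "i < d" "l < \<kappa>" for l i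
  proof -
    define c where "c = l * d + i"
    have c: "c div d = l" "c mod d = i" using that by (auto simp: c_def)
    have "c < \<kappa> * d"
    proof -
      have "c < Suc l * d" using that by (simp add: c_def)
      also have "\<dots> \<le> \<kappa> * d" using that by (intro mult_le_mono1) auto
      finally show ?thesis .
    qed
    show ?thesis
    proof (cases "c = b")
      case True
      have "b = l * d + i" using True c_def by simp
      then have "tab' l i = (\<Sum>k<n. \<omega> (t + (l * d + i) * n + k) i) / real n"
        unfolding tab'_def using that by simp
      then show ?thesis by (simp add: bavg_def shift_seq_apply add.assoc)
    next
      case False
      then have "\<not> (l = ?l \<and> i = ?i)" using c by (metis div_mult_mod_eq)
      then show ?thesis using tab(2)[of c] \<open>c < \<kappa> * d\<close> False b c by (auto simp: tab'_def)
    qed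
  qed
  \<comment> \<open>From \<open>d\<close> on the two tables may differ, but neither the norm nor the
    action reads those entries.\<close>
  have th': "th' i = th i" if "i < d" for i
    unfolding th'_def th_def mom_def using tab' that by (intro arg_cong[of _ _ median] map_cong) auto
  have qn: "qnorm d q th' = qnorm d q th" unfolding qnorm_def using th' by simp
  have ah: "a_hat d q th' = a_hat d q th" unfolding a_hat_def qn using th' by (auto simp: fun_eq_iff)
  have t_eq: "t + \<kappa> * d * n = t + b * n + n" using b(2) by (simp flip: b(2))
  have last: "?i < d" "\<not> Suc ?i < d" "\<not> Suc ?l < \<kappa>" using bdm d k by auto
  have "states \<omega> (t + \<kappa> * d * n) = (if N_hat j < qnorm d q th' then Exploit (a_hat d q th')
     else Explore a \<kappa> (Suc j) 0 0 0 0 (\<lambda>_ _. 0))"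
    using states_block_end[OF tab(1) last(1), folded n_def, OF n, folded tab'_def, folded th'_def] last(2,3)
    unfolding t_eq by simp
  then show ?thesis unfolding qn ah .
qed

lemma states_exploit: "states \<omega> t = Exploit a \<Longrightarrow> t \<le> t' \<Longrightarrow> states \<omega> t' = Exploit a"
  by (rotate_tac, induction t' rule: dec_induct) (auto simp: Let_def)

end

subsection \<open>Medians of block averages\<close>

lemma length_filter_map_upt:
  "length (filter P (map x [0..<k])) = card {l. l < k \<and> P (x l)}"
proof -
  have "length (filter P (map x [0..<k])) = length (filter (\<lambda>l. P (x l)) [0..<k])"
    by (simp add: filter_map o_def)
  also have "\<dots> = card (set (filter (\<lambda>l. P (x l)) [0..<k]))"
    by (rule distinct_card[symmetric]) simp
  also have "set (filter (\<lambda>l. P (x l)) [0..<k]) = {l. l < k \<and> P (x l)}" by auto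
  finally show ?thesis .
qed

lemma prod_if_const: "(\<Prod>l<(k::nat). if P l then c else (1::'b::comm_semiring_1)) = c ^ card {l. l < k \<and> P l}"
proof -
  have "(\<Prod>l<k. if P l then c else 1) = (\<Prod>l\<in>{l. l < k \<and> P l}. c)"
    by (rule prod.mono_neutral_cong_right) auto
  then show ?thesis by simp
qed

text \<open>If the median is off by at least \<open>r\<close>, so are all sorted values beyond it on
  the same side, and these are at least half of all values.\<close>

lemma median_close:
  fixes x :: "nat \<Rightarrow> real"
  assumes few: "2 * card {l. l < k \<and> r \<le> \<bar>x l - c\<bar>} < k"
  shows "\<bar>median (map x [0..<k]) - c\<bar> < r"
proof (rule ccontr)
  assume far: "\<not> ?thesis"
  define ys where "ys = sort (map x [0..<k])"
  \<comment> \<open>The index of the lower median; both \<open>k - m\<close> and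
    \<open>Suc m\<close> are at least \<open>k / 2\<close>, one for each side.\<close>
  define m where "m = (k - 1) div 2"
  have len: "length ys = k" and srt: "sorted ys" by (auto simp: ys_def)
  have k: "0 < k" using few by simp
  then have m: "m < k" by (auto simp: m_def)
  have med: "median (map x [0..<k]) = ys ! m" by (simp add: median_def ys_def m_def)
  have cnt: "length (filter P ys) = card {l. l < k \<and> P (x l)}" for P
  proof -
    have "length (filter P ys) = size (mset (filter P ys))" by (rule size_mset[symmetric])
    also have "\<dots> = length (filter P (map x [0..<k]))" by (simp only: mset_filter ys_def mset_sort size_mset[symmetric])
    finally show ?thesis by (simp only: length_filter_map_upt)
  qed
  have sub: "card {l. l < k \<and> P (x l)} \<le> card {l. l < k \<and> r \<le> \<bar>x l - c\<bar>}"
    if "\<And>y. P y \<Longrightarrow> r \<le> \<bar>y - c\<bar>" for P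
    using that by (intro card_mono) auto
  from far consider "c + r \<le> ys ! m" | "ys ! m \<le> c - r" unfolding med by linarith
  then have "k \<le> 2 * card {l. l < k \<and> r \<le> \<bar>x l - c\<bar>}"
  proof cases
    case 1
    have "filter (\<lambda>y. c + r \<le> y) (drop m ys) = drop m ys"
      unfolding filter_id_conv
    proof
      fix y assume "y \<in> set (drop m ys)"
      then obtain i where "i < k - m" "y = ys ! (m + i)" using len m by (auto simp: in_set_conv_nth)
      moreover from this have "ys ! m \<le> ys ! (m + i)"
        using srt len by (intro sorted_nth_mono) auto
      ultimately show "c + r \<le> y" using 1 by linarith
    qed
    moreover have "filter P ys = filter P (take m ys) @ filter P (drop m ys)" for P
      by (metis append_take_drop_id filter_append)
    ultimately have "k - m \<le> length (filter (\<lambda>y. c + r \<le> y) ys)" using len by simp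
    also have "\<dots> \<le> card {l. l < k \<and> r \<le> \<bar>x l - c\<bar>}" unfolding cnt by (intro sub) auto
    finally show ?thesis using k by (simp add: m_def)
  next
    case 2
    have "filter (\<lambda>y. y \<le> c - r) (take (Suc m) ys) = take (Suc m) ys"
      unfolding filter_id_conv
    proof
      fix y assume "y \<in> set (take (Suc m) ys)"
      then obtain i where "i \<le> m" "y = ys ! i" using len m by (auto simp: in_set_conv_nth less_Suc_eq_le)
      moreover from this have "ys ! i \<le> ys ! m"
        using srt len m by (intro sorted_nth_mono) auto
      ultimately show "y \<le> c - r" using 2 by linarith
    qed
    moreover have "filter P ys = filter P (take (Suc m) ys) @ filter P (drop (Suc m) ys)" for P
      by (metis append_take_drop_id filter_append)
    ultimately have "Suc m \<le> length (filter (\<lambda>y. y \<le> c - r) ys)" using len m by simp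
    also have "\<dots> \<le> card {l. l < k \<and> r \<le> \<bar>x l - c\<bar>}" unfolding cnt by (intro sub) auto
    finally show ?thesis using k by (simp add: m_def)
  qed
  with few show False by simp
qed

locale valee_model = valee_params d p q T \<delta> + sequence_space \<nu>
  for d :: nat and p q :: real and T :: nat and \<delta> :: real and \<nu> :: "(nat \<Rightarrow> real) measure" +
  assumes sets_\<nu>: "sets \<nu> = sets (PiM {..<d} (\<lambda>_. borel))"
    and bounded: "\<And>a. a \<in> lp_ball d p \<Longrightarrow> AE \<theta> in \<nu>. \<bar>inner_d d a \<theta>\<bar> \<le> 1"
begin

abbreviation "\<theta> \<equiv> theta_star \<nu>"
abbreviation "\<sigma>2 \<equiv> Sigma_diag \<nu>"
abbreviation "\<theta>n \<equiv> qnorm d q \<theta>"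

section \<open>Moments of single coordinates and of their centred sums\<close>

lemma coord_measurable_\<nu>: "i < d \<Longrightarrow> (\<lambda>x. x i) \<in> borel_measurable \<nu>"
proof -
  assume "i < d"
  then have "(\<lambda>x. x i) \<in> borel_measurable (PiM {..<d} (\<lambda>_. borel :: real measure))"
    by (intro measurable_component_singleton) auto
  then show ?thesis by (simp only: measurable_cong_sets[OF sets_\<nu> refl])
qed

lemma coord_measurable: "i < d \<Longrightarrow> (\<lambda>\<omega>. \<omega> t i) \<in> borel_measurable S"
  using measurable_compose[OF measurable_component_singleton[of t UNIV "\<lambda>_. \<nu>"] coord_measurable_\<nu>] by simp

lemma coord_bounded: "i < d \<Longrightarrow> AE x in \<nu>. \<bar>x i\<bar> \<le> 1"
  using bounded[OF unit_vec_in_lp_ball, of i] by (simp add: inner_unit_vec)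

lemma coord_integrable: "i < d \<Longrightarrow> integrable \<nu> (\<lambda>x. x i)"
  by (rule M.integrable_const_bound[where B = 1]) (auto intro: coord_measurable_\<nu> coord_bounded)

lemma dev_sq_integrable: "i < d \<Longrightarrow> integrable \<nu> (\<lambda>x. (x i - \<theta> i)\<^sup>2)"
proof (rule M.integrable_const_bound[where B = "(1 + \<bar>\<theta> i\<bar>)\<^sup>2"])
  assume i: "i < d"
  show "AE x in \<nu>. norm ((x i - \<theta> i)\<^sup>2) \<le> (1 + \<bar>\<theta> i\<bar>)\<^sup>2"
    using coord_bounded[OF i] by eventually_elim (auto intro!: power2_le_iff_abs_le[THEN iffD2])
  show "(\<lambda>x. (x i - \<theta> i)\<^sup>2) \<in> borel_measurable \<nu>"
    using coord_measurable_\<nu>[OF i] by simp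
qed

lemma Sigma_nonneg: "0 \<le> \<sigma>2 i"
  unfolding Sigma_diag_def by simp

lemma inner_integral: "(\<integral>x. inner_d d a x \<partial>\<nu>) = inner_d d a \<theta>"
proof -
  have "integrable \<nu> (\<lambda>x. a i * x i)" if "i < d" for i
    using coord_integrable[OF that] by simp
  then show ?thesis unfolding inner_d_def theta_star_def
    by (subst Bochner_Integration.integral_sum) auto
qed

lemma inner_theta_le: "a \<in> lp_ball d p \<Longrightarrow> inner_d d a \<theta> \<le> 1"
proof -
  assume a: "a \<in> lp_ball d p"
  have "integrable \<nu> (\<lambda>x. a i * x i)" if "i < d" for i
    using coord_integrable[OF that] by simp
  then have int: "integrable \<nu> (\<lambda>x. inner_d d a x)"
    unfolding inner_d_def by (intro Bochner_Integration.integrable_sum) auto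
  have "(\<integral>x. inner_d d a x \<partial>\<nu>) \<le> (\<integral>x. 1 \<partial>\<nu>)"
    using int bounded[OF a] by (intro integral_mono_AE) auto
  then show ?thesis by (simp add: inner_integral M.prob_space)
qed

lemma theta_norm_le_1: "\<theta>n \<le> 1"
  using inner_theta_le[OF a_hat_in_lp_ball, of \<theta>] by (simp add: inner_a_hat_self)

lemma distr_coord: "distr S \<nu> (\<lambda>\<omega>. \<omega> t) = \<nu>"
  by (rule distr_PiM_component) (auto intro: M.prob_space_axioms)

lemma coord_integral:
  fixes f :: "(nat \<Rightarrow> real) \<Rightarrow> real"
  assumes [measurable]: "f \<in> borel_measurable \<nu>"
  shows "(\<integral>\<omega>. f (\<omega> t) \<partial>S) = (\<integral>x. f x \<partial>\<nu>)" and "integrable \<nu> f \<Longrightarrow> integrable S (\<lambda>\<omega>. f (\<omega> t))"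
proof -
  have [measurable]: "(\<lambda>\<omega>. \<omega> t) \<in> S \<rightarrow>\<^sub>M \<nu>" by (rule measurable_component_singleton) simp
  show "(\<integral>\<omega>. f (\<omega> t) \<partial>S) = (\<integral>x. f x \<partial>\<nu>)"
    using integral_distr[of "\<lambda>\<omega>. \<omega> t" S \<nu> f] by (simp add: distr_coord)
  show "integrable \<nu> f \<Longrightarrow> integrable S (\<lambda>\<omega>. f (\<omega> t))"
    using integrable_distr[of "\<lambda>\<omega>. \<omega> t" S \<nu> f] by (simp add: distr_coord)
qed

definition dev :: "nat \<Rightarrow> nat \<Rightarrow> (nat \<Rightarrow> nat \<Rightarrow> real) \<Rightarrow> real" where
  "dev i n \<omega> = (\<Sum>m<n. \<omega> m i - \<theta> i)"

lemma dev_measurable: "i < d \<Longrightarrow> dev i n \<in> borel_measurable S"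
proof -
  assume i: "i < d"
  note [measurable] = coord_measurable[OF i]
  show ?thesis unfolding dev_def by measurable
qed

lemma dev_1:
  assumes i: "i < d"
  shows "integrable S (\<lambda>\<omega>. \<omega> t i - \<theta> i)" "(\<integral>\<omega>. \<omega> t i - \<theta> i \<partial>S) = 0"
    "integrable S (\<lambda>\<omega>. (\<omega> t i - \<theta> i)\<^sup>2)" "(\<integral>\<omega>. (\<omega> t i - \<theta> i)\<^sup>2 \<partial>S) = \<sigma>2 i"
proof -
  note [measurable] = coord_measurable_\<nu>[OF i]
  have int: "integrable \<nu> (\<lambda>x. x i - \<theta> i)" using coord_integrable[OF i] by simp
  show "integrable S (\<lambda>\<omega>. \<omega> t i - \<theta> i)" using int by (intro coord_integral(2)) auto
  show "integrable S (\<lambda>\<omega>. (\<omega> t i - \<theta> i)\<^sup>2)"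
    using dev_sq_integrable[OF i] by (intro coord_integral(2)) auto
  show "(\<integral>\<omega>. \<omega> t i - \<theta> i \<partial>S) = 0"
    using coord_integrable[OF i] coord_integral(1)[of "\<lambda>x. x i - \<theta> i" t]
    by (simp add: M.prob_space theta_star_def)
  show "(\<integral>\<omega>. (\<omega> t i - \<theta> i)\<^sup>2 \<partial>S) = \<sigma>2 i"
    using coord_integral(1)[of "\<lambda>x. (x i - \<theta> i)\<^sup>2" t] by (simp add: Sigma_diag_def)
qed

text \<open>The first draw is independent of the shifted remainder and both are centred, so the
  cross term vanishes and variances add.\<close>

lemma dev_moments:
  assumes i: "i < d"
  shows "integrable S (dev i n) \<and> (\<integral>\<omega>. dev i n \<omega> \<partial>S) = 0 \<and>
    integrable S (\<lambda>\<omega>. (dev i n \<omega>)\<^sup>2) \<and> (\<integral>\<omega>. (dev i n \<omega>)\<^sup>2 \<partial>S) = real n * \<sigma>2 i"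
proof (induction n)
  case 0
  show ?case by (simp add: dev_def[abs_def])
next
  case (Suc n)
  let ?f = "\<lambda>\<omega> :: nat \<Rightarrow> nat \<Rightarrow> real. \<omega> 0 i - \<theta> i"
  let ?h = "\<lambda>\<omega>. dev i n (shift_seq 1 \<omega>)"
  have IH: "integrable S (dev i n)" "(\<integral>\<omega>. dev i n \<omega> \<partial>S) = 0"
    "integrable S (\<lambda>\<omega>. (dev i n \<omega>)\<^sup>2)" "(\<integral>\<omega>. (dev i n \<omega>)\<^sup>2 \<partial>S) = real n * \<sigma>2 i"
    using Suc by auto
  note [measurable] = dev_measurable[OF i, of n]
  have eq: "dev i (Suc n) = (\<lambda>\<omega>. ?f \<omega> + ?h \<omega>)"
    by (auto simp: dev_def shift_seq_apply fun_eq_iff sum.lessThan_Suc_shift simp del: sum.lessThan_Suc)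
  have eq2: "(\<lambda>\<omega>. (dev i (Suc n) \<omega>)\<^sup>2) = (\<lambda>\<omega>. (?f \<omega>)\<^sup>2 + 2 * (?f \<omega> * ?h \<omega>) + (?h \<omega>)\<^sup>2)"
    by (simp add: eq fun_eq_iff power2_sum)
  have dep: "depends_below 1 ?f" by (simp add: depends_below_def)
  have h1: "integrable S ?h" "(\<integral>\<omega>. ?h \<omega> \<partial>S) = 0"
    using integrable_shift_seq[OF IH(1), of 1] integral_shift_seq[of "dev i n" 1] IH by auto
  have h2: "integrable S (\<lambda>\<omega>. (?h \<omega>)\<^sup>2)" "(\<integral>\<omega>. (?h \<omega>)\<^sup>2 \<partial>S) = real n * \<sigma>2 i"
    using integrable_shift_seq[OF IH(3), of 1] integral_shift_seq[of "\<lambda>\<omega>. (dev i n \<omega>)\<^sup>2" 1] IH by auto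
  have cr: "integrable S (\<lambda>\<omega>. ?f \<omega> * ?h \<omega>)" "(\<integral>\<omega>. ?f \<omega> * ?h \<omega> \<partial>S) = 0"
    using integral_mult_shift_seq[OF dev_1(1)[OF i] IH(1) dep] IH(2) by auto
  note f = dev_1[OF i, of 0]
  have "integrable S (dev i (Suc n))" "(\<integral>\<omega>. dev i (Suc n) \<omega> \<partial>S) = 0"
    unfolding eq using f h1 by auto
  moreover have "integrable S (\<lambda>\<omega>. (dev i (Suc n) \<omega>)\<^sup>2)"
    unfolding eq2 using f h2 cr by auto
  moreover have "(\<integral>\<omega>. (dev i (Suc n) \<omega>)\<^sup>2 \<partial>S) = \<sigma>2 i + 2 * 0 + real n * \<sigma>2 i"
    unfolding eq2 using f h2 cr by (simp del: integral_mult_right_zero)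
  ultimately show ?case by (simp add: algebra_simps)
qed

section \<open>Failure probabilities of medians of means\<close>

definition w :: "nat \<Rightarrow> real" where "w i = \<sigma>2 i + \<tau>"

lemma w_pos: "0 < w i" using Sigma_nonneg[of i] tau_pos by (simp add: w_def)

text \<open>The Chebyshev radius for failure probability 1/8, with \<open>w i\<close> as upper bound
  for the variance. At block length \<open>8 / (\<alpha>\<^sup>2 * N_hat j)\<close> it equals
  \<open>\<alpha> * sqrt (N_hat j * w i)\<close>.\<close>

definition rad :: "nat \<Rightarrow> nat \<Rightarrow> real" where "rad n i = sqrt (8 * w i / real n)"

definition bad_block :: "nat \<Rightarrow> nat \<Rightarrow> nat \<Rightarrow> (nat \<Rightarrow> nat \<Rightarrow> real) \<Rightarrow> bool" where
  "bad_block n i l \<omega> \<longleftrightarrow> rad n i \<le> \<bar>bavg n l i \<omega> - \<theta> i\<bar>"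

lemma bavg_measurable: "i < d \<Longrightarrow> bavg n l i \<in> borel_measurable S"
proof -
  assume i: "i < d"
  note [measurable] = coord_measurable[OF i]
  show ?thesis unfolding bavg_def[abs_def] by measurable
qed

lemma bad_block_measurable: "i < d \<Longrightarrow> Measurable.pred S (bad_block n i l)"
proof -
  assume i: "i < d"
  note [measurable] = bavg_measurable[OF i]
  show ?thesis unfolding bad_block_def[abs_def] by measurable
qed

text \<open>Chebyshev's inequality. The first repetition suffices, since the others are shifts of
  it.\<close>

lemma bad_block_prob:
  assumes i: "i < d" and n: "0 < n"
  shows "measure S {\<omega> \<in> space S. bad_block n i 0 \<omega>} \<le> 1 / 8"
proof -
  note [measurable] = dev_measurable[OF i, of n]
  let ?r = "rad n i * real n"
  let ?h = "\<lambda>\<omega>. dev i n (shift_seq (i * n) \<omega>)"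
  have r: "0 < ?r" using w_pos[of i] n by (simp add: rad_def)
  have r2: "?r\<^sup>2 = 8 * w i * real n"
    using w_pos[of i] n by (simp add: rad_def power_mult_distrib) (simp add: power2_eq_square)
  have h2: "integrable S (\<lambda>\<omega>. (?h \<omega>)\<^sup>2)" "(\<integral>\<omega>. (?h \<omega>)\<^sup>2 \<partial>S) = real n * \<sigma>2 i"
    using integrable_shift_seq[of "\<lambda>\<omega>. (dev i n \<omega>)\<^sup>2"] integral_shift_seq[of "\<lambda>\<omega>. (dev i n \<omega>)\<^sup>2"]
      dev_moments[OF i, of n] by auto
  have "bavg n 0 i \<omega> - \<theta> i = ?h \<omega> / real n" for \<omega>
    using n by (simp add: bavg_def dev_def shift_seq_apply sum_subtractf field_simps)
  then have "bad_block n i 0 \<omega> \<longleftrightarrow> ?r \<le> \<bar>?h \<omega>\<bar>" for \<omega>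
    using n by (simp add: bad_block_def abs_divide pos_le_divide_eq)
  also have "\<dots> \<omega> \<longleftrightarrow> ?r\<^sup>2 \<le> (?h \<omega>)\<^sup>2" for \<omega>
    using r by (metis abs_le_square_iff abs_of_pos)
  finally have "measure S {\<omega> \<in> space S. bad_block n i 0 \<omega>} = measure S {\<omega> \<in> space S. ?r\<^sup>2 \<le> (?h \<omega>)\<^sup>2}"
    by simp
  also have "\<dots> \<le> (\<integral>\<omega>. (?h \<omega>)\<^sup>2 \<partial>S) / ?r\<^sup>2"
    using h2 r n by (intro integral_Markov_inequality_measure[where A = "space S"]) auto
  also have "\<dots> = \<sigma>2 i / (8 * w i)" unfolding h2 r2 using n by simp
  also have "\<dots> \<le> 1 / 8" using w_pos[of i] tau_pos by (simp add: field_simps w_def)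
  finally show ?thesis .
qed

definition bad_phase :: "nat \<Rightarrow> nat \<Rightarrow> (nat \<Rightarrow> nat \<Rightarrow> real) set" where
  "bad_phase i n = {\<omega> \<in> space S. \<kappa> \<le> 2 * card {l. l < \<kappa> \<and> bad_block n i l \<omega>}}"

text \<open>Each block is bad with probability at most 1/8, so the weight 9 per bad block has mean
  at most 2 per block, whereas half of the blocks being bad means total weight at least \<open>3 ^ \<kappa>\<close>.\<close>

lemma bad_phase_prob:
  assumes i: "i < d" and n: "0 < n"
  shows "bad_phase i n \<in> sets S" and "measure S (bad_phase i n) \<le> (2/3) ^ \<kappa>"
proof -
  define g where "g = (\<lambda>\<omega>. if bad_block n i 0 \<omega> then 9 else 1 :: ennreal)"
  note [measurable] = bad_block_measurable[OF i]
  have [measurable]: "g \<in> borel_measurable S" unfolding g_def by measurable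
  have avg: "bavg n l i \<omega> = bavg n 0 i (shift_seq (l * (d * n)) \<omega>)" for l \<omega>
    by (simp add: bavg_def shift_seq_apply algebra_simps)
  have dep: "depends_below (d * n) g"
    unfolding depends_below_def
  proof (intro allI impI)
    fix \<omega> \<omega>' :: "nat \<Rightarrow> nat \<Rightarrow> real" assume ag: "\<forall>t<d * n. \<omega>' t = \<omega> t"
    have "i * n + m < d * n" if "m < n" for m
    proof -
      have "i * n + m < Suc i * n" using that by simp
      also have "\<dots> \<le> d * n" using i by (intro mult_le_mono1) simp
      finally show ?thesis .
    qed
    then have "bavg n 0 i \<omega>' = bavg n 0 i \<omega>" using ag by (simp add: bavg_def)
    then show "g \<omega>' = g \<omega>" by (simp add: g_def bad_block_def)
  qed
  let ?G = "\<lambda>\<omega>. \<Prod>l<\<kappa>. g (shift_seq (l * (d * n)) \<omega>)"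
  have G: "?G \<omega> = 9 ^ card {l. l < \<kappa> \<and> bad_block n i l \<omega>}" for \<omega>
    unfolding g_def bad_block_def avg[symmetric] by (rule prod_if_const)
  have iff: "(3::ennreal) ^ \<kappa> \<le> ?G \<omega> \<longleftrightarrow> \<kappa> \<le> 2 * card {l. l < \<kappa> \<and> bad_block n i l \<omega>}" for \<omega>
  proof -
    let ?c = "card {l. l < \<kappa> \<and> bad_block n i l \<omega>}"
    have "(9::ennreal) ^ ?c = ennreal (9 ^ ?c)" "(3::ennreal) ^ \<kappa> = ennreal (3 ^ \<kappa>)"
      by (simp_all add: ennreal_power[symmetric])
    moreover have "(9::real) ^ ?c = 3 ^ (2 * ?c)" by (simp add: power_mult)
    ultimately have "(3::ennreal) ^ \<kappa> \<le> ?G \<omega> \<longleftrightarrow> (3::real) ^ \<kappa> \<le> 3 ^ (2 * ?c)"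
      unfolding G by (simp add: ennreal_le_iff)
    then show ?thesis by simp
  qed
  have eq: "bad_phase i n = {\<omega> \<in> space S. 3 ^ \<kappa> \<le> ?G \<omega>}" unfolding bad_phase_def iff ..
  show [measurable]: "bad_phase i n \<in> sets S" unfolding eq by measurable
  have "(\<integral>\<^sup>+\<omega>. g \<omega> \<partial>S) = (\<integral>\<^sup>+\<omega>. 1 + 8 * indicator {\<omega> \<in> space S. bad_block n i 0 \<omega>} \<omega> \<partial>S)"
    by (intro nn_integral_cong) (auto simp: g_def indicator_def)
  also have "\<dots> = 1 + 8 * emeasure S {\<omega> \<in> space S. bad_block n i 0 \<omega>}"
    by (subst nn_integral_add) (auto simp: nn_integral_cmult P.emeasure_space_1)
  also have "\<dots> = ennreal (1 + 8 * measure S {\<omega> \<in> space S. bad_block n i 0 \<omega>})"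
    by (simp add: P.emeasure_eq_measure ennreal_plus ennreal_mult')
  also have "\<dots> \<le> ennreal 2" using bad_block_prob[OF i n] by (intro ennreal_leI) simp
  finally have g2: "(\<integral>\<^sup>+\<omega>. g \<omega> \<partial>S) \<le> 2" by simp
  have "3 ^ \<kappa> * emeasure S (bad_phase i n) = (\<integral>\<^sup>+\<omega>. 3 ^ \<kappa> * indicator (bad_phase i n) \<omega> \<partial>S)"
    by (simp add: nn_integral_cmult)
  also have "\<dots> \<le> (\<integral>\<^sup>+\<omega>. ?G \<omega> \<partial>S)"
    by (intro nn_integral_mono) (auto simp: eq indicator_def)
  also have "\<dots> = (\<integral>\<^sup>+\<omega>. g \<omega> \<partial>S) ^ \<kappa>" by (rule nn_integral_prod_shift_seq[OF _ dep]) simp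
  also have "\<dots> \<le> 2 ^ \<kappa>" using g2 by (intro power_mono) auto
  finally have "ennreal (3 ^ \<kappa> * measure S (bad_phase i n)) \<le> ennreal (2 ^ \<kappa>)"
    by (simp add: P.emeasure_eq_measure ennreal_mult' ennreal_power[symmetric])
  then have "3 ^ \<kappa> * measure S (bad_phase i n) \<le> 2 ^ \<kappa>" by (subst (asm) ennreal_le_iff) auto
  then show "measure S (bad_phase i n) \<le> (2/3) ^ \<kappa>" by (simp add: power_divide field_simps)
qed

lemma not_bad_phase:
  assumes "\<omega> \<in> space S" "\<omega> \<notin> bad_phase i n"
  shows "\<bar>mom n \<omega> i - \<theta> i\<bar> \<le> rad n i"
proof -
  have "2 * card {l. l < \<kappa> \<and> bad_block n i l \<omega>} < \<kappa>" using assms by (simp add: bad_phase_def)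
  then show ?thesis unfolding mom_def bad_block_def
    by (intro less_imp_le median_close) simp
qed

end

subsection \<open>Variance estimation and the good event\<close>

lemma exp_le_1_plus_2x: "exp x \<le> 1 + 2 * x" if "0 \<le> x" "x \<le> 1" for x :: real
proof -
  have "exp x \<le> 1 + x + x\<^sup>2" using that by (intro exp_bound) auto
  also have "x\<^sup>2 \<le> x" using that by (simp add: power2_eq_square mult_left_le)
  finally show ?thesis by simp
qed

lemma exp_minus_le_1_minus_half: "exp (- x) \<le> 1 - x / 2" if "0 \<le> x" "x \<le> 1" for x :: real
proof -
  have "1 \<le> (1 - x / 2) * (1 + x)"
  proof -
    have "x * x \<le> x" using that by (simp add: mult_left_le)
    then show ?thesis by (simp add: field_simps)
  qed
  also have "\<dots> \<le> (1 - x / 2) * exp x" using that by (intro mult_left_mono exp_ge_add_one_self) auto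
  finally show ?thesis by (simp add: exp_minus field_simps)
qed

context valee_model
begin

section \<open>Measurability and stopping-time property of the schedule\<close>

lemma vsum_measurable: "i < d \<Longrightarrow> vsum i n \<in> borel_measurable S"
proof -
  assume i: "i < d"
  note [measurable] = coord_measurable[OF i]
  show ?thesis unfolding vsum_def[abs_def] var_sample_def by measurable
qed

lemma nstop_measurable: "i < d \<Longrightarrow> nstop i \<in> measurable S (count_space UNIV)"
proof -
  assume i: "i < d"
  note [measurable] = vsum_measurable[OF i]
  show ?thesis unfolding nstop_def[abs_def] by measurable
qed

text \<open>A shift by a random amount is measurable because the amount has only countably many
  values.\<close>

lemma vstart_measurable: "i \<le> d \<Longrightarrow> vstart i \<in> measurable S (count_space UNIV)"
proof (induction i)
  case 0
  show ?case by simp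
next
  case (Suc i)
  then have [measurable]: "vstart i \<in> measurable S (count_space UNIV)" "nstop i \<in> measurable S (count_space UNIV)"
    by (auto intro: nstop_measurable)
  have [measurable]: "(\<lambda>\<omega>. nstop i (shift_seq (vstart i \<omega>) \<omega>)) \<in> measurable S (count_space UNIV)"
    by (rule measurable_compose_countable[of "\<lambda>s \<omega>. nstop i (shift_seq s \<omega>)"]) auto
  show ?case unfolding vstart.simps by measurable
qed

lemma nvar_measurable: "i < d \<Longrightarrow> nvar i \<in> measurable S (count_space UNIV)"
proof -
  assume i: "i < d"
  note [measurable] = nstop_measurable[OF i] vstart_measurable[OF less_imp_le[OF i]]
  show ?thesis unfolding nvar_def
    by (rule measurable_compose_countable[of "\<lambda>s \<omega>. nstop i (shift_seq s \<omega>)"]) auto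
qed

lemma sighat_measurable: "sighat \<in> borel_measurable S"
proof -
  have "(\<lambda>\<omega>. \<Sum>i<d. (Y1 / real (nvar i \<omega>)) powr (q / 2)) \<in> borel_measurable S"
  proof (rule borel_measurable_sum)
    fix i assume "i \<in> {..<d}"
    then have [measurable]: "nvar i \<in> measurable S (count_space UNIV)" by (simp add: nvar_measurable)
    show "(\<lambda>\<omega>. (Y1 / real (nvar i \<omega>)) powr (q / 2)) \<in> borel_measurable S" by measurable
  qed
  moreover have "sighat = (\<lambda>\<omega>. (\<Sum>i<d. (Y1 / real (nvar i \<omega>)) powr (q / 2)) powr (2 / q))"
    by (auto simp: sighat_def sigma_q_hat_def vest_def fun_eq_iff)
  ultimately show ?thesis by simp
qed

lemma plen_measurable: "plen j \<in> measurable S (count_space UNIV)"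
proof -
  note [measurable] = sighat_measurable
  show ?thesis unfolding plen_def[abs_def] phase_len_def alpha_def valee_alpha_def by measurable
qed

lemma pstart_measurable: "pstart j \<in> measurable S (count_space UNIV)"
proof (induction j)
  case 0
  show ?case using vstart_measurable[of d] by simp
next
  case (Suc j)
  note [measurable] = Suc plen_measurable[of j]
  show ?case unfolding pstart.simps by measurable
qed

lemma nstop_cong:
  assumes "\<And>t. t < 2 * nstop i \<omega> \<Longrightarrow> \<omega>' t = \<omega> t"
  shows "nstop i \<omega>' = nstop i \<omega>"
proof -
  have eq: "vsum i n \<omega>' = vsum i n \<omega>" if "n \<le> nstop i \<omega>" for n
    unfolding vsum_def using assms that by (intro sum.cong) auto
  have "nstop i \<omega>' \<le> nstop i \<omega>" unfolding nstop_le_iff eq[OF order.refl] by (rule nstop_ge)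
  moreover have "nstop i \<omega> \<le> nstop i \<omega>'"
    using nstop_ge[of i \<omega>'] eq[of "nstop i \<omega>'"] calculation unfolding nstop_le_iff by simp
  ultimately show ?thesis by simp
qed

lemma vstart_nvar_cong:
  assumes "\<And>t. t < vstart i \<omega> \<Longrightarrow> \<omega>' t = \<omega> t"
  shows "vstart i \<omega>' = vstart i \<omega> \<and> (\<forall>k<i. nvar k \<omega>' = nvar k \<omega>)"
  using assms
proof (induction i)
  case (Suc i)
  then have IH: "vstart i \<omega>' = vstart i \<omega>" "\<forall>k<i. nvar k \<omega>' = nvar k \<omega>" by auto
  have "nvar i \<omega>' = nvar i \<omega>" unfolding nvar_def IH(1)
    using Suc.prems by (intro nstop_cong) (simp add: shift_seq_apply)
  with IH show ?case by (auto simp: less_Suc_eq nvar_def)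
qed simp

lemma pstart_ge: "vstart d \<omega> \<le> pstart j \<omega>"
  by (induction j) auto

text \<open>This is the hypothesis \<open>stop\<close> of \<open>strong_markov_le\<close>, with the
  block length as mark. It holds because the variance estimation, which determines every boundary
  and length, is over before any phase begins.\<close>

lemma pstart_plen_cong:
  assumes "\<And>t. t < pstart j \<omega> \<Longrightarrow> \<omega>' t = \<omega> t"
  shows "pstart j \<omega>' = pstart j \<omega> \<and> plen j \<omega>' = plen j \<omega>"
proof -
  have n: "vstart d \<omega>' = vstart d \<omega>" "\<forall>k<d. nvar k \<omega>' = nvar k \<omega>"
    using assms pstart_ge[of \<omega> j] vstart_nvar_cong[of d \<omega> \<omega>'] by auto
  then have "vest d \<omega>' = vest d \<omega>" by (auto simp: vest_def)
  then have pl: "plen k \<omega>' = plen k \<omega>" for k by (simp add: plen_def alpha_def sighat_def)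
  have "pstart k \<omega>' = pstart k \<omega>" for k by (induction k) (auto simp: n pl)
  with pl show ?thesis by simp
qed

section \<open>Mean and tails of the variance samples\<close>

definition zvar :: "nat \<Rightarrow> (nat \<Rightarrow> nat \<Rightarrow> real) \<Rightarrow> real" where
  "zvar i \<omega> = var_sample \<tau> (\<omega> 0 i) (\<omega> 1 i)"

definition \<mu> :: "nat \<Rightarrow> real" where "\<mu> i = (\<integral>\<omega>. zvar i \<omega> \<partial>S)"

lemma zvar_measurable: "i < d \<Longrightarrow> zvar i \<in> borel_measurable S"
proof -
  assume i: "i < d"
  note [measurable] = coord_measurable[OF i]
  show ?thesis unfolding zvar_def[abs_def] var_sample_def by measurable
qed

lemma zvar_nonneg: "0 \<le> zvar i \<omega>"
  by (simp add: zvar_def var_sample_nonneg)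

lemma depends_below_zvar: "depends_below 2 (\<lambda>\<omega>. f (zvar i \<omega>))"
  by (simp add: depends_below_def zvar_def)

lemma vsum_zvar: "vsum i n \<omega> = (\<Sum>m<n. zvar i (shift_seq (m * 2) \<omega>))"
  by (simp add: vsum_def zvar_def shift_seq_apply mult.commute)

lemma sq_diff_integral:
  assumes i: "i < d"
  shows "integrable S (\<lambda>\<omega>. (\<omega> 0 i - \<omega> 1 i)\<^sup>2)" "(\<integral>\<omega>. (\<omega> 0 i - \<omega> 1 i)\<^sup>2 \<partial>S) = 2 * \<sigma>2 i"
proof -
  let ?f = "\<lambda>\<omega> :: nat \<Rightarrow> nat \<Rightarrow> real. \<omega> 0 i - \<theta> i"
  let ?g = "\<lambda>\<omega> :: nat \<Rightarrow> nat \<Rightarrow> real. \<omega> 1 i - \<theta> i"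
  have eq: "(\<lambda>\<omega>. (\<omega> 0 i - \<omega> 1 i)\<^sup>2) = (\<lambda>\<omega>. (?f \<omega>)\<^sup>2 - 2 * (?f \<omega> * ?g \<omega>) + (?g \<omega>)\<^sup>2)"
    by (simp add: fun_eq_iff power2_eq_square algebra_simps)
  have dep: "depends_below 1 ?f" by (simp add: depends_below_def)
  note f = dev_1[OF i, of 0] and g = dev_1[OF i, of 1]
  have cr: "integrable S (\<lambda>\<omega>. ?f \<omega> * ?g \<omega>)" "(\<integral>\<omega>. ?f \<omega> * ?g \<omega> \<partial>S) = 0"
    using integral_mult_shift_seq[OF f(1) f(1) dep] f(2) by (auto simp: shift_seq_apply)
  show "integrable S (\<lambda>\<omega>. (\<omega> 0 i - \<omega> 1 i)\<^sup>2)" unfolding eq using f g cr by auto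
  have "(\<integral>\<omega>. (\<omega> 0 i - \<omega> 1 i)\<^sup>2 \<partial>S) = \<sigma>2 i - 2 * 0 + \<sigma>2 i"
    unfolding eq using f g cr by (simp del: integral_mult_right_zero)
  then show "(\<integral>\<omega>. (\<omega> 0 i - \<omega> 1 i)\<^sup>2 \<partial>S) = 2 * \<sigma>2 i" by simp
qed

lemma zvar_le_1:
  assumes i: "i < d" and \<tau>: "\<tau> \<le> 1"
  shows "AE \<omega> in S. zvar i \<omega> \<le> 1"
proof -
  have "AE \<omega> in S. \<bar>\<omega> t i\<bar> \<le> 1" for t
    using coord_bounded[OF i] by (intro AE_PiM_component) (auto intro: M.prob_space_axioms)
  from this[of 0] this[of 1] show ?thesis
  proof eventually_elim
    fix \<omega> :: "nat \<Rightarrow> nat \<Rightarrow> real" assume "\<bar>\<omega> 0 i\<bar> \<le> 1" "\<bar>\<omega> 1 i\<bar> \<le> 1"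
    then have "\<bar>\<omega> 0 i - \<omega> 1 i\<bar> \<le> \<bar>2\<bar>" by linarith
    then have "(\<omega> 0 i - \<omega> 1 i)\<^sup>2 \<le> 2\<^sup>2" by (rule abs_le_square_iff[THEN iffD1])
    then show "zvar i \<omega> \<le> 1" using \<tau> by (simp add: zvar_def var_sample_def)
  qed
qed

lemma zvar_integrable: "i < d \<Longrightarrow> \<tau> \<le> 1 \<Longrightarrow> integrable S (zvar i)"
  using zvar_le_1[of i] zvar_nonneg
  by (intro P.integrable_const_bound[where B = 1]) (auto intro: zvar_measurable)

text \<open>Without truncation the mean is half the variance. A maximum of two nonnegative numbers
  lies between their average and their sum, whence the bounds by \<open>w i / 4\<close> and
  \<open>w i / 2\<close>.\<close>

lemma \<mu>_bounds:
  assumes i: "i < d" and \<tau>: "\<tau> \<le> 1"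
  shows "w i / 4 \<le> \<mu> i" "\<mu> i \<le> w i / 2" "\<mu> i \<le> 1" "\<tau> / 2 \<le> \<mu> i" "0 < \<mu> i"
proof -
  note int = zvar_integrable[OF i \<tau>] and sq = sq_diff_integral[OF i]
  have z: "zvar i \<omega> = max ((\<omega> 0 i - \<omega> 1 i)\<^sup>2 / 4) (\<tau> / 2)" for \<omega> by (simp add: zvar_def var_sample_def)
  have "(\<integral>\<omega>. (\<omega> 0 i - \<omega> 1 i)\<^sup>2 / 4 \<partial>S) \<le> \<mu> i"
    unfolding \<mu>_def using sq int by (intro integral_mono) (auto simp: z)
  then have a: "\<sigma>2 i / 2 \<le> \<mu> i" using sq by simp
  have "(\<integral>\<omega>. \<tau> / 2 \<partial>S) \<le> \<mu> i"
    unfolding \<mu>_def using int by (intro integral_mono) (auto simp: z)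
  then show b: "\<tau> / 2 \<le> \<mu> i" by (simp add: P.prob_space)
  then show "0 < \<mu> i" using tau_pos by linarith
  show "w i / 4 \<le> \<mu> i" using a b by (simp add: w_def)
  have "\<mu> i \<le> (\<integral>\<omega>. (\<omega> 0 i - \<omega> 1 i)\<^sup>2 / 4 + \<tau> / 2 \<partial>S)"
    unfolding \<mu>_def using sq int tau_pos by (intro integral_mono) (auto simp: z)
  also have "\<dots> = w i / 2" using sq by (simp add: P.prob_space w_def)
  finally show "\<mu> i \<le> w i / 2" .
  have "\<mu> i \<le> (\<integral>\<omega>. 1 \<partial>S)"
    unfolding \<mu>_def using int zvar_le_1[OF i \<tau>] by (intro integral_mono_AE) auto
  then show "\<mu> i \<le> 1" by (simp add: P.prob_space)
qed

text \<open>Taking both exponential moments at 1 is enough, since only the order of magnitude of the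
  variance estimate matters.\<close>

lemma vsum_upper_tail:
  assumes i: "i < d" and \<tau>: "\<tau> \<le> 1" and n: "real n * \<mu> i \<le> Y1 / 4"
  shows "measure S {\<omega> \<in> space S. Y1 \<le> vsum i n \<omega>} \<le> exp (- Y1 / 2)"
proof -
  note [measurable] = zvar_measurable[OF i] vsum_measurable[OF i]
  define g where "g = (\<lambda>\<omega>. ennreal (exp (zvar i \<omega>)))"
  have [measurable]: "g \<in> borel_measurable S" unfolding g_def by measurable
  have dep: "depends_below 2 g" unfolding g_def by (rule depends_below_zvar)
  have "(\<integral>\<^sup>+\<omega>. g \<omega> \<partial>S) \<le> (\<integral>\<^sup>+\<omega>. ennreal (1 + 2 * zvar i \<omega>) \<partial>S)"
  proof (rule nn_integral_mono_AE)
    show "AE \<omega> in S. g \<omega> \<le> ennreal (1 + 2 * zvar i \<omega>)"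
      using zvar_le_1[OF i \<tau>]
      by eventually_elim (unfold g_def, intro ennreal_leI exp_le_1_plus_2x zvar_nonneg)
  qed
  also have "\<dots> = ennreal (\<integral>\<omega>. 1 + 2 * zvar i \<omega> \<partial>S)"
    using zvar_integrable[OF i \<tau>] zvar_nonneg by (intro nn_integral_eq_integral) auto
  also have "(\<integral>\<omega>. 1 + 2 * zvar i \<omega> \<partial>S) = 1 + 2 * \<mu> i"
    using zvar_integrable[OF i \<tau>] by (simp add: P.prob_space \<mu>_def)
  also have "ennreal (1 + 2 * \<mu> i) \<le> ennreal (exp (2 * \<mu> i))"
    by (intro ennreal_leI) (rule exp_ge_add_one_self)
  finally have g: "(\<integral>\<^sup>+\<omega>. g \<omega> \<partial>S) \<le> ennreal (exp (2 * \<mu> i))" .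
  have prod: "(\<Prod>m<n. g (shift_seq (m * 2) \<omega>)) = ennreal (exp (vsum i n \<omega>))" for \<omega>
    unfolding g_def vsum_zvar by (simp add: prod_ennreal exp_sum)
  have "ennreal (exp Y1) * emeasure S {\<omega> \<in> space S. Y1 \<le> vsum i n \<omega>}
      = (\<integral>\<^sup>+\<omega>. ennreal (exp Y1) * indicator {\<omega> \<in> space S. Y1 \<le> vsum i n \<omega>} \<omega> \<partial>S)"
    by (simp add: nn_integral_cmult)
  also have "\<dots> \<le> (\<integral>\<^sup>+\<omega>. (\<Prod>m<n. g (shift_seq (m * 2) \<omega>)) \<partial>S)"
    unfolding prod by (intro nn_integral_mono) (auto simp: indicator_def intro!: ennreal_leI)
  also have "\<dots> = (\<integral>\<^sup>+\<omega>. g \<omega> \<partial>S) ^ n" by (rule nn_integral_prod_shift_seq[OF _ dep]) simp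
  also have "\<dots> \<le> ennreal (exp (2 * \<mu> i)) ^ n" using g by (intro power_mono) auto
  also have "\<dots> = ennreal (exp (2 * (real n * \<mu> i)))"
    by (simp add: ennreal_power exp_of_nat_mult[symmetric] mult.left_commute)
  also have "\<dots> \<le> ennreal (exp (Y1 / 2))" using n by (intro ennreal_leI) simp
  finally have "ennreal (exp Y1 * measure S {\<omega> \<in> space S. Y1 \<le> vsum i n \<omega>}) \<le> ennreal (exp (Y1 / 2))"
    by (simp add: P.emeasure_eq_measure ennreal_mult')
  then have "exp Y1 * measure S {\<omega> \<in> space S. Y1 \<le> vsum i n \<omega>} \<le> exp (Y1 / 2)"
    by (subst (asm) ennreal_le_iff) auto
  then have "measure S {\<omega> \<in> space S. Y1 \<le> vsum i n \<omega>} \<le> exp (Y1 / 2) / exp Y1"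
    by (simp add: field_simps)
  also have "\<dots> = exp (Y1 / 2 - Y1)" by (rule exp_diff[symmetric])
  also have "Y1 / 2 - Y1 = - Y1 / 2" by simp
  finally show ?thesis .
qed

text \<open>One sample contributes at most \<open>exp (- \<mu> i / 2)\<close>, so \<open>n\<close>
  of them contribute \<open>exp (- 2 * Y1)\<close>; dividing by the weight \<open>exp (- Y1)\<close>
  of the event leaves more than the required decay.\<close>

lemma vsum_lower_tail:
  assumes i: "i < d" and \<tau>: "\<tau> \<le> 1" and n: "4 * Y1 \<le> real n * \<mu> i"
  shows "measure S {\<omega> \<in> space S. vsum i n \<omega> < Y1} \<le> exp (- Y1 / 2)"
proof -
  note [measurable] = zvar_measurable[OF i] vsum_measurable[OF i]
  define g where "g = (\<lambda>\<omega>. ennreal (exp (- zvar i \<omega>)))"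
  have [measurable]: "g \<in> borel_measurable S" unfolding g_def by measurable
  have dep: "depends_below 2 g" unfolding g_def by (rule depends_below_zvar)
  have "(\<integral>\<^sup>+\<omega>. g \<omega> \<partial>S) \<le> (\<integral>\<^sup>+\<omega>. ennreal (1 - zvar i \<omega> / 2) \<partial>S)"
  proof (rule nn_integral_mono_AE)
    show "AE \<omega> in S. g \<omega> \<le> ennreal (1 - zvar i \<omega> / 2)"
      using zvar_le_1[OF i \<tau>]
      by eventually_elim (unfold g_def, intro ennreal_leI exp_minus_le_1_minus_half zvar_nonneg)
  qed
  also have "\<dots> = ennreal (\<integral>\<omega>. 1 - zvar i \<omega> / 2 \<partial>S)"
  proof (rule nn_integral_eq_integral)
    show "integrable S (\<lambda>\<omega>. 1 - zvar i \<omega> / 2)" using zvar_integrable[OF i \<tau>] by auto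
    show "AE \<omega> in S. 0 \<le> 1 - zvar i \<omega> / 2"
      using zvar_le_1[OF i \<tau>] by eventually_elim simp
  qed
  also have "(\<integral>\<omega>. 1 - zvar i \<omega> / 2 \<partial>S) = 1 + - \<mu> i / 2"
    using zvar_integrable[OF i \<tau>] by (simp add: P.prob_space \<mu>_def)
  also have "ennreal (1 + - \<mu> i / 2) \<le> ennreal (exp (- \<mu> i / 2))"
    by (intro ennreal_leI) (rule exp_ge_add_one_self)
  finally have g: "(\<integral>\<^sup>+\<omega>. g \<omega> \<partial>S) \<le> ennreal (exp (- \<mu> i / 2))" .
  have prod: "(\<Prod>m<n. g (shift_seq (m * 2) \<omega>)) = ennreal (exp (- vsum i n \<omega>))" for \<omega>
    unfolding g_def vsum_zvar by (simp add: prod_ennreal exp_sum sum_negf[symmetric])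
  have "ennreal (exp (- Y1)) * emeasure S {\<omega> \<in> space S. vsum i n \<omega> < Y1}
      = (\<integral>\<^sup>+\<omega>. ennreal (exp (- Y1)) * indicator {\<omega> \<in> space S. vsum i n \<omega> < Y1} \<omega> \<partial>S)"
    by (simp add: nn_integral_cmult)
  also have "\<dots> \<le> (\<integral>\<^sup>+\<omega>. (\<Prod>m<n. g (shift_seq (m * 2) \<omega>)) \<partial>S)"
    unfolding prod by (intro nn_integral_mono) (auto simp: indicator_def intro!: ennreal_leI)
  also have "\<dots> = (\<integral>\<^sup>+\<omega>. g \<omega> \<partial>S) ^ n" by (rule nn_integral_prod_shift_seq[OF _ dep]) simp
  also have "\<dots> \<le> ennreal (exp (- \<mu> i / 2)) ^ n" using g by (intro power_mono) auto
  also have "\<dots> = ennreal (exp (- (real n * \<mu> i) / 2))"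
    by (simp add: ennreal_power exp_of_nat_mult[symmetric] mult.left_commute)
  also have "\<dots> \<le> ennreal (exp (- (2 * Y1)))" using n by (intro ennreal_leI) simp
  finally have "ennreal (exp (- Y1) * measure S {\<omega> \<in> space S. vsum i n \<omega> < Y1}) \<le> ennreal (exp (- (2 * Y1)))"
    by (simp add: P.emeasure_eq_measure ennreal_mult')
  then have "exp (- Y1) * measure S {\<omega> \<in> space S. vsum i n \<omega> < Y1} \<le> exp (- (2 * Y1))"
    by (subst (asm) ennreal_le_iff) auto
  then have "measure S {\<omega> \<in> space S. vsum i n \<omega> < Y1} \<le> exp (- (2 * Y1)) / exp (- Y1)"
    by (simp add: pos_le_divide_eq mult.commute)
  also have "\<dots> = exp (- (2 * Y1) - - Y1)" by (rule exp_diff[symmetric])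
  also have "\<dots> \<le> exp (- Y1 / 2)" using Y1_bounds(1) by simp
  finally show ?thesis .
qed

text \<open>Sample counts whose expected sums are about \<open>Y1 / 4\<close> and
  \<open>4 * Y1\<close>, a constant factor away from the level \<open>Y1\<close> on either
  side.\<close>

definition n_lo :: "nat \<Rightarrow> nat" where "n_lo i = nat \<lfloor>Y1 / (4 * \<mu> i)\<rfloor>"
definition n_hi :: "nat \<Rightarrow> nat" where "n_hi i = nat \<lceil>4 * Y1 / \<mu> i\<rceil>"

definition bad_var :: "nat \<Rightarrow> (nat \<Rightarrow> nat \<Rightarrow> real) set" where
  "bad_var i = {\<omega> \<in> space S. Y1 \<le> vsum i (n_lo i) \<omega>} \<union> {\<omega> \<in> space S. vsum i (n_hi i) \<omega> < Y1}"

lemma bad_var_prob: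
  assumes i: "i < d" and \<tau>: "\<tau> \<le> 1"
  shows "bad_var i \<in> sets S" "measure S (bad_var i) \<le> \<delta> / real d"
proof -
  note [measurable] = vsum_measurable[OF i]
  note mu = \<mu>_bounds[OF i \<tau>]
  show "bad_var i \<in> sets S" unfolding bad_var_def by measurable
  have lo: "real (n_lo i) * \<mu> i \<le> Y1 / 4"
  proof -
    have "real (n_lo i) \<le> Y1 / (4 * \<mu> i)"
      unfolding n_lo_def using mu Y1_bounds(1) by (intro of_nat_floor) auto
    then show ?thesis using mu by (simp add: field_simps)
  qed
  have hi: "4 * Y1 \<le> real (n_hi i) * \<mu> i"
  proof -
    have "4 * Y1 / \<mu> i \<le> real (n_hi i)" unfolding n_hi_def by (rule real_nat_ceiling_ge)
    then show ?thesis using mu by (simp add: field_simps)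
  qed
  have "measure S (bad_var i) \<le> measure S {\<omega> \<in> space S. Y1 \<le> vsum i (n_lo i) \<omega>}
     + measure S {\<omega> \<in> space S. vsum i (n_hi i) \<omega> < Y1}"
    unfolding bad_var_def by (rule measure_Un_le) measurable
  also have "\<dots> \<le> 2 * exp (- Y1 / 2)"
    using vsum_upper_tail[OF i \<tau> lo] vsum_lower_tail[OF i \<tau> hi] by simp
  also have "exp (- Y1 / 2) \<le> exp (- (ln 2 + Ld))" using Y1_bounds(2) by simp
  also have "2 * exp (- (ln 2 + Ld)) = \<delta> / real d"
    using d \<delta> by (simp add: Ld_def exp_minus exp_add ln_div field_simps exp_diff)
  finally show "measure S (bad_var i) \<le> \<delta> / real d" by simp
qed

lemma vest_bounds:
  assumes i: "i < d" and \<tau>: "\<tau> \<le> 1" and sp: "\<omega> \<in> space S"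
    and good: "shift_seq (vstart i \<omega>) \<omega> \<notin> bad_var i"
  shows "w i / 20 \<le> vest d \<omega> i" "vest d \<omega> i \<le> 2 * w i" "real (nvar i \<omega>) \<le> 10 * Y1 / \<tau>"
proof -
  note mu = \<mu>_bounds[OF i \<tau>]
  have "shift_seq (vstart i \<omega>) \<omega> \<in> space S" using sp by (rule measurable_space[OF measurable_shift_seq])
  then have "vsum i (n_lo i) (shift_seq (vstart i \<omega>) \<omega>) < Y1" "Y1 \<le> vsum i (n_hi i) (shift_seq (vstart i \<omega>) \<omega>)"
    using good by (auto simp: bad_var_def)
  then have lo: "n_lo i < nvar i \<omega>" and hi: "nvar i \<omega> \<le> n_hi i"
    unfolding nvar_def less_nstop nstop_le_iff by auto
  have np: "0 < real (nvar i \<omega>)" using nvar_pos by simp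
  have ve: "vest d \<omega> i = Y1 / real (nvar i \<omega>)" using i by (simp add: vest_def)
  have "Y1 / (4 * \<mu> i) \<le> real (nvar i \<omega>)"
  proof -
    \<comment> \<open>The loss from rounding down is recovered because the stopping time exceeds
      \<open>n_lo i\<close> strictly.\<close>
    have "Y1 / (4 * \<mu> i) \<le> real (n_lo i) + 1" unfolding n_lo_def by linarith
    also have "\<dots> \<le> real (nvar i \<omega>)" using lo by simp
    finally show ?thesis .
  qed
  then have "Y1 / real (nvar i \<omega>) \<le> 4 * \<mu> i" using mu np by (simp add: field_simps)
  then show "vest d \<omega> i \<le> 2 * w i" using mu ve by simp
  have up: "real (nvar i \<omega>) \<le> 5 * Y1 / \<mu> i"
  proof -
    have "real (nvar i \<omega>) \<le> real (n_hi i)" using hi by simp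
    also have "\<dots> \<le> 4 * Y1 / \<mu> i + 1"
      unfolding n_hi_def using mu Y1_bounds(1) divide_nonneg_pos[of "4 * Y1" "\<mu> i"] by linarith
    \<comment> \<open>The rounding term 1 is at most \<open>Y1 / \<mu> i\<close>, as
      \<open>\<mu> i \<le> 1 \<le> Y1\<close>.\<close>
    also have "\<dots> \<le> 5 * Y1 / \<mu> i" using mu Y1_bounds(1) by (simp add: field_simps)
    finally show ?thesis .
  qed
  have "w i / 20 \<le> \<mu> i / 5" using mu by simp
  also have "\<dots> \<le> Y1 / real (nvar i \<omega>)" using up np mu by (simp add: field_simps)
  finally show "w i / 20 \<le> vest d \<omega> i" using ve by simp
  have "5 * Y1 / \<mu> i \<le> 5 * Y1 / (\<tau> / 2)"
    using mu Y1_bounds(1) tau_pos by (intro divide_left_mono) auto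
  with up show "real (nvar i \<omega>) \<le> 10 * Y1 / \<tau>" by simp
qed

section \<open>Probability of the good event\<close>

text \<open>Phases are controlled up to \<open>ln T\<close> only; by \<open>phase_count\<close> no
  later phase ends within the horizon.\<close>

definition good :: "(nat \<Rightarrow> nat \<Rightarrow> real) set" where
  "good = {\<omega> \<in> space S. (\<forall>i<d. shift_seq (vstart i \<omega>) \<omega> \<notin> bad_var i) \<and>
     (\<forall>j\<in>{1..nat \<lfloor>ln (real T)\<rfloor>}. \<forall>i<d. shift_seq (pstart j \<omega>) \<omega> \<notin> bad_phase i (plen j \<omega>))}"

lemma kappa_ge: "8 * ln (real d * ln (real T) / \<delta>) \<le> real \<kappa>"
  unfolding valee_kappa_def by (rule real_nat_ceiling_ge)

text \<open>Since \<open>2/3 \<le> exp (- 1/8)\<close>, the factor 8 in \<open>\<kappa>\<close>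
  cancels; what remains is the share of one coordinate in one of \<open>ln T\<close> phases.\<close>

lemma power_kappa_le:
  assumes T3: "3 \<le> T"
  shows "(2/3::real) ^ \<kappa> \<le> \<delta> / (real d * ln (real T))"
proof -
  have lnT: "0 < ln (real T)" using T3 by simp
  have pos: "0 < real d * ln (real T) / \<delta>" using lnT d \<delta> by simp
  have "2/3 \<le> exp (- (1/8) :: real)"
    using exp_ge_add_one_self[of "- (1/8) :: real"] by simp
  then have "(2/3::real) ^ \<kappa> \<le> exp (- (1/8)) ^ \<kappa>" by (intro power_mono) auto
  also have "\<dots> = exp (- (real \<kappa> / 8))" by (simp flip: exp_of_nat_mult)
  also have "\<dots> \<le> exp (- ln (real d * ln (real T) / \<delta>))" using kappa_ge by simp
  also have "\<dots> = \<delta> / (real d * ln (real T))" using pos by (simp add: exp_minus)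
  finally show ?thesis .
qed

lemma plen_pos:
  assumes "0 < alpha \<omega>"
  shows "0 < plen j \<omega>"
proof -
  have "0 < 8 / (alpha \<omega> * sqrt (N_hat j))\<^sup>2" using assms by (simp add: N_hat_def)
  then show ?thesis unfolding plen_def phase_len_def by simp
qed

lemma sighat_pos: "0 < sighat \<omega>"
proof -
  have "0 < (\<Sum>i<d. vest d \<omega> i powr (q / 2))"
    using d nvar_pos Y1_bounds(1) by (intro sum_pos) (auto simp: vest_def lessThan_empty_iff)
  then show ?thesis by (simp add: sighat_def sigma_q_hat_def)
qed

lemma kappa_pos: "3 \<le> T \<Longrightarrow> 0 < \<kappa>"
proof -
  assume T3: "3 \<le> T"
  have "1 * (1::real) \<le> real d * ln (real T)" using d lnT_ge_1[OF T3] by (intro mult_mono) auto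
  then have "1 < real d * ln (real T) / \<delta>" using \<delta> by (simp add: field_simps)
  then have "0 < 8 * ln (real d * ln (real T) / \<delta>)" by simp
  with kappa_ge have "0 < real \<kappa>" by linarith
  then show ?thesis by simp
qed

lemma alpha_pos: "3 \<le> T \<Longrightarrow> 0 < alpha \<omega>"
  using sighat_pos[of \<omega>] kappa_pos d T q2 by (simp add: alpha_def valee_alpha_def)

lemma good_prob:
  assumes \<tau>: "\<tau> \<le> 1" and T3: "3 \<le> T"
  shows "good \<in> sets S" "1 - 2 * \<delta> \<le> measure S good"
proof -
  define J where "J = nat \<lfloor>ln (real T)\<rfloor>"
  define V where "V = (\<lambda>i. {\<omega> \<in> space S. shift_seq (vstart i \<omega>) \<omega> \<in> bad_var i})"
  define B where "B = (\<lambda>(j, i). {\<omega> \<in> space S. shift_seq (pstart j \<omega>) \<omega> \<in> bad_phase i (plen j \<omega>)})"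
  have lnT: "0 < ln (real T)" using T3 by simp
  let ?\<rho> = "\<delta> / (real d * ln (real T))"
  have V: "V i \<in> sets S" "measure S (V i) \<le> \<delta> / real d" if i: "i < d" for i
  proof -
    have m: "vstart i \<in> measurable S (count_space UNIV)" using i by (intro vstart_measurable) simp
    have m0: "(\<lambda>_. 0 :: nat) \<in> measurable S (count_space UNIV)" by simp
    have cong: "vstart i \<omega>' = vstart i \<omega> \<and> (0::nat) = 0" if "\<And>t. t < vstart i \<omega> \<Longrightarrow> \<omega>' t = \<omega> t" for \<omega> \<omega>'
      using vstart_nvar_cong[OF that] by simp
    show "V i \<in> sets S" "measure S (V i) \<le> \<delta> / real d"
      using strong_markov_le[OF m m0 cong bad_var_prob[OF i \<tau>]] unfolding V_def by blast+
  qed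
  have B: "B (j, i) \<in> sets S" "measure S (B (j, i)) \<le> ?\<rho>" if i: "i < d" for i j
  proof -
    \<comment> \<open>The tail bound asks for a positive block length. On every outcome
      \<open>plen\<close> is positive, so emptying the set at 0 does not change the event.\<close>
    define C where "C = (\<lambda>n. if n = 0 then {} else bad_phase i n)"
    have C: "C n \<in> sets S" "measure S (C n) \<le> ?\<rho>" for n
      using bad_phase_prob[OF i, of n] power_kappa_le[OF T3] \<delta> d lnT by (auto simp: C_def)
    have "B (j, i) = {\<omega> \<in> space S. shift_seq (pstart j \<omega>) \<omega> \<in> C (plen j \<omega>)}"
      using plen_pos[OF alpha_pos[OF T3]] by (auto simp: B_def C_def dest: gr_implies_not0)
    then show "B (j, i) \<in> sets S" "measure S (B (j, i)) \<le> ?\<rho>"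
      using strong_markov_le[OF pstart_measurable plen_measurable pstart_plen_cong C] by auto
  qed
  let ?I = "{1..J} \<times> {..<d}"
  have eq: "good = space S - ((\<Union>i<d. V i) \<union> (\<Union>z\<in>?I. B z))"
    unfolding good_def V_def B_def J_def by auto
  have UV: "(\<Union>i<d. V i) \<in> sets S" using V by (intro sets.finite_UN) auto
  have UB: "(\<Union>z\<in>?I. B z) \<in> sets S" using B by (intro sets.finite_UN) auto
  show "good \<in> sets S" unfolding eq using UV UB by auto
  have "measure S (\<Union>i<d. V i) \<le> (\<Sum>i<d. measure S (V i))"
    using V by (intro measure_UNION_le) auto
  also have "\<dots> \<le> (\<Sum>i<d. \<delta> / real d)" using V by (intro sum_mono) auto
  also have "\<dots> = \<delta>" using d by simp
  finally have mV: "measure S (\<Union>i<d. V i) \<le> \<delta>" .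
  have "measure S (\<Union>z\<in>?I. B z) \<le> (\<Sum>z\<in>?I. measure S (B z))"
    using B by (intro measure_UNION_le) auto
  also have "\<dots> \<le> (\<Sum>z\<in>?I. ?\<rho>)" using B by (intro sum_mono) auto
  also have "\<dots> = real J * real d * ?\<rho>" by simp
  also have "\<dots> \<le> ln (real T) * real d * ?\<rho>"
    unfolding J_def using lnT \<delta> d by (intro mult_right_mono of_nat_floor) auto
  also have "\<dots> = \<delta>" using lnT d by simp
  finally have mB: "measure S (\<Union>z\<in>?I. B z) \<le> \<delta>" .
  have "measure S ((\<Union>i<d. V i) \<union> (\<Union>z\<in>?I. B z)) \<le> \<delta> + \<delta>"
    using measure_Un_le[OF UV UB] mV mB by linarith
  then show "1 - 2 * \<delta> \<le> measure S good"
    unfolding eq using UV UB by (subst P.prob_compl) auto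
qed

end

subsection \<open>Regret on the good event\<close>

text \<open>Concave powers are subadditive: each share of the total lies in the unit interval, hence
  is at most its own \<open>s\<close>-th power.\<close>

lemma powr_add_le_add_powr:
  fixes a b s :: real
  assumes "0 \<le> a" "0 \<le> b" "0 < s" "s \<le> 1"
  shows "(a + b) powr s \<le> a powr s + b powr s"
proof (cases "a + b = 0")
  case False
  then have ab: "0 < a + b" using assms by linarith
  have le: "x \<le> x powr s" if "0 \<le> x" "x \<le> 1" for x :: real
  proof (cases "x = 0")
    case False
    then show ?thesis using powr_mono'[of s 1 x] that assms by simp
  qed simp
  have "1 = a / (a + b) + b / (a + b)" using ab by (simp flip: add_divide_distrib)
  also have "\<dots> \<le> (a / (a + b)) powr s + (b / (a + b)) powr s"
    using assms ab by (intro add_mono le) auto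
  also have "\<dots> = (a powr s + b powr s) / (a + b) powr s"
    using assms by (simp add: powr_divide add_divide_distrib)
  finally show ?thesis using ab by (simp add: pos_le_divide_eq)
qed (use assms in auto)

lemma sigma_q_hat_mono:
  assumes "0 < q" "\<And>i. i < d \<Longrightarrow> 0 \<le> u i" "\<And>i. i < d \<Longrightarrow> u i \<le> v i"
  shows "sigma_q_hat d q u \<le> sigma_q_hat d q v"
  unfolding sigma_q_hat_def using assms by (intro powr_mono2 sum_mono sum_nonneg) auto

lemma sigma_q_hat_scale:
  assumes "0 < q" "0 \<le> c" "\<And>i. i < d \<Longrightarrow> 0 \<le> u i"
  shows "sigma_q_hat d q (\<lambda>i. c * u i) = c * sigma_q_hat d q u"
proof -
  have "(\<Sum>i<d. (c * u i) powr (q / 2)) = c powr (q / 2) * (\<Sum>i<d. u i powr (q / 2))"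
    unfolding sum_distrib_left using assms by (intro sum.cong) (auto simp: powr_mult)
  then show ?thesis using assms unfolding sigma_q_hat_def
    by (simp add: powr_mult powr_powr sum_nonneg)
qed

lemma sigma_q_hat_const:
  assumes "0 < q" "0 \<le> c"
  shows "sigma_q_hat d q (\<lambda>_. c) = real d powr (2 / q) * c"
  using assms unfolding sigma_q_hat_def by (simp add: powr_mult powr_powr)

text \<open>A triangle inequality up to the factor 2: a sum is at most twice the maximum, and the
  outer exponent \<open>2 / q \<le> 1\<close> is subadditive.\<close>

lemma sigma_q_hat_add_le:
  assumes q: "2 \<le> q" and u: "\<And>i. i < d \<Longrightarrow> 0 \<le> u i" and v: "\<And>i. i < d \<Longrightarrow> 0 \<le> v i"
  shows "sigma_q_hat d q (\<lambda>i. u i + v i) \<le> 2 * (sigma_q_hat d q u + sigma_q_hat d q v)"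
proof -
  let ?U = "\<Sum>i<d. u i powr (q / 2)" and ?V = "\<Sum>i<d. v i powr (q / 2)"
  have U: "0 \<le> ?U" and V: "0 \<le> ?V" by (auto intro: sum_nonneg)
  have "(\<Sum>i<d. (u i + v i) powr (q / 2)) \<le> (\<Sum>i<d. 2 powr (q / 2) * (u i powr (q / 2) + v i powr (q / 2)))"
  proof (rule sum_mono)
    fix i assume "i \<in> {..<d}"
    then have uv: "0 \<le> u i" "0 \<le> v i" using u v by auto
    have "(u i + v i) powr (q / 2) \<le> (2 * max (u i) (v i)) powr (q / 2)"
      using uv q by (intro powr_mono2) auto
    also have "\<dots> = 2 powr (q / 2) * max (u i) (v i) powr (q / 2)"
      using uv by (simp add: powr_mult)
    also have "max (u i) (v i) powr (q / 2) \<le> u i powr (q / 2) + v i powr (q / 2)"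
      by (auto simp: max_def)
    finally show "(u i + v i) powr (q / 2) \<le> 2 powr (q / 2) * (u i powr (q / 2) + v i powr (q / 2))"
      by simp
  qed
  also have "\<dots> = 2 powr (q / 2) * (?U + ?V)" by (simp add: sum_distrib_left sum.distrib distrib_left)
  finally have "sigma_q_hat d q (\<lambda>i. u i + v i) \<le> (2 powr (q / 2) * (?U + ?V)) powr (2 / q)"
    unfolding sigma_q_hat_def using q by (intro powr_mono2) (auto intro: sum_nonneg)
  also have "\<dots> = 2 * (?U + ?V) powr (2 / q)" using q U V by (simp add: powr_mult powr_powr)
  also have "(?U + ?V) powr (2 / q) \<le> ?U powr (2 / q) + ?V powr (2 / q)"
    using U V q by (intro powr_add_le_add_powr) auto
  finally show ?thesis by (simp add: sigma_q_hat_def)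
qed

section \<open>Size of the threshold and the logarithmic factors\<close>

context valee_params
begin

text \<open>\<open>G\<close> is the first term of the regret bound with \<open>ln (d / \<delta>)\<close> in place of \<open>ln (1 / \<delta>)\<close>.\<close>

definition G :: real where "G = real d * Ld / \<tau>"

lemma tau_cube: "\<tau> ^ 3 * (real T * q * real d powr (2 / q)) = real d * Ld"
proof -
  have p3: "(x powr a) ^ 3 = x powr (3 * a)" if "0 < x" for x a :: real
    using that by (simp add: powr_power mult.commute)
  have Tq: "0 < real T * q" using T q2 by simp
  have "\<tau> ^ 3 = real d powr (1 - 2 / q) * Ld / (real T * q)"
    unfolding valee_tau_def Ld_def[symmetric] power_divide power_mult_distrib
    using d Ld_pos Tq q2 by (simp add: p3 right_diff_distrib)
  then have "\<tau> ^ 3 * (real T * q * real d powr (2 / q)) = real d powr (1 - 2 / q) * real d powr (2 / q) * Ld"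
    using T q2 by simp
  also have "real d powr (1 - 2 / q) * real d powr (2 / q) = real d"
    using d by (simp flip: powr_add)
  finally show ?thesis .
qed

lemma G_pos: "0 < G" using d Ld_pos tau_pos by (simp add: G_def)

lemma dLd: "real d * Ld = \<tau> * G" using tau_pos by (simp add: G_def)

lemma G_alt: "G = real T * q * real d powr (2 / q) * \<tau>\<^sup>2"
proof -
  have "\<tau> * (real T * q * real d powr (2 / q) * \<tau>\<^sup>2) = \<tau> ^ 3 * (real T * q * real d powr (2 / q))"
    by (simp add: power2_eq_square power3_eq_cube)
  also have "\<dots> = \<tau> * G" using tau_cube dLd by simp
  finally have "\<tau> * G = \<tau> * (real T * q * real d powr (2 / q) * \<tau>\<^sup>2)" ..
  then show ?thesis using tau_pos by simp
qed

text \<open>With \<open>\<tau>\<close> in place of every variance, the square-root term of the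
  regret (with \<open>ln (d / \<delta>)\<close>) is exactly \<open>G\<close>.\<close>

lemma G_sq: "real d * Ld * (real T * q) * (\<tau> * real d powr (2 / q)) = G\<^sup>2"
proof -
  have "real d * Ld * (real T * q) * (\<tau> * real d powr (2 / q)) = G * (real T * q * real d powr (2 / q) * \<tau>\<^sup>2)"
    unfolding dLd by (simp add: power2_eq_square mult.assoc mult.left_commute)
  also have "\<dots> = G * G" by (simp only: G_alt[symmetric])
  finally show ?thesis by (simp only: power2_eq_square)
qed

lemma d_powr_ge_1: "1 \<le> real d powr (2 / q)"
  using d q2 by (intro ge_one_powr_ge_zero) auto

lemma Ld_ge': "2 / 3 \<le> Ld" using Ld_ge ln2_ge_two_thirds by linarith

text \<open>This lower bound, free of \<open>\<tau>\<close>, is what limits the number of phases: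
  \<open>\<tau>\<close> cancels between \<open>\<tau> * G = d * Ld\<close> and
  \<open>G / \<tau>\<^sup>2\<close>.\<close>

lemma G_cube_ge: "real T / 2 \<le> G ^ 3"
proof -
  have "G ^ 3 = (\<tau> * G)\<^sup>2 * (G / \<tau>\<^sup>2)"
    using tau_pos by (simp add: power2_eq_square power3_eq_cube)
  also have "G / \<tau>\<^sup>2 = real T * q * real d powr (2 / q)"
    unfolding G_alt using tau_pos by simp
  also have "(\<tau> * G)\<^sup>2 = (real d * Ld)\<^sup>2" by (simp add: dLd)
  finally have eq: "G ^ 3 = (real d * Ld)\<^sup>2 * (real T * q * real d powr (2 / q))" .
  have "2 / 3 \<le> real d * Ld" using Ld_ge' d mult_mono[of 1 "real d" "2/3" Ld] by simp
  then have "(2/3)\<^sup>2 \<le> (real d * Ld)\<^sup>2" by (intro power_mono) auto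
  then have a: "1/4 \<le> (real d * Ld)\<^sup>2" by (simp add: power2_eq_square)
  have "real T * 2 * 1 \<le> real T * q * real d powr (2 / q)"
    using q2 d_powr_ge_1 by (intro mult_mono) auto
  then have "1/4 * (real T * 2 * 1) \<le> G ^ 3" unfolding eq by (rule mult_mono[OF a]) auto
  then show ?thesis by simp
qed

text \<open>Outside the regime of the main argument the trivial regret bound is enough: a large
  \<open>\<tau>\<close> makes \<open>G\<close> exceed \<open>T\<close> by \<open>G_alt\<close>, and
  for \<open>T < 3\<close> a constant lower bound for \<open>G\<close> does.\<close>

lemma trivial_le_G:
  assumes "\<not> (\<tau> \<le> 1 \<and> 3 \<le> T)"
  shows "real T \<le> 3 * G"
proof (cases "\<tau> \<le> 1")
  case False
  have "real T * 1 * 1 * 1 \<le> real T * q * real d powr (2 / q) * \<tau>\<^sup>2"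
    using q2 d_powr_ge_1 False by (intro mult_mono) auto
  then show ?thesis using G_pos by (simp flip: G_alt)
next
  case True
  then have "T < 3" using assms by simp
  moreover have "2 / 3 \<le> G"
  proof -
    have "2 / 3 \<le> real d * Ld" using Ld_ge' d mult_mono[of 1 "real d" "2/3" Ld] by simp
    also have "\<dots> = \<tau> * G" by (rule dLd)
    also have "\<dots> \<le> 1 * G" using True G_pos by (intro mult_right_mono) auto
    finally show ?thesis by simp
  qed
  ultimately show ?thesis by simp
qed

text \<open>The logarithm hidden in the soft O; the summand \<open>exp 1\<close> keeps it at least
  1.\<close>

definition \<Lambda> :: real where "\<Lambda> = ln (exp 1 + real d * real T * q)"
definition B1 :: real where
  "B1 = real d powr (2/3 + 2 / (3 * q)) * ln (1 / \<delta>) powr (2/3) * (real T * q) powr (1/3)"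

lemma ln_le_\<Lambda>: "0 < x \<Longrightarrow> x \<le> exp 1 + real d * real T * q \<Longrightarrow> ln x \<le> \<Lambda>"
  unfolding \<Lambda>_def by simp

lemma \<Lambda>_ge: "1 \<le> \<Lambda>" "ln (real d) \<le> \<Lambda>" "ln (real T) \<le> \<Lambda>"
proof -
  have dT: "real d * 1 * 1 \<le> real d * real T * q" "1 * real T * 1 \<le> real d * real T * q"
    using d T q2 by (intro mult_mono; simp)+
  have nn: "0 \<le> real d * real T * q" using q2 by simp
  then show "1 \<le> \<Lambda>" using ln_le_\<Lambda>[of "exp 1"] by simp
  show "ln (real d) \<le> \<Lambda>" "ln (real T) \<le> \<Lambda>"
    using dT d T by (auto intro!: ln_le_\<Lambda> intro: add_increasing)
qed

lemma ln_inv_\<delta>: "2/3 \<le> ln (1 / \<delta>)"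
proof -
  have "ln 2 \<le> ln (1 / \<delta>)" using \<delta> by (simp add: field_simps)
  then show ?thesis using ln2_ge_two_thirds by linarith
qed

text \<open>Trades the algorithm's \<open>ln (d / \<delta>)\<close> for the claimed
  \<open>ln (1 / \<delta>)\<close>: since the latter is at least 2/3, the additive
  \<open>ln d\<close> can be made a factor.\<close>

lemma Ld_le: "Ld \<le> 3 * \<Lambda> * ln (1 / \<delta>)"
proof -
  let ?L = "ln (1 / \<delta>)"
  have "Ld = ln (real d) + ?L" unfolding Ld_def using d \<delta> by (simp add: ln_div)
  also have "\<dots> \<le> \<Lambda> + ?L" using \<Lambda>_ge by simp
  also have "\<dots> \<le> \<Lambda> * (3/2 * ?L) + \<Lambda> * ?L"
  proof (rule add_mono)
    show "\<Lambda> \<le> \<Lambda> * (3/2 * ?L)" using \<Lambda>_ge ln_inv_\<delta> by (simp add: mult_le_cancel_left1)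
    show "?L \<le> \<Lambda> * ?L" using \<Lambda>_ge ln_inv_\<delta> by (simp add: mult_le_cancel_right1)
  qed
  also have "\<dots> \<le> 3 * \<Lambda> * ?L"
  proof -
    have "0 \<le> \<Lambda> * ?L" using \<Lambda>_ge ln_inv_\<delta> by simp
    then show ?thesis by simp
  qed
  finally show ?thesis .
qed

lemma G_le: "G \<le> 3 * \<Lambda> * B1"
proof -
  let ?L = "ln (1 / \<delta>)" and ?a = "1/3 - 2 / (3 * q)"
  have "real d / real d powr a = real d powr (1 - a)" for a using d by (simp add: powr_diff)
  then have "real d / real d powr ?a = real d powr (1 - ?a)" .
  moreover have "1 - ?a = 2/3 + 2 / (3 * q)" by simp
  moreover have "Ld / Ld powr (1/3) = Ld powr (2/3)"
    using Ld_pos powr_diff[of Ld 1 "1/3"] by simp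
  moreover have "G = (real d / real d powr ?a) * (Ld / Ld powr (1/3)) * (real T * q) powr (1/3)"
    unfolding G_def valee_tau_def Ld_def[symmetric] by simp
  ultimately have "G = real d powr (2/3 + 2 / (3 * q)) * Ld powr (2/3) * (real T * q) powr (1/3)"
    by simp
  also have "Ld powr (2/3) \<le> (3 * \<Lambda> * ?L) powr (2/3)"
    using Ld_pos Ld_le by (intro powr_mono2) auto
  also have "(3 * \<Lambda> * ?L) powr (2/3) = (3 * \<Lambda>) powr (2/3) * ?L powr (2/3)"
    using \<Lambda>_ge ln_inv_\<delta> by (simp add: powr_mult)
  also have "(3 * \<Lambda>) powr (2/3) \<le> (3 * \<Lambda>) powr 1" using \<Lambda>_ge by (intro powr_mono) auto
  finally show ?thesis using \<Lambda>_ge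
    by (simp add: B1_def mult_right_mono mult_left_mono mult.assoc mult.left_commute)
qed

lemma ln_kappa_arg: "3 \<le> T \<Longrightarrow> ln (real d * ln (real T) / \<delta>) = Ld + ln (ln (real T))"
proof -
  assume T3: "3 \<le> T"
  have "real d * ln (real T) / \<delta> = (real d / \<delta>) * ln (real T)" by simp
  then show ?thesis unfolding Ld_def using lnT_ge_1[OF T3] d \<delta> ln_mult_pos[of "real d / \<delta>" "ln (real T)"] by simp
qed

lemma kappa_bounds:
  assumes T3: "3 \<le> T"
  shows "8 * Ld \<le> real \<kappa>" "real \<kappa> \<le> 22 * \<Lambda> * Ld"
proof -
  note l = lnT_ge_1[OF T3]
  have ll: "0 \<le> ln (ln (real T))" using l by simp
  have "8 * (Ld + ln (ln (real T))) \<le> real \<kappa>"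
    unfolding valee_kappa_def ln_kappa_arg[OF T3] by (rule real_nat_ceiling_ge)
  then show "8 * Ld \<le> real \<kappa>" using ll by simp
  have "real \<kappa> \<le> 8 * (Ld + ln (ln (real T))) + 1"
    unfolding valee_kappa_def ln_kappa_arg[OF T3]
    using mult_nonneg_nonneg[of 8 "Ld + ln (ln (real T))"] ll Ld_pos by linarith
  also have "ln (ln (real T)) \<le> \<Lambda>"
  proof -
    have "ln (ln (real T)) \<le> ln (real T) - 1" using l by (intro ln_le_minus_one) simp
    then show ?thesis using \<Lambda>_ge(3) by simp
  qed
  also have "8 * (Ld + \<Lambda>) + 1 \<le> 8 * (Ld + \<Lambda>) + \<Lambda>" using \<Lambda>_ge by simp
  \<comment> \<open>The total factor is \<open>8 + 9 * 3/2 = 21.5\<close>, where 3/2 comes from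
    \<open>Ld \<ge> 2/3\<close>.\<close>
  also have "\<dots> \<le> 8 * (\<Lambda> * Ld) + 9 * (\<Lambda> * (3/2 * Ld))"
  proof -
    have "\<Lambda> \<le> \<Lambda> * (3/2 * Ld)" using \<Lambda>_ge Ld_ge' by (simp add: mult_le_cancel_left1)
    moreover have "Ld \<le> \<Lambda> * Ld" using \<Lambda>_ge Ld_ge' by (simp add: mult_le_cancel_right1)
    ultimately show ?thesis unfolding distrib_left by linarith
  qed
  also have "\<dots> \<le> 22 * \<Lambda> * Ld"
  proof -
    have "0 \<le> \<Lambda> * Ld" using \<Lambda>_ge Ld_ge' by simp
    then show ?thesis by (simp add: mult.commute)
  qed
  finally show "real \<kappa> \<le> 22 * \<Lambda> * Ld" by simp
qed

end

context valee_model
begin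

definition W :: real where "W = sigma_q_hat d q w"

lemma W_ge: "\<tau> * real d powr (2 / q) \<le> W"
proof -
  have "sigma_q_hat d q (\<lambda>_. \<tau>) \<le> W" unfolding W_def
    using q2 tau_pos Sigma_nonneg by (intro sigma_q_hat_mono) (auto simp: w_def)
  then show ?thesis using sigma_q_hat_const[of q \<tau> d] q2 tau_pos by (simp add: mult.commute)
qed

lemma W_pos: "0 < W"
  using W_ge tau_pos d_powr_ge_1 mult_pos_pos[of \<tau> "real d powr (2 / q)"] by linarith

lemma W_le: "W \<le> 2 * (sigma_q_sq d q \<nu> + \<tau> * real d powr (2 / q))"
proof -
  have "W = sigma_q_hat d q (\<lambda>i. \<sigma>2 i + \<tau>)" unfolding W_def w_def ..
  also have "\<dots> \<le> 2 * (sigma_q_hat d q \<sigma>2 + sigma_q_hat d q (\<lambda>_. \<tau>))"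
    using q2 Sigma_nonneg tau_pos by (intro sigma_q_hat_add_le) auto
  finally show ?thesis using sigma_q_hat_const[of q \<tau> d] q2 tau_pos
    by (simp add: sigma_q_hat_def sigma_q_sq_def mult.commute)
qed

definition B2 :: real where
  "B2 = sqrt (real d * real T * q * ln (1 / \<delta>) * sigma_q_sq d q \<nu>)"

lemma sigma_q_sq_nonneg: "0 \<le> sigma_q_sq d q \<nu>"
  by (simp add: sigma_q_sq_def)

lemma B2_nonneg: "0 \<le> B2"
  unfolding B2_def using sigma_q_sq_nonneg q2 ln_inv_\<delta> by simp

text \<open>Regret against \<open>\<theta>n\<close> instead of the supremum: by Hoelder this is an
  upper bound, and it is the quantity that \<open>a_hat_regret_le\<close> controls.\<close>

definition R :: "(nat \<Rightarrow> nat \<Rightarrow> real) \<Rightarrow> nat \<Rightarrow> real" where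
  "R \<omega> t = \<theta>n - inner_d d (valee_act d q T \<delta> \<omega> t) \<theta>"

lemma R_le: "R \<omega> t \<le> 2 * \<theta>n"
  using inner_d_le_qnorm[OF valee_act_in_lp_ball, of \<omega> t \<theta>] by (simp add: R_def abs_le_iff)

lemma regret_le: "valee_regret d p T \<delta> \<nu> \<omega> \<le> (\<Sum>t<T. R \<omega> t)"
proof -
  have "unit_vec 0 \<in> lp_ball d p" using d by (intro unit_vec_in_lp_ball) simp
  then have ne: "lp_ball d p \<noteq> {}" by blast
  have "(SUP a\<in>lp_ball d p. inner_d d a \<theta>) \<le> \<theta>n"
    using ne by (intro cSUP_least) (auto dest: inner_d_le_qnorm[of _ \<theta>] simp: abs_le_iff)
  then show ?thesis unfolding valee_regret_def R_def q_def[symmetric] by (intro sum_mono) auto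
qed

lemma sum_R_le: "finite I \<Longrightarrow> sum (R \<omega>) I \<le> real (card I) * (2 * \<theta>n)"
  using sum_bounded_above[of I "R \<omega>" "2 * \<theta>n"] R_le by simp

lemma regret_le_2T: "(\<Sum>t<T. R \<omega> t) \<le> 2 * real T"
  using sum_R_le[of "{..<T}" \<omega>] theta_norm_le_1 mult_left_mono[of \<theta>n 1 "2 * real T"] by simp

text \<open>Turns coordinatewise deviations proportional to \<open>sqrt (w i)\<close> into a single
  error bound in terms of \<open>W\<close>.\<close>

lemma qnorm_scaled_sqrt_w:
  assumes "0 \<le> c"
  shows "qnorm d q (\<lambda>i. c * sqrt (w i)) = c * sqrt W"
proof -
  have "(\<Sum>i<d. \<bar>c * sqrt (w i)\<bar> powr q) = c powr q * (\<Sum>i<d. w i powr (q / 2))"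
    unfolding sum_distrib_left using assms w_pos
    by (intro sum.cong) (auto simp: powr_mult abs_mult less_imp_le powr_half_sqrt[symmetric] powr_powr)
  then have "qnorm d q (\<lambda>i. c * sqrt (w i)) = c * (\<Sum>i<d. w i powr (q / 2)) powr (1 / q)"
    unfolding qnorm_def using assms q2 by (simp add: powr_mult powr_powr sum_nonneg)
  also have "(\<Sum>i<d. w i powr (q / 2)) powr (1 / q) = sqrt W"
    unfolding W_def sigma_q_hat_def using q2 by (subst powr_half_sqrt[symmetric]) (auto simp: powr_powr)
  finally show ?thesis .
qed

end

section \<open>Deterministic analysis of one good outcome\<close>

locale valee_good = valee_model +
  fixes \<omega> :: "nat \<Rightarrow> nat \<Rightarrow> real"
  assumes \<tau>1: "\<tau> \<le> 1" and T3: "3 \<le> T" and good: "\<omega> \<in> good"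
begin

abbreviation "\<alpha> \<equiv> alpha \<omega>"
abbreviation "\<sigma>h \<equiv> sighat \<omega>"

text \<open>The common value of the two balanced costs:
  \<open>d * \<kappa> / \<alpha>\<^sup>2\<close> for a phase and
  \<open>T * q * \<sigma>h * \<alpha>\<^sup>2\<close> for exploitation, see
  \<open>H_alpha\<close>.\<close>

definition H :: real where "H = sqrt (real d * real \<kappa> * (real T * q * \<sigma>h))"

lemma space: "\<omega> \<in> space S" using good by (simp add: good_def)

lemma good_var: "i < d \<Longrightarrow> shift_seq (vstart i \<omega>) \<omega> \<notin> bad_var i"
  using good by (simp add: good_def)

lemma sighat_bounds: "W / 20 \<le> \<sigma>h" "\<sigma>h \<le> 2 * W"
proof -
  note vb = vest_bounds[OF _ \<tau>1 space good_var]
  have "sigma_q_hat d q (\<lambda>i. 1 / 20 * w i) \<le> \<sigma>h" unfolding sighat_def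
    using q2 w_pos vb by (intro sigma_q_hat_mono) (auto simp: less_imp_le)
  then show "W / 20 \<le> \<sigma>h" using sigma_q_hat_scale[of q "1/20" d w] w_pos q2 by (simp add: W_def less_imp_le)
  have "0 \<le> vest d \<omega> i" if "i < d" for i
    using vb(1)[OF that that] w_pos[of i] by linarith
  then have "\<sigma>h \<le> sigma_q_hat d q (\<lambda>i. 2 * w i)" unfolding sighat_def
    using q2 vb by (intro sigma_q_hat_mono) auto
  then show "\<sigma>h \<le> 2 * W" using sigma_q_hat_scale[of q 2 d w] w_pos q2 by (simp add: W_def less_imp_le)
qed

lemma pos: "0 < \<alpha>" "0 < \<kappa>" "0 < \<sigma>h" "0 < real d * real \<kappa>" "0 < real T * q * \<sigma>h" "0 < H"
proof -
  show a: "0 < \<alpha>" "0 < \<kappa>" "0 < \<sigma>h" using alpha_pos[OF T3] kappa_pos[OF T3] sighat_pos by auto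
  show "0 < real d * real \<kappa>" "0 < real T * q * \<sigma>h" using a d T q2 by auto
  then show "0 < H" unfolding H_def by simp
qed

lemma alpha_sq: "\<alpha>\<^sup>2 = sqrt (real d * real \<kappa> / (real T * q * \<sigma>h))"
proof -
  have "\<alpha>\<^sup>2 = (real d * real \<kappa> / (real T * q * \<sigma>h)) powr (1/2)"
    unfolding alpha_def valee_alpha_def by (simp add: power2_eq_square flip: powr_add)
  then show ?thesis using pos by (simp add: powr_half_sqrt)
qed

lemma H_alpha: "H * \<alpha>\<^sup>2 = real d * real \<kappa>" "H = real T * q * \<sigma>h * \<alpha>\<^sup>2"
proof -
  let ?X = "real d * real \<kappa>" and ?Y = "real T * q * \<sigma>h"
  have XY: "0 < ?X" "0 < ?Y" using pos by auto
  have cancel: "x * y * (x / y) = x * x" if "y \<noteq> 0" for x y :: real using that by simp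
  have cancel': "y * y * (x / y) = x * y" if "y \<noteq> 0" for x y :: real using that by simp
  have "H * \<alpha>\<^sup>2 = sqrt ?X * sqrt ?X" unfolding H_def alpha_sq real_sqrt_mult[of ?X ?Y] real_sqrt_divide[of ?X ?Y]
    using real_sqrt_gt_zero[OF XY(2)] by (intro cancel) linarith
  then show "H * \<alpha>\<^sup>2 = ?X" using XY by simp
  have "?Y * \<alpha>\<^sup>2 = (sqrt ?Y * sqrt ?Y) * (sqrt ?X / sqrt ?Y)"
    unfolding alpha_sq real_sqrt_divide[of ?X ?Y] using XY by simp
  also have "\<dots> = sqrt ?X * sqrt ?Y" using real_sqrt_gt_zero[OF XY(2)] by (intro cancel') linarith
  finally show "H = ?Y * \<alpha>\<^sup>2" unfolding H_def real_sqrt_mult[of ?X ?Y] by simp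
qed

lemma T_alpha_W: "real T * q * (\<alpha>\<^sup>2 * W) \<le> 20 * H" "real T * (\<alpha>\<^sup>2 * W) \<le> 20 * H"
proof -
  have "real T * q * (\<alpha>\<^sup>2 * W) \<le> real T * q * (\<alpha>\<^sup>2 * (20 * \<sigma>h))"
    using sighat_bounds q2 by (intro mult_left_mono) auto
  then show a: "real T * q * (\<alpha>\<^sup>2 * W) \<le> 20 * H" using H_alpha(2) by (simp add: mult.assoc mult.left_commute mult.commute)
  have "real T * 1 * (\<alpha>\<^sup>2 * W) \<le> real T * q * (\<alpha>\<^sup>2 * W)"
    using q2 W_pos by (intro mult_right_mono mult_left_mono) auto
  with a show "real T * (\<alpha>\<^sup>2 * W) \<le> 20 * H" by simp
qed

lemma N_hat_pos: "0 < N_hat j" by (simp add: N_hat_def)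

lemma plen_bounds: "8 / (\<alpha>\<^sup>2 * N_hat j) \<le> real (plen j \<omega>)" "real (plen j \<omega>) \<le> 8 / (\<alpha>\<^sup>2 * N_hat j) + 1" "0 < plen j \<omega>"
proof -
  have eq: "(\<alpha> * sqrt (N_hat j))\<^sup>2 = \<alpha>\<^sup>2 * N_hat j" using N_hat_pos[of j] by (simp add: power_mult_distrib)
  have nn: "0 \<le> 8 / (\<alpha>\<^sup>2 * N_hat j)" using N_hat_pos[of j] by simp
  show "8 / (\<alpha>\<^sup>2 * N_hat j) \<le> real (plen j \<omega>)"
    unfolding plen_def phase_len_def eq by (rule real_nat_ceiling_ge)
  show "real (plen j \<omega>) \<le> 8 / (\<alpha>\<^sup>2 * N_hat j) + 1"
    unfolding plen_def phase_len_def eq using nn by linarith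
  show "0 < plen j \<omega>" using plen_pos pos by simp
qed

lemma error_bound:
  assumes j: "1 \<le> j" "j \<le> nat \<lfloor>ln (real T)\<rfloor>"
  defines "th \<equiv> mom (plen j \<omega>) (shift_seq (pstart j \<omega>) \<omega>)"
  shows "qnorm d q (\<lambda>i. \<theta> i - th i) \<le> \<alpha> * sqrt (N_hat j * W)"
proof -
  have "\<bar>\<theta> i - th i\<bar> \<le> \<bar>\<alpha> * sqrt (N_hat j) * sqrt (w i)\<bar>" if i: "i < d" for i
  proof -
    have "shift_seq (pstart j \<omega>) \<omega> \<in> space S" using space by (rule measurable_space[OF measurable_shift_seq])
    moreover have "shift_seq (pstart j \<omega>) \<omega> \<notin> bad_phase i (plen j \<omega>)" using good i j by (simp add: good_def)
    ultimately have "\<bar>th i - \<theta> i\<bar> \<le> rad (plen j \<omega>) i" unfolding th_def by (rule not_bad_phase)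
    also have "\<dots> \<le> sqrt (\<alpha>\<^sup>2 * N_hat j * w i)" unfolding rad_def
    proof (rule real_sqrt_le_mono)
      have "8 \<le> real (plen j \<omega>) * (\<alpha>\<^sup>2 * N_hat j)"
        using plen_bounds(1)[of j] pos N_hat_pos[of j] by (simp add: pos_divide_le_eq)
      then have "8 * w i \<le> real (plen j \<omega>) * (\<alpha>\<^sup>2 * N_hat j) * w i" using w_pos[of i] by (intro mult_right_mono) auto
      then show "8 * w i / real (plen j \<omega>) \<le> \<alpha>\<^sup>2 * N_hat j * w i"
        using plen_bounds(3)[of j] by (simp add: pos_divide_le_eq mult.assoc mult.left_commute mult.commute)
    qed
    also have "\<dots> = \<alpha> * sqrt (N_hat j) * sqrt (w i)" using pos by (simp add: real_sqrt_mult)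
    finally show ?thesis by linarith
  qed
  then have "qnorm d q (\<lambda>i. \<theta> i - th i) \<le> qnorm d q (\<lambda>i. \<alpha> * sqrt (N_hat j) * sqrt (w i))"
    using q2 by (intro qnorm_mono) auto
  also have "\<dots> = \<alpha> * sqrt (N_hat j) * sqrt W"
    using pos N_hat_pos[of j] by (intro qnorm_scaled_sqrt_w) (auto simp: less_imp_le)
  finally show ?thesis by (simp add: real_sqrt_mult mult.assoc)
qed

text \<open>\<open>160 * H\<close> covers the case of small \<open>N_hat j\<close>, and
  \<open>64 * H\<close> the other one, where rounding up the block length adds the second
  summand.\<close>

definition pcost :: real where "pcost = 160 * H + 2 * (real d * real \<kappa>)"

text \<open>If \<open>N_hat j\<close> is below \<open>\<alpha>\<^sup>2 W\<close>, then the gap is so small that even playing arbitrary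
  actions for all \<open>T\<close> rounds is affordable.\<close>

lemma phase_cost:
  assumes \<theta>: "\<theta>n \<le> 2 * N_hat j + \<alpha> * sqrt (2 * N_hat j * W)"
    and n: "n \<le> real T" "n \<le> real (\<kappa> * d * plen j \<omega>)" "0 \<le> n"
  shows "n * (2 * \<theta>n) \<le> pcost"
proof (cases "N_hat j < \<alpha>\<^sup>2 * W")
  case True
  have "\<alpha> * sqrt (2 * N_hat j * W) = sqrt (\<alpha>\<^sup>2 * (2 * N_hat j * W))"
    using pos by (simp add: real_sqrt_mult)
  also have "\<dots> \<le> sqrt ((2 * (\<alpha>\<^sup>2 * W))\<^sup>2)"
  proof (rule real_sqrt_le_mono)
    have "\<alpha>\<^sup>2 * (2 * N_hat j * W) = N_hat j * (2 * (\<alpha>\<^sup>2 * W))" by simp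
    also have "\<dots> \<le> (2 * (\<alpha>\<^sup>2 * W)) * (2 * (\<alpha>\<^sup>2 * W))" using True W_pos N_hat_pos[of j] by (intro mult_right_mono) auto
    finally show "\<alpha>\<^sup>2 * (2 * N_hat j * W) \<le> (2 * (\<alpha>\<^sup>2 * W))\<^sup>2" by (simp only: power2_eq_square)
  qed
  also have "\<dots> = 2 * (\<alpha>\<^sup>2 * W)" using W_pos by (subst real_sqrt_abs) simp
  finally have "\<theta>n \<le> 4 * (\<alpha>\<^sup>2 * W)" using \<theta> True by linarith
  then have "n * (2 * \<theta>n) \<le> real T * (2 * (4 * (\<alpha>\<^sup>2 * W)))" using n by (intro mult_mono) auto
  also have "\<dots> = 8 * (real T * (\<alpha>\<^sup>2 * W))" by simp
  also have "\<dots> \<le> 8 * (20 * H)" using T_alpha_W(2) by (intro mult_left_mono) auto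
  also have "\<dots> \<le> pcost" using pos by (simp add: pcost_def)
  finally show ?thesis .
next
  case False
  have N0: "0 < N_hat j" by (rule N_hat_pos)
  have "\<alpha> * sqrt (2 * N_hat j * W) = sqrt (\<alpha>\<^sup>2 * (2 * N_hat j * W))"
    using pos by (simp add: real_sqrt_mult)
  also have "\<dots> \<le> sqrt ((2 * N_hat j)\<^sup>2)"
  proof (rule real_sqrt_le_mono)
    have "\<alpha>\<^sup>2 * (2 * N_hat j * W) = (\<alpha>\<^sup>2 * W) * (2 * N_hat j)" by simp
    also have "\<dots> \<le> (2 * N_hat j) * (2 * N_hat j)" using False N0 by (intro mult_right_mono) auto
    finally show "\<alpha>\<^sup>2 * (2 * N_hat j * W) \<le> (2 * N_hat j)\<^sup>2" by (simp only: power2_eq_square)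
  qed
  also have "\<dots> = 2 * N_hat j" using N0 by (subst real_sqrt_abs) simp
  finally have th4: "\<theta>n \<le> 4 * N_hat j" using \<theta> by linarith
  let ?D = "real d * real \<kappa>"
  have D: "0 < ?D" by (rule pos)
  have "n * (2 * \<theta>n) \<le> real (\<kappa> * d * plen j \<omega>) * (2 * \<theta>n)" using n by (intro mult_right_mono) auto
  also have "\<dots> = ?D * real (plen j \<omega>) * (2 * \<theta>n)" by (simp add: mult.commute)
  also have "\<dots> \<le> ?D * (8 / (\<alpha>\<^sup>2 * N_hat j) + 1) * (2 * \<theta>n)"
    using D plen_bounds(2)[of j] by (intro mult_right_mono mult_left_mono) auto
  also have "\<dots> = ?D * (16 / (\<alpha>\<^sup>2 * N_hat j)) * \<theta>n + 2 * ?D * \<theta>n" by (simp add: algebra_simps)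
  \<comment> \<open>In the main term \<open>\<theta>n \<le> 4 * N_hat j\<close> cancels the growth
    of the phase length; in the rounding term \<open>\<theta>n \<le> 1\<close> suffices.\<close>
  also have "\<dots> \<le> ?D * (16 / (\<alpha>\<^sup>2 * N_hat j)) * (4 * N_hat j) + 2 * ?D * 1"
    using D N0 pos th4 theta_norm_le_1 by (intro add_mono mult_left_mono) auto
  also have "?D * (16 / (\<alpha>\<^sup>2 * N_hat j)) * (4 * N_hat j) = 64 * (?D / \<alpha>\<^sup>2)" using N0 by simp
  also have "?D / \<alpha>\<^sup>2 = H" unfolding H_alpha(1)[symmetric] using pos by simp
  also have "64 * H + 2 * ?D * 1 \<le> pcost" using pos by (simp add: pcost_def)
  finally show ?thesis .
qed

text \<open>The truncation keeps the estimated variances of order at least \<open>\<tau>\<close>; by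
  \<open>G_sq\<close> the square of \<open>H\<close> is then at least \<open>8/20\<close> of that of
  \<open>G\<close>.\<close>

lemma H_ge: "G / 2 \<le> H"
proof -
  have "(G / 2)\<^sup>2 \<le> (8/20) * G\<^sup>2" by (simp add: power_divide)
  also have "\<dots> = real d * (8 * Ld) * (real T * q * (\<tau> * real d powr (2 / q) / 20))"
    unfolding G_sq[symmetric] by simp
  also have "\<dots> \<le> real d * real \<kappa> * (real T * q * \<sigma>h)"
  proof (intro mult_mono mult_left_mono)
    show "8 * Ld \<le> real \<kappa>" by (rule kappa_bounds[OF T3])
    show "\<tau> * real d powr (2 / q) / 20 \<le> \<sigma>h" using W_ge sighat_bounds by linarith
  qed (use q2 tau_pos Ld_pos in auto)
  finally have "(G / 2)\<^sup>2 \<le> real d * real \<kappa> * (real T * q * \<sigma>h)" .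
  then have "sqrt ((G / 2)\<^sup>2) \<le> H" unfolding H_def by (rule real_sqrt_le_mono)
  then show ?thesis using G_pos by simp
qed

text \<open>Phase \<open>j\<close> lasts at least \<open>4 * 2 ^ j * H\<close> rounds, hence at
  least \<open>2 * 2 ^ j * G\<close>. Cubing and inserting \<open>G_cube_ge\<close> gives
  \<open>4 * 8 ^ j \<le> T\<^sup>2\<close>, and \<open>ln 8 \<ge> 2\<close> turns this into the
  bound by \<open>ln T\<close> on which the union bound relies.\<close>

lemma phase_count:
  assumes fits: "\<kappa> * d * plen j \<omega> \<le> T"
  shows "j \<le> nat \<lfloor>ln (real T)\<rfloor>"
proof -
  have "real d * real \<kappa> * (8 / (\<alpha>\<^sup>2 * N_hat j)) \<le> real d * real \<kappa> * real (plen j \<omega>)"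
    using plen_bounds(1) by (intro mult_left_mono) auto
  also have "\<dots> = real (\<kappa> * d * plen j \<omega>)" by simp
  also have "\<dots> \<le> real T" using fits by (simp only: of_nat_le_iff)
  finally have "real d * real \<kappa> * (8 / (\<alpha>\<^sup>2 * N_hat j)) \<le> real T" .
  moreover have "real d * real \<kappa> * (8 / (\<alpha>\<^sup>2 * N_hat j)) = 4 * 2 ^ j * H"
    unfolding H_alpha(1)[symmetric] using pos by (simp add: N_hat_def)
  ultimately have "4 * 2 ^ j * H \<le> real T" by simp
  moreover have "4 * 2 ^ j * (G / 2) \<le> 4 * 2 ^ j * H" using H_ge by (intro mult_left_mono) auto
  ultimately have "2 * 2 ^ j * G \<le> real T" by linarith
  then have "(2 * 2 ^ j * G) ^ 3 \<le> real T ^ 3" using G_pos by (intro power_mono) auto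
  moreover have "(2 * 2 ^ j * G) ^ 3 = 8 * 8 ^ j * G ^ 3"
  proof -
    have "((2::real) ^ j) ^ 3 = (2 ^ 3) ^ j" by (simp only: power_mult[symmetric] mult.commute)
    then show ?thesis by (simp add: power_mult_distrib)
  qed
  moreover have "8 * 8 ^ j * (real T / 2) \<le> 8 * 8 ^ j * G ^ 3" using G_cube_ge by (intro mult_left_mono) auto
  ultimately have "8 * 8 ^ j * (real T / 2) \<le> real T ^ 3" by linarith
  then have "real T * (4 * 8 ^ j) \<le> real T * (real T)\<^sup>2" by (simp add: power3_eq_cube power2_eq_square)
  then have "4 * 8 ^ j \<le> (real T)\<^sup>2" using T by (subst (asm) mult_le_cancel_left_pos) auto
  then have "(8::real) ^ j \<le> (real T)\<^sup>2" using zero_le_power[of "8::real" j] by linarith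
  then have "ln ((8::real) ^ j) \<le> ln ((real T)\<^sup>2)" using T by (subst ln_le_cancel_iff) auto
  then have "real j * ln 8 \<le> 2 * ln (real T)" using T by (simp add: ln_realpow)
  moreover have "2 \<le> ln (8::real)"
  proof -
    have "ln (8::real) = ln (2 ^ 3)" by simp
    also have "\<dots> = 3 * ln 2" by (subst ln_realpow) auto
    finally show ?thesis using ln2_ge_two_thirds by simp
  qed
  then have "real j * 2 \<le> real j * ln 8" by (intro mult_left_mono) auto
  ultimately have "real j \<le> ln (real T)" by linarith
  then show ?thesis by (simp add: le_nat_floor)
qed

text \<open>The squared error is proportional to \<open>N_hat j\<close>, and the stopping test
  bounds \<open>N_hat j\<close> by the very norm that \<open>a_hat_regret_le\<close> divides
  by.\<close>

lemma exploit_regret: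
  assumes j: "1 \<le> j" "j \<le> nat \<lfloor>ln (real T)\<rfloor>"
  defines "th \<equiv> mom (plen j \<omega>) (shift_seq (pstart j \<omega>) \<omega>)"
  assumes stop: "N_hat j < qnorm d q th"
  shows "\<theta>n - inner_d d (a_hat d q th) \<theta> \<le> 3 * q * (\<alpha>\<^sup>2 * W)"
proof -
  have N0: "0 < N_hat j" by (rule N_hat_pos)
  have th0: "0 < qnorm d q th" using stop N0 by linarith
  have "(qnorm d q (\<lambda>i. \<theta> i - th i))\<^sup>2 \<le> (\<alpha> * sqrt (N_hat j * W))\<^sup>2"
    using error_bound[OF j] unfolding th_def by (intro power_mono) auto
  also have "\<dots> = \<alpha>\<^sup>2 * W * N_hat j" using N0 W_pos by (simp add: power_mult_distrib)
  also have "\<dots> \<le> \<alpha>\<^sup>2 * W * qnorm d q th" using stop W_pos by (intro mult_left_mono) auto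
  finally have "(qnorm d q (\<lambda>i. \<theta> i - th i))\<^sup>2 / qnorm d q th \<le> \<alpha>\<^sup>2 * W" using th0 by (simp add: pos_divide_le_eq)
  then have "3 * q * ((qnorm d q (\<lambda>i. \<theta> i - th i))\<^sup>2 / qnorm d q th) \<le> 3 * q * (\<alpha>\<^sup>2 * W)"
    using q2 by (intro mult_left_mono) auto
  then show ?thesis using a_hat_regret_le[OF th0, of \<theta>] by simp
qed

text \<open>Induction on the number \<open>k\<close> of phases still possible. The hypothesis on
  \<open>\<theta>n\<close> is what a failed stopping test in the previous phase yields, rewritten
  with \<open>N_hat (j - 1) = 2 * N_hat j\<close>.\<close>

lemma explore_regret:
  assumes "states \<omega> (pstart j \<omega>) = Explore \<alpha> \<kappa> j 0 0 0 0 tab" "1 \<le> j" "pstart j \<omega> \<le> T"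
    and "\<theta>n \<le> 2 * N_hat j + \<alpha> * sqrt (2 * N_hat j * W)"
    and "j + k = nat \<lfloor>ln (real T)\<rfloor> + 1"
  shows "(\<Sum>t=pstart j \<omega>..<T. R \<omega> t) \<le> real (k + 1) * pcost + 60 * H"
  using assms
proof (induction k arbitrary: j tab)
  case (0 j tab)
  have "\<not> \<kappa> * d * plen j \<omega> \<le> T" using phase_count[of j] 0 by auto
  have "(\<Sum>t=pstart j \<omega>..<T. R \<omega> t) \<le> real (T - pstart j \<omega>) * (2 * \<theta>n)"
    using sum_R_le[of "{pstart j \<omega>..<T}"] by simp
  also have "\<dots> \<le> pcost"
  proof (rule phase_cost[OF 0(4)])
    show "real (T - pstart j \<omega>) \<le> real (\<kappa> * d * plen j \<omega>)"
      using \<open>\<not> _\<close> by (simp only: of_nat_le_iff)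
  qed auto
  finally show ?case using pos by simp
next
  case (Suc k j tab)
  let ?n = "\<kappa> * d * plen j \<omega>"
  have ps: "pstart (Suc j) \<omega> = pstart j \<omega> + ?n" using Suc.prems(2) by simp
  have pc0: "0 \<le> pcost" using pos by (simp add: pcost_def)
  show ?case
  proof (cases "pstart (Suc j) \<omega> \<le> T")
    case False
    have "(\<Sum>t=pstart j \<omega>..<T. R \<omega> t) \<le> real (T - pstart j \<omega>) * (2 * \<theta>n)"
      using sum_R_le[of "{pstart j \<omega>..<T}"] by simp
    also have "\<dots> \<le> pcost"
    proof (rule phase_cost[OF Suc.prems(4)])
      show "real (T - pstart j \<omega>) \<le> real ?n"
        using False ps by (simp only: of_nat_le_iff)
    qed auto
    also have "\<dots> \<le> real (Suc k + 1) * pcost + 60 * H"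
      using pos pc0 mult_right_mono[of 1 "real (Suc k + 1)" pcost] by simp
    finally show ?thesis .
  next
    case True
    have j: "1 \<le> j" "j \<le> nat \<lfloor>ln (real T)\<rfloor>" using Suc.prems phase_count[of j] True ps by auto
    define th where "th = mom (plen j \<omega>) (shift_seq (pstart j \<omega>) \<omega>)"
    have st: "states \<omega> (pstart (Suc j) \<omega>) = (if N_hat j < qnorm d q th then Exploit (a_hat d q th)
       else Explore \<alpha> \<kappa> (Suc j) 0 0 0 0 (\<lambda>_ _. 0))"
      using states_phase_end[OF Suc.prems(1)] plen_bounds(3)[of j] pos
      unfolding ps th_def plen_def by simp
    have split: "(\<Sum>t=pstart j \<omega>..<T. R \<omega> t)
        = (\<Sum>t=pstart j \<omega>..<pstart (Suc j) \<omega>. R \<omega> t) + (\<Sum>t=pstart (Suc j) \<omega>..<T. R \<omega> t)"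
      using True ps by (intro sum.atLeastLessThan_concat[symmetric]) auto
    have "(\<Sum>t=pstart j \<omega>..<pstart (Suc j) \<omega>. R \<omega> t) \<le> real ?n * (2 * \<theta>n)"
      using sum_R_le[of "{pstart j \<omega>..<pstart (Suc j) \<omega>}"] ps by simp
    also have "\<dots> \<le> pcost"
      using True ps by (intro phase_cost[OF Suc.prems(4)]) (simp_all only: of_nat_le_iff of_nat_0_le_iff)
    finally have one: "(\<Sum>t=pstart j \<omega>..<pstart (Suc j) \<omega>. R \<omega> t) \<le> pcost" .
    show ?thesis
    proof (cases "N_hat j < qnorm d q th")
      case exit: True
      have st': "states \<omega> (pstart (Suc j) \<omega>) = Exploit (a_hat d q th)"
        using st exit by (simp only: if_True)
      have r: "R \<omega> t \<le> 3 * q * (\<alpha>\<^sup>2 * W)" if "t \<in> {pstart (Suc j) \<omega>..<T}" for t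
      proof -
        have "states \<omega> t = Exploit (a_hat d q th)"
          using that by (intro states_exploit[OF st']) (simp only: atLeastLessThan_iff)
        then have "R \<omega> t = \<theta>n - inner_d d (a_hat d q th) \<theta>" by (simp add: R_def valee_act_def)
        then show ?thesis using exploit_regret[OF j] exit unfolding th_def by simp
      qed
      have "(\<Sum>t=pstart (Suc j) \<omega>..<T. R \<omega> t) \<le> real (T - pstart (Suc j) \<omega>) * (3 * q * (\<alpha>\<^sup>2 * W))"
        using sum_bounded_above[of "{pstart (Suc j) \<omega>..<T}" "R \<omega>", OF r] by (simp only: card_atLeastLessThan)
      also have "\<dots> \<le> real T * (3 * q * (\<alpha>\<^sup>2 * W))"
        using q2 W_pos by (intro mult_right_mono) auto
      also have "\<dots> = 3 * (real T * q * (\<alpha>\<^sup>2 * W))" by simp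
      also have "\<dots> \<le> 60 * H" using T_alpha_W(1) by linarith
      finally have "(\<Sum>t=pstart j \<omega>..<T. R \<omega> t) \<le> pcost + 60 * H" using split one by linarith
      also have "\<dots> \<le> real (Suc k + 1) * pcost + 60 * H"
        using pc0 mult_right_mono[of 1 "real (Suc k + 1)" pcost] by simp
      finally show ?thesis .
    next
      case cont: False
      have "\<theta>n \<le> qnorm d q th + qnorm d q (\<lambda>i. \<theta> i - th i)"
        using qnorm_triangle[of th "\<lambda>i. \<theta> i - th i"] by simp
      also have "\<dots> \<le> N_hat j + \<alpha> * sqrt (N_hat j * W)"
        using cont error_bound[OF j] unfolding th_def by linarith
      also have "\<dots> = 2 * N_hat (Suc j) + \<alpha> * sqrt (2 * N_hat (Suc j) * W)" by (simp add: N_hat_def)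
      finally have "\<theta>n \<le> 2 * N_hat (Suc j) + \<alpha> * sqrt (2 * N_hat (Suc j) * W)" .
      moreover have "states \<omega> (pstart (Suc j) \<omega>) = Explore \<alpha> \<kappa> (Suc j) 0 0 0 0 (\<lambda>_ _. 0)"
        using st cont by (simp only: if_False)
      moreover have "Suc j + k = nat \<lfloor>ln (real T)\<rfloor> + 1" using Suc.prems(5) by simp
      ultimately have "(\<Sum>t=pstart (Suc j) \<omega>..<T. R \<omega> t) \<le> real (k + 1) * pcost + 60 * H"
        using True by (intro Suc.IH[of "Suc j" "\<lambda>_ _. 0"]) (assumption | simp only: le_add1 Suc_eq_plus1_left)+
      then show ?thesis using split one by (simp add: algebra_simps)
    qed
  qed
qed

lemma vstart_le: "i \<le> d \<Longrightarrow> real (vstart i \<omega>) \<le> real i * (20 * Y1 / \<tau>)"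
proof (induction i)
  case (Suc i)
  define c where "c = 20 * Y1 / \<tau>"
  have "real (nvar i \<omega>) \<le> 10 * Y1 / \<tau>" using Suc.prems by (intro vest_bounds(3)[OF _ \<tau>1 space good_var]) auto
  then have "2 * real (nvar i \<omega>) \<le> c" by (simp add: c_def)
  moreover have "real (vstart i \<omega>) \<le> real i * c" using Suc unfolding c_def by simp
  ultimately show ?case unfolding c_def[symmetric] by (simp add: nvar_def[symmetric] distrib_right)
qed simp

lemma vstart_d_le: "real (vstart d \<omega>) \<le> 1000 * G"
proof -
  have "real (vstart d \<omega>) \<le> real d * (20 * Y1 / \<tau>)" by (rule vstart_le) simp
  also have "\<dots> \<le> real d * (20 * (50 * Ld) / \<tau>)"
    using Y1_bounds(3) tau_pos by (intro mult_left_mono divide_right_mono) auto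
  also have "\<dots> = 1000 * G" by (simp add: G_def)
  finally show ?thesis .
qed

lemma total_regret: "(\<Sum>t<T. R \<omega> t) \<le> 2000 * G + (ln (real T) + 1) * pcost + 60 * H"
proof -
  have pc0: "0 \<le> pcost" using pos by (simp add: pcost_def)
  have lnT: "0 \<le> ln (real T)" using lnT_ge_1[OF T3] by simp
  have ve: "real n * (2 * \<theta>n) \<le> 2000 * G" if "n \<le> vstart d \<omega>" for n
  proof -
    have "real n * (2 * \<theta>n) \<le> real (vstart d \<omega>) * (2 * 1)"
      using that theta_norm_le_1 by (intro mult_mono) auto
    then show ?thesis using vstart_d_le by simp
  qed
  show ?thesis
  proof (cases "vstart d \<omega> \<le> T")
    case False
    have "(\<Sum>t<T. R \<omega> t) \<le> real T * (2 * \<theta>n)" using sum_R_le[of "{..<T}"] by simp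
    also have "\<dots> \<le> 2000 * G" using False by (intro ve) simp
    finally show ?thesis using pc0 lnT pos by (simp add: add_increasing2)
  next
    case True
    have p1: "pstart 1 \<omega> = vstart d \<omega>" by simp
    have "0 \<le> \<alpha> * sqrt (2 * N_hat 1 * W)" using pos W_pos by (simp add: N_hat_def)
    \<comment> \<open>No test precedes the first phase; \<open>2 * N_hat 1 = 2\<close> dominates
      \<open>\<theta>n \<le> 1\<close>.\<close>
    then have "\<theta>n \<le> 2 * N_hat 1 + \<alpha> * sqrt (2 * N_hat 1 * W)"
      using theta_norm_le_1 by (simp add: N_hat_def)
    then have "(\<Sum>t=pstart 1 \<omega>..<T. R \<omega> t) \<le> real (nat \<lfloor>ln (real T)\<rfloor> + 1) * pcost + 60 * H"
      using states_explore_start[of \<omega>] True p1 by (intro explore_regret) auto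
    also have "\<dots> \<le> (ln (real T) + 1) * pcost + 60 * H"
      using pc0 lnT of_nat_floor[of "ln (real T)"] by (intro add_right_mono mult_right_mono) auto
    finally have a: "(\<Sum>t=vstart d \<omega>..<T. R \<omega> t) \<le> (ln (real T) + 1) * pcost + 60 * H" unfolding p1 .
    have "(\<Sum>t<vstart d \<omega>. R \<omega> t) \<le> real (vstart d \<omega>) * (2 * \<theta>n)"
      using sum_R_le[of "{..<vstart d \<omega>}" \<omega>] by simp
    also have "\<dots> \<le> 2000 * G" by (rule ve) simp
    finally have "(\<Sum>t<vstart d \<omega>. R \<omega> t) \<le> 2000 * G" .
    moreover have "(\<Sum>t<T. R \<omega> t) = (\<Sum>t<vstart d \<omega>. R \<omega> t) + (\<Sum>t=vstart d \<omega>..<T. R \<omega> t)"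
      using True sum.atLeastLessThan_concat[of 0 "vstart d \<omega>" T "R \<omega>"] by (simp add: atLeast0LessThan)
    ultimately show ?thesis using a by linarith
  qed
qed

text \<open>Splitting \<open>W\<close> into the true variances and \<open>\<tau>\<close> calls for
  two bounds of \<open>\<kappa>\<close>: one by \<open>ln (1 / \<delta>)\<close>, which produces
  \<open>B2\<close>, and one by \<open>Ld\<close>, for which \<open>G_sq\<close> applies.\<close>

lemma H_le: "H \<le> 17 * \<Lambda> * B2 + 10 * \<Lambda> * G"
proof -
  let ?L = "ln (1 / \<delta>)" and ?D = "real d * (real T * q)" and ?s = "sigma_q_sq d q \<nu>" and ?t = "\<tau> * real d powr (2 / q)"
  have D: "0 \<le> ?D" using q2 by simp
  have t0: "0 \<le> ?t" using tau_pos by simp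
  have s0: "0 \<le> ?s" by (rule sigma_q_sq_nonneg)
  have k1: "real \<kappa> \<le> 22 * \<Lambda> * Ld" by (rule kappa_bounds[OF T3])
  also have "\<dots> \<le> 22 * \<Lambda> * (3 * \<Lambda> * ?L)" using Ld_le \<Lambda>_ge by (intro mult_left_mono) auto
  finally have k2: "real \<kappa> \<le> 66 * \<Lambda>\<^sup>2 * ?L" by (simp add: power2_eq_square)
  have "real d * real \<kappa> * (real T * q * \<sigma>h) = ?D * real \<kappa> * \<sigma>h" by simp
  also have "\<dots> \<le> ?D * real \<kappa> * (4 * (?s + ?t))"
    using W_le sighat_bounds(2) D by (intro mult_left_mono) auto
  also have "\<dots> = 4 * (?D * real \<kappa> * ?s) + 4 * (?D * real \<kappa> * ?t)" by (simp add: algebra_simps)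
  also have "\<dots> \<le> 4 * (?D * (66 * \<Lambda>\<^sup>2 * ?L) * ?s) + 4 * (?D * (22 * \<Lambda> * Ld) * ?t)"
    using k1 k2 D s0 t0 by (intro add_mono mult_left_mono mult_right_mono) auto
  also have "4 * (?D * (66 * \<Lambda>\<^sup>2 * ?L) * ?s) = 264 * \<Lambda>\<^sup>2 * (real d * real T * q * ?L * ?s)" by simp
  also have "real d * real T * q * ?L * ?s = B2\<^sup>2"
    unfolding B2_def using s0 q2 ln_inv_\<delta> by (subst real_sqrt_pow2) auto
  also have "4 * (?D * (22 * \<Lambda> * Ld) * ?t) = 88 * \<Lambda> * (real d * Ld * (real T * q) * ?t)" by simp
  also have "\<dots> = 88 * \<Lambda> * G\<^sup>2" by (simp only: G_sq)
  also have "\<dots> \<le> 100 * \<Lambda>\<^sup>2 * G\<^sup>2"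
  proof -
    have "\<Lambda> * 1 \<le> \<Lambda> * \<Lambda>" using \<Lambda>_ge by (intro mult_left_mono) auto
    then show ?thesis using \<Lambda>_ge by (intro mult_right_mono) (auto simp: power2_eq_square)
  qed
  \<comment> \<open>The constants 17 and 10 satisfy \<open>17\<^sup>2 = 289 \<ge> 264\<close> and
    \<open>10\<^sup>2 = 100\<close>.\<close>
  also have "264 * \<Lambda>\<^sup>2 * B2\<^sup>2 + 100 * \<Lambda>\<^sup>2 * G\<^sup>2 \<le> (17 * \<Lambda> * B2 + 10 * \<Lambda> * G)\<^sup>2"
  proof -
    have B20: "0 \<le> B2" by (rule B2_nonneg)
    have "(17 * \<Lambda> * B2 + 10 * \<Lambda> * G)\<^sup>2 = 289 * (\<Lambda>\<^sup>2 * B2\<^sup>2) + 100 * (\<Lambda>\<^sup>2 * G\<^sup>2) + 340 * (\<Lambda>\<^sup>2 * (B2 * G))"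
      by (simp add: power2_eq_square algebra_simps)
    moreover have "0 \<le> \<Lambda>\<^sup>2 * (B2 * G)" "0 \<le> \<Lambda>\<^sup>2 * B2\<^sup>2" using B20 G_pos by auto
    ultimately show ?thesis by linarith
  qed
  finally have "real d * real \<kappa> * (real T * q * \<sigma>h) \<le> (17 * \<Lambda> * B2 + 10 * \<Lambda> * G)\<^sup>2" by simp
  then have "H \<le> sqrt ((17 * \<Lambda> * B2 + 10 * \<Lambda> * G)\<^sup>2)" unfolding H_def by (rule real_sqrt_le_mono)
  moreover have "0 \<le> 17 * \<Lambda> * B2 + 10 * \<Lambda> * G"
    using \<Lambda>_ge G_pos B2_nonneg by auto
  ultimately show ?thesis by simp
qed

lemma good_regret: "(\<Sum>t<T. R \<omega> t) \<le> 26000 * \<Lambda> ^ 3 * (B1 + B2)"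
proof -
  have L1: "1 \<le> \<Lambda>" by (rule \<Lambda>_ge)
  have B20: "0 \<le> B2" by (rule B2_nonneg)
  have G0: "0 < G" by (rule G_pos)
  have dk: "real d * real \<kappa> \<le> 22 * \<Lambda> * G"
  proof -
    have "real d * real \<kappa> \<le> real d * (22 * \<Lambda> * Ld)" using kappa_bounds[OF T3] by (intro mult_left_mono) auto
    also have "\<dots> = 22 * \<Lambda> * (real d * Ld)" by simp
    also have "\<dots> = 22 * \<Lambda> * (\<tau> * G)" by (simp only: dLd)
    also have "\<dots> \<le> 22 * \<Lambda> * (1 * G)" using \<tau>1 G0 L1 by (intro mult_left_mono mult_right_mono) auto
    finally show ?thesis by simp
  qed
  define x where "x = \<Lambda> * B2 + \<Lambda> * G"
  have x0: "0 \<le> \<Lambda> * B2" "0 \<le> \<Lambda> * G" using L1 B20 G0 by auto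
  have Hx: "H \<le> 17 * x" using H_le x0 unfolding x_def by simp
  \<comment> \<open>\<open>2764 = 160 * 17 + 2 * 22\<close>.\<close>
  have pc: "pcost \<le> 2764 * x" unfolding pcost_def using Hx dk x0 unfolding x_def by simp
  have "(ln (real T) + 1) * pcost \<le> (2 * \<Lambda>) * (2764 * x)"
    using pc \<Lambda>_ge pos lnT_ge_1[OF T3] by (intro mult_mono) (auto simp: pcost_def)
  moreover have "x \<le> \<Lambda> * x" "G \<le> \<Lambda> * x"
  proof -
    show *: "x \<le> \<Lambda> * x" using L1 x0 mult_right_mono[of 1 \<Lambda> x] by (simp add: x_def)
    have "G \<le> \<Lambda> * G" using L1 G0 mult_right_mono[of 1 \<Lambda> G] by simp
    also have "\<dots> \<le> x" using x0 by (simp add: x_def)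
    finally show "G \<le> \<Lambda> * x" using * by linarith
  qed
  \<comment> \<open>\<open>8548 = 2000 + 2 * 2764 + 60 * 17\<close>; converting \<open>G\<close>
    into \<open>B1\<close> below costs a further factor 3 and the third power of
    \<open>\<Lambda>\<close>.\<close>
  ultimately have "(\<Sum>t<T. R \<omega> t) \<le> 8548 * (\<Lambda> * x)" using total_regret Hx by linarith
  also have "8548 * (\<Lambda> * x) \<le> 26000 * \<Lambda> ^ 3 * (B1 + B2)"
  proof -
    have "\<Lambda>\<^sup>2 * G \<le> \<Lambda>\<^sup>2 * (3 * \<Lambda> * B1)" using G_le by (intro mult_left_mono) auto
    then have "\<Lambda>\<^sup>2 * G \<le> 3 * (\<Lambda> ^ 3 * B1)" by (simp add: power2_eq_square power3_eq_cube)
    moreover have "\<Lambda>\<^sup>2 * B2 \<le> \<Lambda> ^ 3 * B2"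
      using L1 B20 by (intro mult_right_mono power_increasing) auto
    moreover have "0 \<le> \<Lambda> ^ 3 * B2" "0 \<le> \<Lambda> ^ 3 * B1" using L1 B20 by (auto simp: B1_def)
    moreover have "\<Lambda> * x = \<Lambda>\<^sup>2 * B2 + \<Lambda>\<^sup>2 * G" by (simp add: x_def power2_eq_square algebra_simps)
    moreover have "26000 * \<Lambda> ^ 3 * (B1 + B2) = 26000 * (\<Lambda> ^ 3 * B1) + 26000 * (\<Lambda> ^ 3 * B2)"
      by (simp add: algebra_simps)
    ultimately show ?thesis by linarith
  qed
  finally show ?thesis .
qed

end

section \<open>From good outcomes to high probability\<close>

lemma (in valee_model) regret_high_probability:
  "\<exists>E\<in>sets S. 1 - 2 * \<delta> \<le> measure S E \<and>
     (\<forall>\<omega>\<in>E. valee_regret d p T \<delta> \<nu> \<omega> \<le> 26000 * \<Lambda> ^ 3 * (B1 + B2))"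
proof (cases "\<tau> \<le> 1 \<and> 3 \<le> T")
  case True
  show ?thesis
  proof (rule bexI[of _ good], intro conjI ballI)
    fix \<omega> assume "\<omega> \<in> good"
    then interpret valee_good d p q T \<delta> \<nu> \<omega>
      using True by unfold_locales auto
    show "valee_regret d p T \<delta> \<nu> \<omega> \<le> 26000 * \<Lambda> ^ 3 * (B1 + B2)"
      using regret_le[of \<omega>] good_regret by linarith
  qed (use good_prob True in auto)
next
  case False
  show ?thesis
  proof (rule bexI[of _ "space S"], intro conjI ballI)
    fix \<omega>
    have L1: "1 \<le> \<Lambda>" by (rule \<Lambda>_ge)
    have B10: "0 \<le> B1" by (simp add: B1_def)
    have "valee_regret d p T \<delta> \<nu> \<omega> \<le> 2 * real T"
      using regret_le[of \<omega>] regret_le_2T[of \<omega>] by linarith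
    also have "\<dots> \<le> 6 * G" using trivial_le_G[OF False] by simp
    also have "\<dots> \<le> 6 * (3 * \<Lambda> * B1)" using G_le by simp
    also have "\<dots> = 18 * \<Lambda> * B1" by simp
    also have "\<dots> \<le> 26000 * \<Lambda> ^ 3 * (B1 + B2)"
    proof (intro mult_mono)
      show "\<Lambda> \<le> \<Lambda> ^ 3" using L1 power_increasing[of 1 3 \<Lambda>] by simp
    qed (use L1 B10 B2_nonneg in auto)
    finally show "valee_regret d p T \<delta> \<nu> \<omega> \<le> 26000 * \<Lambda> ^ 3 * (B1 + B2)" .
  qed (use P.prob_space \<delta> in auto)
qed

theorem theorem3p9:
  "\<exists>C>0. \<exists>k::nat. \<forall>(d::nat) (p::real) (T::nat) (\<delta>::real) (\<nu>::(nat \<Rightarrow> real) measure).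
     1 \<le> d \<longrightarrow> 1 < p \<longrightarrow> p \<le> 2 \<longrightarrow> 1 \<le> T \<longrightarrow> 0 < \<delta> \<longrightarrow> \<delta> < 1 \<longrightarrow>
     prob_space \<nu> \<longrightarrow> sets \<nu> = sets (PiM {..<d} (\<lambda>_. borel)) \<longrightarrow>
     (\<forall>a\<in>lp_ball d p. AE \<theta> in \<nu>. \<bar>inner_d d a \<theta>\<bar> \<le> 1) \<longrightarrow>
     (let q = dual_exp p;
          M = PiM UNIV (\<lambda>_::nat. \<nu>)
      in \<exists>E\<in>sets M. 1 - 2 * \<delta> \<le> measure M E \<and>
           (\<forall>om\<in>E. valee_regret d p T \<delta> \<nu> om \<le>
              C * ln (exp 1 + real d * real T * q) ^ k *
              (real d powr (2/3 + 2 / (3 * q)) * ln (1 / \<delta>) powr (2/3) * (real T * q) powr (1/3)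
               + sqrt (real d * real T * q * ln (1 / \<delta>) * sigma_q_sq d q \<nu>))))"
proof (intro exI[of _ "26000::real"] conjI exI[of _ "3::nat"] allI impI)
  fix d T :: nat and p \<delta> :: real and \<nu> :: "(nat \<Rightarrow> real) measure"
  assume d: "1 \<le> d" and p: "1 < p" "p \<le> 2" and T: "1 \<le> T" and \<delta>: "0 < \<delta>" "\<delta> < 1"
    and \<nu>: "prob_space \<nu>" "sets \<nu> = sets (PiM {..<d} (\<lambda>_. borel))"
    and bd: "\<forall>a\<in>lp_ball d p. AE \<theta> in \<nu>. \<bar>inner_d d a \<theta>\<bar> \<le> 1"
  let ?q = "dual_exp p" and ?M = "PiM UNIV (\<lambda>_::nat. \<nu>)"
  have "\<exists>E\<in>sets ?M. 1 - 2 * \<delta> \<le> measure ?M E \<and>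
           (\<forall>om\<in>E. valee_regret d p T \<delta> \<nu> om \<le>
              26000 * ln (exp 1 + real d * real T * ?q) ^ 3 *
              (real d powr (2/3 + 2 / (3 * ?q)) * ln (1 / \<delta>) powr (2/3) * (real T * ?q) powr (1/3)
               + sqrt (real d * real T * ?q * ln (1 / \<delta>) * sigma_q_sq d ?q \<nu>)))"
  proof (cases "\<delta> < 1 / 2")
    case False
    \<comment> \<open>Here \<open>1 - 2 * \<delta> \<le> 0\<close>, so the empty event
      qualifies.\<close>
    then show ?thesis by (intro bexI[of _ "{}"]) auto
  next
    case True
    interpret product_prob_space "\<lambda>_. \<nu>" "UNIV :: nat set"
      by (rule product_prob_spaceI) (rule \<nu>(1))
    interpret valee_model d p ?q T \<delta> \<nu>
      using d p T \<delta>(1) True \<nu>(2) bd by unfold_locales auto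
    show ?thesis using regret_high_probability unfolding \<Lambda>_def B1_def B2_def .
  qed
  then show "let q = dual_exp p; M = PiM UNIV (\<lambda>_::nat. \<nu>)
      in \<exists>E\<in>sets M. 1 - 2 * \<delta> \<le> measure M E \<and>
           (\<forall>om\<in>E. valee_regret d p T \<delta> \<nu> om \<le>
              26000 * ln (exp 1 + real d * real T * q) ^ 3 *
              (real d powr (2/3 + 2 / (3 * q)) * ln (1 / \<delta>) powr (2/3) * (real T * q) powr (1/3)
               + sqrt (real d * real T * q * ln (1 / \<delta>) * sigma_q_sq d q \<nu>)))"
    unfolding Let_def .
qed simp

end
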